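(* Assume $(\lambda_0,s_0)=(0,1)$ is a crossing (i.e. $0\in\operatorname{Spec}(N)$) and that the first order crossing form $\mathfrak m_{\lambda_0}$ (in the $\lambda$-direction) is identically zero there. If the second order crossing form $\mathfrak m^{(2)}_{\lambda_0}$ is nondegenerate, then for $0<\varepsilon\ll1$ $$\operatorname{Mas}\big(\Lambda(\lambda,1),\mathcal D;\lambda\in[0,\varepsilon]\big)=-n_-\big(\mathfrak m^{(2)}_{\lambda_0}\big).$$
   Context: Operators. $\ell>0$, $g,h\in C^2([0,\ell],\mathbb R)$, $L_+=-\partial_{xx}-g$, $L_-=-\partial_{xx}-h$ in $L^2(0,\ell)$ with domain $H^2(0,\ell)\cap H^1_0(0,\ell)$, $N=\begin{pmatrix}0&-L_-\\ L_+&0\end{pmatrix}$ with domain $(H^2(0,\ell)\cap H^1_0(0,\ell))^2$. $S=\begin{pmatrix}0&1\\ 1&0\end{pmatrix}$; $\langle\cdot,\cdot\rangle$ is the $L^2$ inner product; functions are real-valued. Lagrangian path. For $\mathbf u=(u,v)^\top\in H^2(0,\ell)$ put $\operatorname{Tr}\mathbf u=(u(0),v(0),u(\ell),v(\ell),-u'(0),v'(0),u'(\ell),-v'(\ell))^\top\in\mathbb R^8$; $\Lambda(\lambda,1)=\{\operatorname{Tr}\mathbf u:\mathbf u\in H^2(0,\ell),\ N\mathbf u=\lambda\mathbf u\}$ for $\lambda\in\mathbb R$ (differential equation only, no boundary conditions), a Lagrangian subspace of $\mathbb R^8$; $\mathcal D=\{0\}\times\mathbb R^4$. Forms. $\Lambda(0,1)\cap\mathcal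 D=\operatorname{Tr}(\ker N)$. For $q=\operatorname{Tr}\mathbf u$ with $\mathbf u=(u,v)^\top\in\ker N$, the first order crossing form is $\mathfrak m_{\lambda_0}(q)=-\langle\mathbf u,S\mathbf u\rangle=-2\langle u,v\rangle$. If it vanishes identically, the second order crossing form is $\mathfrak m^{(2)}_{\lambda_0}(q)=-2\langle\mathbf v,S\mathbf u\rangle$, where $\mathbf v\in\operatorname{dom}(N)$ is any solution of $N\mathbf v=\mathbf u$ (it exists and the value does not depend on the choice). $n_-(\cdot)$ and $n_+(\cdot)$ denote the numbers of negative and positive squares of a quadratic form. Maslov index. On $\mathbb R^{2n}$ let $\omega(x,y)=Jx\cdot y$, $J=\begin{pmatrix}0_n&-I_n\\ I_n&0_n\end{pmatrix}$; $\mathcal L(n)$ is the set of $n$-dimensional subspaces on which $\omega$ vanishes. Fix $\Lambda_0\in\mathcal L(n)$. For a $C^1$ path $\Lambda:[a,b]\to\mathcal L(n)$, a crossing is $t_0$ with $\Lambda(t_0)\cap\Lambda_0\ne\{0\}$. Choosing a complement $W$ of $\Lambda(t_0)$, for $t$ near $t_0$, $\Lambda(t)=\{q+R_tq:q\in\Lambda(t_0)\}$ with $R_t:\Lambda(t_0)\to W$ linear, $C^1$ in $t$, $R_{t_0}=0$; the crossing form is $\mathfrak m_{t_0}(q)=\frac d{dt}\omega(q,R_tq)|_{t=t_0}$ on $\Lambda(t_0)\cap\Lambda_0$, and the crossing is regular if this is nondegenerate. With $\operatorname{sign}=n_+-n_-$, for a path with only regular crossings $\operatorname{Mas}(\Lambda(t),\Lambda_0;[a,b])=-n_-(\mathfrak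 m_a)+\sum_{a<t_0<b}\operatorname{sign}(\mathfrak m_{t_0})+n_+(\mathfrak m_b)$ (endpoint terms are $0$ if not crossings). For an arbitrary continuous path the index is that of any path with only regular crossings homotopic to it with fixed endpoints (well defined). *)

theory Defs
  imports "HOL-Analysis.Analysis"
begin

section \<open>Quadratic forms on subspaces\<close>

text \<open>
  A quadratic form is given by its values; only the values on the subspace \<open>V\<close> matter.
\<close>

definition polar_form :: "('a::euclidean_space \<Rightarrow> real) \<Rightarrow> 'a \<Rightarrow> 'a \<Rightarrow> real" where
  "polar_form Q x y = (Q (x + y) - Q x - Q y) / 2"

definition nondegenerate_on :: "'a::euclidean_space set \<Rightarrow> ('a \<Rightarrow> real) \<Rightarrow> bool" where
  "nondegenerate_on V Q \<longleftrightarrow> (\<forall>x\<in>V. (\<forall>y\<in>V. polar_form Q x y = 0) \<longrightarrow> x = 0)"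

text \<open>
  The number of negative (positive) squares, as the largest dimension of a subspace on which
  the form is negative (positive) definite.
\<close>

definition n_neg :: "'a::euclidean_space set \<Rightarrow> ('a \<Rightarrow> real) \<Rightarrow> nat" where
  "n_neg V Q = Max {dim W | W. subspace W \<and> W \<subseteq> V \<and> (\<forall>x\<in>W. x \<noteq> 0 \<longrightarrow> Q x < 0)}"

definition n_pos :: "'a::euclidean_space set \<Rightarrow> ('a \<Rightarrow> real) \<Rightarrow> nat" where
  "n_pos V Q = Max {dim W | W. subspace W \<and> W \<subseteq> V \<and> (\<forall>x\<in>W. x \<noteq> 0 \<longrightarrow> 0 < Q x)}"

definition sign_form :: "'a::euclidean_space set \<Rightarrow> ('a \<Rightarrow> real) \<Rightarrow> int" where
  "sign_form V Q = int (n_pos V Q) - int (n_neg V Q)"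


section \<open>The Lagrangian Grassmannian and the Maslov index\<close>

type_synonym 'n phase = "(real^'n) \<times> (real^'n)"

text \<open>\<open>J = (0, -I; I, 0)\<close> and \<open>\<omega>(x,y) = Jx \<bullet> y\<close>.\<close>

definition J_map :: "'n::finite phase \<Rightarrow> 'n phase" where
  "J_map x = (- snd x, fst x)"

definition omega :: "'n::finite phase \<Rightarrow> 'n phase \<Rightarrow> real" where
  "omega x y = J_map x \<bullet> y"

definition lagrangians :: "'n::finite phase set set" where
  "lagrangians = {L. subspace L \<and> dim L = CARD('n) \<and> (\<forall>x\<in>L. \<forall>y\<in>L. omega x y = 0)}"

text \<open>
  A subspace \<open>L\<close> is identified with the orthogonal projection onto it, which is
  \<open>closest_point L\<close>.  The topology on functions is that of pointwise convergence; for
  linear maps on a finite-dimensional space this is the operator norm topology, so one obtains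
  the usual topology of the Grassmannian.
\<close>

definition lagrangian_topology :: "'n::finite phase set topology" where
  "lagrangian_topology = pullback_topology lagrangians closest_point euclidean"

definition C1_lagrangian_path :: "(real \<Rightarrow> 'n::finite phase set) \<Rightarrow> real \<Rightarrow> real \<Rightarrow> bool" where
  "C1_lagrangian_path \<Gamma> a b \<longleftrightarrow>
     (\<forall>t\<in>{a..b}. \<Gamma> t \<in> lagrangians) \<and>
     (\<forall>x. \<exists>D. continuous_on {a..b} D \<and>
        (\<forall>t\<in>{a..b}. ((\<lambda>s. closest_point (\<Gamma> s) x) has_vector_derivative D t) (at t within {a..b})))"

definition crossing :: "(real \<Rightarrow> 'n::finite phase set) \<Rightarrow> 'n phase set \<Rightarrow> real \<Rightarrow> bool" where
  "crossing \<Gamma> \<Lambda>0 t \<longleftrightarrow> \<Gamma> t \<inter> \<Lambda>0 \<noteq> {0}"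

text \<open>
  If \<open>M\<close> is the graph \<open>{q + R q | q \<in> L}\<close> of a linear map \<open>R : L \<rightarrow> W\<close>, where
  \<open>W\<close> is a complement of \<open>L\<close>, then \<open>graph_map W M q = R q\<close> for \<open>q \<in> L\<close>.
\<close>

definition graph_map :: "'a::euclidean_space set \<Rightarrow> 'a set \<Rightarrow> 'a \<Rightarrow> 'a" where
  "graph_map W M q = (THE w. w \<in> W \<and> q + w \<in> M)"

text \<open>
  The crossing form does not depend on the complement \<open>W\<close>; we take the orthogonal
  complement of \<open>\<Gamma> t0\<close>.  At an endpoint of \<open>[a,b]\<close> the derivative is one-sided.
\<close>

definition crossing_form ::
    "(real \<Rightarrow> 'n::finite phase set) \<Rightarrow> real \<Rightarrow> real \<Rightarrow> real \<Rightarrow> 'n phase \<Rightarrow> real" where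
  "crossing_form \<Gamma> a b t0 q =
     vector_derivative (\<lambda>t. omega q (graph_map (orthogonal_comp (\<Gamma> t0)) (\<Gamma> t) q))
       (at t0 within {a..b})"

definition regular_path ::
    "(real \<Rightarrow> 'n::finite phase set) \<Rightarrow> 'n phase set \<Rightarrow> real \<Rightarrow> real \<Rightarrow> bool" where
  "regular_path \<Gamma> \<Lambda>0 a b \<longleftrightarrow>
     C1_lagrangian_path \<Gamma> a b \<and>
     (\<forall>t\<in>{a..b}. crossing \<Gamma> \<Lambda>0 t \<longrightarrow> nondegenerate_on (\<Gamma> t \<inter> \<Lambda>0) (crossing_form \<Gamma> a b t))"

text \<open>
  Regular crossings are isolated, so the sum is finite for a regular path.  If an endpoint is not
  a crossing, the form there lives on the zero space and its term is zero.
\<close>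

definition regular_maslov ::
    "(real \<Rightarrow> 'n::finite phase set) \<Rightarrow> 'n phase set \<Rightarrow> real \<Rightarrow> real \<Rightarrow> int" where
  "regular_maslov \<Gamma> \<Lambda>0 a b =
     - int (n_neg (\<Gamma> a \<inter> \<Lambda>0) (crossing_form \<Gamma> a b a))
     + (\<Sum>t \<in> {t. a < t \<and> t < b \<and> crossing \<Gamma> \<Lambda>0 t}.
          sign_form (\<Gamma> t \<inter> \<Lambda>0) (crossing_form \<Gamma> a b t))
     + int (n_pos (\<Gamma> b \<inter> \<Lambda>0) (crossing_form \<Gamma> a b b))"

text \<open>
  The common value of \<open>regular_maslov\<close> on all regular paths that are homotopic to
  \<open>\<Gamma>\<close> in the Lagrangian Grassmannian with fixed endpoints.
\<close>

definition maslov_index ::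
    "(real \<Rightarrow> 'n::finite phase set) \<Rightarrow> 'n phase set \<Rightarrow> real \<Rightarrow> real \<Rightarrow> int" where
  "maslov_index \<Gamma> \<Lambda>0 a b =
     (THE k. \<exists>\<Delta>. regular_path \<Delta> \<Lambda>0 a b \<and>
        homotopic_with (\<lambda>\<gamma>. \<gamma> a = \<Gamma> a \<and> \<gamma> b = \<Gamma> b)
          (top_of_set {a..b}) lagrangian_topology \<Gamma> \<Delta> \<and>
        k = regular_maslov \<Delta> \<Lambda>0 a b)"


section \<open>The operators on \<open>[0,\<ell>]\<close>\<close>

definition C2_on :: "real \<Rightarrow> (real \<Rightarrow> real) \<Rightarrow> bool" where
  "C2_on l f \<longleftrightarrow> (\<exists>f1 f2.
     (\<forall>x\<in>{0..l}. (f has_real_derivative f1 x) (at x within {0..l})) \<and>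
     (\<forall>x\<in>{0..l}. (f1 has_real_derivative f2 x) (at x within {0..l})) \<and>
     continuous_on {0..l} f2)"

definition L2 :: "real \<Rightarrow> (real \<Rightarrow> real) set" where
  "L2 l = {w. w \<in> borel_measurable (lebesgue_on {0..l}) \<and>
              integrable (lebesgue_on {0..l}) (\<lambda>x. (w x)\<^sup>2)}"

text \<open>One-sided at the endpoints.\<close>

definition dx :: "real \<Rightarrow> (real \<Rightarrow> real) \<Rightarrow> real \<Rightarrow> real" where
  "dx l u x = vector_derivative u (at x within {0..l})"

text \<open>
  \<open>w\<close> is the weak second derivative of \<open>u\<close>: \<open>u\<close> is the continuously
  differentiable representative on \<open>[0,\<ell>]\<close>, and \<open>u'\<close> is absolutely continuous with
  density \<open>w \<in> L\<^sup>2(0,\<ell>)\<close>.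
\<close>

definition weak_second_deriv :: "real \<Rightarrow> (real \<Rightarrow> real) \<Rightarrow> (real \<Rightarrow> real) \<Rightarrow> bool" where
  "weak_second_deriv l u w \<longleftrightarrow>
     (\<forall>x\<in>{0..l}. u differentiable (at x within {0..l})) \<and>
     w \<in> L2 l \<and>
     (\<forall>x\<in>{0..l}. dx l u x = dx l u 0 + (LINT t:{0..x}|lebesgue. w t))"

definition H2 :: "real \<Rightarrow> (real \<Rightarrow> real) set" where
  "H2 l = {u. \<exists>w. weak_second_deriv l u w}"

definition H10 :: "real \<Rightarrow> (real \<Rightarrow> real) set" where
  "H10 l = {u. u 0 = 0 \<and> u l = 0}"

text \<open>Determined up to a null set of \<open>[0,\<ell>]\<close>, for \<open>u \<in> H2 l\<close>.\<close>

definition dxx :: "real \<Rightarrow> (real \<Rightarrow> real) \<Rightarrow> real \<Rightarrow> real" where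
  "dxx l u = (SOME w. weak_second_deriv l u w)"

text \<open>The differential expression \<open>-\<partial>\<^sub>x\<^sub>x - g\<close>: \<open>L\<^sub>+\<close> for \<open>g\<close>, \<open>L\<^sub>-\<close> for \<open>h\<close>.\<close>

definition schroedinger :: "real \<Rightarrow> (real \<Rightarrow> real) \<Rightarrow> (real \<Rightarrow> real) \<Rightarrow> real \<Rightarrow> real" where
  "schroedinger l g u = (\<lambda>x. - dxx l u x - g x * u x)"

type_synonym fun2 = "(real \<Rightarrow> real) \<times> (real \<Rightarrow> real)"

definition N_expr :: "real \<Rightarrow> (real \<Rightarrow> real) \<Rightarrow> (real \<Rightarrow> real) \<Rightarrow> fun2 \<Rightarrow> fun2" where
  "N_expr l g h U = ((\<lambda>x. - schroedinger l h (snd U) x), schroedinger l g (fst U))"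

definition dom_N :: "real \<Rightarrow> fun2 set" where
  "dom_N l = (H2 l \<inter> H10 l) \<times> (H2 l \<inter> H10 l)"

definition S_map :: "fun2 \<Rightarrow> fun2" where
  "S_map U = (snd U, fst U)"

definition scale_fun2 :: "real \<Rightarrow> fun2 \<Rightarrow> fun2" where
  "scale_fun2 c U = ((\<lambda>x. c * fst U x), (\<lambda>x. c * snd U x))"

definition eq_ae :: "real \<Rightarrow> fun2 \<Rightarrow> fun2 \<Rightarrow> bool" where
  "eq_ae l U V \<longleftrightarrow> (AE x in lebesgue_on {0..l}. fst U x = fst V x \<and> snd U x = snd V x)"

definition inner_L2 :: "real \<Rightarrow> fun2 \<Rightarrow> fun2 \<Rightarrow> real" where
  "inner_L2 l U V = (LINT x:{0..l}|lebesgue. fst U x * fst V x + snd U x * snd V x)"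

definition ker_N :: "real \<Rightarrow> (real \<Rightarrow> real) \<Rightarrow> (real \<Rightarrow> real) \<Rightarrow> fun2 set" where
  "ker_N l g h = {U \<in> dom_N l. eq_ae l (N_expr l g h U) (\<lambda>x. 0, \<lambda>x. 0)}"


section \<open>The Lagrangian path and the crossing forms\<close>

definition Tr :: "real \<Rightarrow> fun2 \<Rightarrow> 4 phase" where
  "Tr l U = (let u = fst U; v = snd U in
     (vector [u 0, v 0, u l, v l],
      vector [- dx l u 0, dx l v 0, dx l u l, - dx l v l]))"

text \<open>The path \<open>\<lambda> \<mapsto> \<Lambda>(\<lambda>,1)\<close>; no boundary conditions are imposed.\<close>

definition Lambda_path ::
    "real \<Rightarrow> (real \<Rightarrow> real) \<Rightarrow> (real \<Rightarrow> real) \<Rightarrow> real \<Rightarrow> 4 phase set" where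
  "Lambda_path l g h c =
     {Tr l U | U. U \<in> H2 l \<times> H2 l \<and> eq_ae l (N_expr l g h U) (scale_fun2 c U)}"

definition dirichlet :: "4 phase set" where
  "dirichlet = {0} \<times> UNIV"

text \<open>
  Both forms live on \<open>Lambda_path l g h 0 \<inter> dirichlet\<close>, which is the image of
  \<open>ker_N l g h\<close> under the trace map.  The value of the first is well defined because the
  trace map is injective on the kernel, modulo values outside \<open>[0,\<ell>]\<close>.  The second one is
  meaningful only if the first vanishes identically: only then is \<open>N V = U\<close> solvable for all
  \<open>U\<close> in the kernel, with a value independent of \<open>V\<close>.
\<close>

definition first_order_form ::
    "real \<Rightarrow> (real \<Rightarrow> real) \<Rightarrow> (real \<Rightarrow> real) \<Rightarrow> 4 phase \<Rightarrow> real" where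
  "first_order_form l g h q =
     (THE r. \<exists>U \<in> ker_N l g h. q = Tr l U \<and> r = - inner_L2 l U (S_map U))"

definition second_order_form ::
    "real \<Rightarrow> (real \<Rightarrow> real) \<Rightarrow> (real \<Rightarrow> real) \<Rightarrow> 4 phase \<Rightarrow> real" where
  "second_order_form l g h q =
     (THE r. \<exists>U \<in> ker_N l g h. \<exists>V \<in> dom_N l.
        q = Tr l U \<and> eq_ae l (N_expr l g h V) U \<and> r = - 2 * inner_L2 l V (S_map U))"

end

theory Submission
  imports Defs
begin

text \<open>
  Fix a real \<open>\<tau>\<close>. The Lagrangian subspaces that meet the Lagrangian \<open>{(x, \<tau> x)}\<close> only in \<open>0\<close> form
  an open set, here called a chart. On such a subspace \<open>M\<close> the number \<open>steep \<tau> M\<close> of negative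
  squares of the quadratic form \<open>slope_form \<tau>\<close> measures the position of \<open>M\<close> with respect to the
  vertical Lagrangian \<open>{0} \<times> \<real>\<^sup>n\<close>: it is the number of slopes of \<open>M\<close> that exceed \<open>\<tau>\<close>, where \<open>M\<close> is
  the sum of a vertical space and of lines \<open>{(r x, r \<lambda> x)}\<close> of slopes \<open>\<lambda>\<close>. It jumps only when a
  slope passes through infinity, that is when \<open>M\<close> meets the vertical space. For two values \<open>\<tau> < \<sigma>\<close>
  the difference counts the slopes in between, which is the number of negative squares of a form
  nondegenerate on \<open>M\<close>, and so the difference is locally constant (\<open>steep_diff_locally_constant\<close>).
  The local functions \<open>steep \<tau>\<close> therefore glue, along a path or over a homotopy, to one
  integer-valued potential (\<open>maslov_potential_rectangle\<close>), and its drop along a path is invariant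
  under homotopies with fixed endpoints. Along a path with regular crossings the jumps of the
  potential are given by the signs of the crossing form, and the drop is the defining sum of the
  Maslov index (\<open>path_index_regular\<close>). Every path in a chart is homotopic within the chart to a
  regular path; hence the index of a path \<open>\<Gamma>\<close> on \<open>[a,b]\<close> that stays in the chart of \<open>\<tau>\<close> is \<open>steep
  \<tau> (\<Gamma> a) - steep \<tau> (\<Gamma> b)\<close> (\<open>maslov_index_in_chart\<close>).

  It remains to see by how much \<open>steep \<tau>\<close> increases when the parameter of \<open>\<Lambda>(\<lambda>,1)\<close> leaves \<open>0\<close> to
  the right. By \<open>steep_eventually_near_crossing\<close> the increase is the number of negative squares of
  a nondegenerate form \<open>b\<close> on \<open>\<Lambda>(0,1) \<inter> \<D>\<close> as soon as every \<open>q\<close> in this space is the limit of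
  vectors \<open>c(t) \<in> \<Lambda>(t,1)\<close> with \<open>\<omega>(q', c(t)) \<approx> \<delta>(t) b(q', q)\<close> for a positive scale \<open>\<delta>(t) \<rightarrow> 0\<close>,
  whichever scale that is, provided that the first half of \<open>c(t)\<close> is of order \<open>\<delta>(t)\<close>. At a regular
  crossing \<open>\<delta>\<close> is the distance to the crossing time and \<open>b\<close> is, up to the sign on the left, the
  crossing form. If the first order form vanishes, then \<open>N V = U\<close> can be solved for \<open>U\<close> in the
  kernel of \<open>N\<close> (\<open>preimage_exists\<close>), and correcting \<open>U + t V\<close> by a term of second order gives a
  curve with \<open>\<delta>(t) = t\<^sup>2\<close> (\<open>mode_curve\<close>). Green's formula turns the symplectic form of traces into
  \<open>\<langle>\<cdot>, S \<cdot>\<rangle>\<close>, and the resulting \<open>b\<close> is half the second order form.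
\<close>

section \<open>Symmetric bilinear forms on a subspace\<close>

definition sym_form_on :: "'a::euclidean_space set \<Rightarrow> ('a \<Rightarrow> 'a \<Rightarrow> real) \<Rightarrow> bool" where
  "sym_form_on V b \<longleftrightarrow> subspace V \<and>
     (\<forall>x\<in>V. \<forall>y\<in>V. \<forall>z\<in>V. b (x + y) z = b x z + b y z) \<and>
     (\<forall>c. \<forall>x\<in>V. \<forall>y\<in>V. b (c *\<^sub>R x) y = c * b x y) \<and>
     (\<forall>x\<in>V. \<forall>y\<in>V. b x y = b y x)"

lemma sym_form_onD:
  assumes "sym_form_on V b"
  shows "subspace V"
    and "\<And>x y. x \<in> V \<Longrightarrow> y \<in> V \<Longrightarrow> b x y = b y x"
    and "\<And>c x y. x \<in> V \<Longrightarrow> y \<in> V \<Longrightarrow> b (c *\<^sub>R x) y = c * b x y"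
    and "\<And>c x y. x \<in> V \<Longrightarrow> y \<in> V \<Longrightarrow> b x (c *\<^sub>R y) = c * b x y"
    and "\<And>x y z. x \<in> V \<Longrightarrow> y \<in> V \<Longrightarrow> z \<in> V \<Longrightarrow> b (x + y) z = b x z + b y z"
    and "\<And>x y z. x \<in> V \<Longrightarrow> y \<in> V \<Longrightarrow> z \<in> V \<Longrightarrow> b z (x + y) = b z x + b z y"
proof -
  show s: "subspace V" using assms by (simp add: sym_form_on_def)
  show 1: "\<And>x y. x \<in> V \<Longrightarrow> y \<in> V \<Longrightarrow> b x y = b y x"
    and 2: "\<And>c x y. x \<in> V \<Longrightarrow> y \<in> V \<Longrightarrow> b (c *\<^sub>R x) y = c * b x y"
    and 3: "\<And>x y z. x \<in> V \<Longrightarrow> y \<in> V \<Longrightarrow> z \<in> V \<Longrightarrow> b (x + y) z = b x z + b y z"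
    using assms unfolding sym_form_on_def by blast+
  show "\<And>c x y. x \<in> V \<Longrightarrow> y \<in> V \<Longrightarrow> b x (c *\<^sub>R y) = c * b x y"
    using 1 2 s by (metis subspace_scale)
  show "\<And>x y z. x \<in> V \<Longrightarrow> y \<in> V \<Longrightarrow> z \<in> V \<Longrightarrow> b z (x + y) = b z x + b z y"
    using 1 3 s by (metis subspace_add)
qed

lemma sym_form_on_sum:
  assumes "sym_form_on V b" "finite I" "\<And>i. i \<in> I \<Longrightarrow> c i \<in> V" "z \<in> V"
  shows "b (\<Sum>i\<in>I. a i *\<^sub>R c i) z = (\<Sum>i\<in>I. a i * b (c i) z)"
  using assms(2,3)
proof (induction I rule: finite_induct)
  case empty
  have "b (0 *\<^sub>R z) z = 0 * b z z" by (rule sym_form_onD(3)[OF assms(1)]) (fact assms)+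
  then show ?case by simp
next
  case (insert i I)
  have s: "(\<Sum>i\<in>I. a i *\<^sub>R c i) \<in> V" and "a i *\<^sub>R c i \<in> V"
    using insert.prems sym_form_onD(1)[OF assms(1)]
    by (auto intro!: subspace_sum subspace_scale)
  then show ?case
    using insert sym_form_onD(3,5)[OF assms(1)] assms(4) by simp
qed

lemma sym_form_on_sum_sum:
  assumes "sym_form_on V b" "finite I" "\<And>i. i \<in> I \<Longrightarrow> c i \<in> V"
  shows "b (\<Sum>i\<in>I. a i *\<^sub>R c i) (\<Sum>i\<in>I. a i *\<^sub>R c i) = (\<Sum>i\<in>I. \<Sum>j\<in>I. a i * a j * b (c i) (c j))"
proof -
  have V: "subspace V" using sym_form_onD(1)[OF assms(1)] .
  have S: "(\<Sum>i\<in>I. a i *\<^sub>R c i) \<in> V"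
    using assms V by (auto intro!: subspace_sum subspace_scale)
  have "b (\<Sum>i\<in>I. a i *\<^sub>R c i) (\<Sum>i\<in>I. a i *\<^sub>R c i) = (\<Sum>i\<in>I. a i * b (\<Sum>j\<in>I. a j *\<^sub>R c j) (c i))"
    using sym_form_on_sum[OF assms S] sym_form_onD(2)[OF assms(1) _ S] assms(3)
    by (auto intro!: sum.cong)
  also have "\<dots> = (\<Sum>i\<in>I. \<Sum>j\<in>I. a i * a j * b (c i) (c j))"
  proof (rule sum.cong[OF refl])
    fix i assume i: "i \<in> I"
    have "b (\<Sum>j\<in>I. a j *\<^sub>R c j) (c i) = (\<Sum>j\<in>I. a j * b (c i) (c j))"
      using sym_form_on_sum[OF assms(1,2), of c "c i" a] sym_form_onD(2)[OF assms(1)] assms(3) i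
      by (auto intro!: sum.cong)
    then show "a i * b (\<Sum>j\<in>I. a j *\<^sub>R c j) (c i) = (\<Sum>j\<in>I. a i * a j * b (c i) (c j))"
      by (simp add: sum_distrib_left mult.assoc)
  qed
  finally show ?thesis .
qed

lemma sym_form_on_uminus: "sym_form_on V b \<Longrightarrow> sym_form_on V (\<lambda>x y. - b x y)"
  by (auto simp: sym_form_on_def)

lemma sym_form_on_subspace: "sym_form_on V b \<Longrightarrow> subspace W \<Longrightarrow> W \<subseteq> V \<Longrightarrow> sym_form_on W b"
  unfolding sym_form_on_def by (meson subsetD)

lemma polar_form_diagonal:
  assumes "sym_form_on V b" "x \<in> V" "y \<in> V" "\<And>v. v \<in> V \<Longrightarrow> Q v = b v v"
  shows "polar_form Q x y = b x y"
proof -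
  have "x + y \<in> V" using assms sym_form_onD(1) subspace_add by blast
  then have "Q (x + y) = b x x + b x y + (b y x + b y y)"
    using assms sym_form_onD(5,6)[OF assms(1)] sym_form_onD(1)[OF assms(1)] by simp
  then show ?thesis
    using assms sym_form_onD(2)[OF assms(1), of x y] by (simp add: polar_form_def field_simps)
qed

subsection \<open>Diagonalization\<close>

text \<open>
  A maximizer \<open>e\<close> of \<open>b x x\<close> on the unit sphere of \<open>V\<close> is \<open>b\<close>-orthogonal to everything in \<open>V\<close>
  orthogonal to it, since otherwise moving \<open>e\<close> in such a direction would increase the Rayleigh
  quotient to first order.  Splitting off \<open>e\<close> leaves a space of smaller dimension.
\<close>

lemma sym_form_on_diagonalize:
  fixes V :: "'a::euclidean_space set"
  assumes "sym_form_on V b"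
  shows "\<exists>B. B \<subseteq> V \<and> finite B \<and> pairwise orthogonal B \<and> (\<forall>x\<in>B. norm x = 1) \<and>
    span B = V \<and> (\<forall>x\<in>B. \<forall>y\<in>B. x \<noteq> y \<longrightarrow> b x y = 0)"
  using assms
proof (induction "dim V" arbitrary: V rule: less_induct)
  case (less V)
  note b = \<open>sym_form_on V b\<close>
  have V: "subspace V" using sym_form_onD(1)[OF b] .
  show ?case
  proof (cases "V = {0}")
    case True
    then show ?thesis by (intro exI[of _ "{}"]) auto
  next
    case False
    then obtain v0 where v0: "v0 \<in> V" "v0 \<noteq> 0" using subspace_0[OF V] by auto
    obtain B0 where B0: "B0 \<subseteq> V" "pairwise orthogonal B0" "\<And>x. x \<in> B0 \<Longrightarrow> norm x = 1"
      "independent B0" "span B0 = V"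
      using orthonormal_basis_subspace[OF V] by metis
    have fB0: "finite B0" using B0(4) independent_imp_finite by blast
    let ?q = "\<lambda>x. \<Sum>i\<in>B0. \<Sum>j\<in>B0. (x \<bullet> i) * (x \<bullet> j) * b i j"
    have q: "b x x = ?q x" if "x \<in> V" for x
    proof -
      have "(\<Sum>i\<in>B0. (x \<bullet> i) *\<^sub>R i) = x"
        using orthonormal_basis_expand[of B0 x] B0 fB0 that by simp
      then show ?thesis
        using sym_form_on_sum_sum[OF b fB0, of "\<lambda>i. i" "\<lambda>i. x \<bullet> i"] B0(1) by auto
    qed
    define S where "S = sphere 0 1 \<inter> V"
    have "compact S" unfolding S_def
      by (intro compact_Int_closed compact_sphere closed_subspace V)
    moreover have "v0 /\<^sub>R norm v0 \<in> S"
      using v0 V by (auto simp: S_def subspace_scale)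
    moreover have "continuous_on S ?q" by (intro continuous_intros)
    ultimately obtain e where e: "e \<in> S" and emax: "\<And>x. x \<in> S \<Longrightarrow> ?q x \<le> ?q e"
      using continuous_attains_sup[of S ?q] by blast
    have eV: "e \<in> V" and e1: "norm e = 1" using e by (auto simp: S_def)
    have ray: "b x x \<le> b e e * (norm x)\<^sup>2" if "x \<in> V" for x
    proof (cases "x = 0")
      case True
      then show ?thesis using sym_form_onD(3)[OF b, of x x 0] that by simp
    next
      case False
      let ?y = "x /\<^sub>R norm x"
      have "?y \<in> S" using that V False by (auto simp: S_def subspace_scale)
      then have "b ?y ?y \<le> b e e" using emax[of ?y] q[of ?y] q[OF eV] S_def by auto
      moreover have "b ?y ?y = b x x / (norm x)\<^sup>2"
        using sym_form_onD(3,4)[OF b] that V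
        by (simp add: subspace_scale power2_eq_square divide_inverse)
      ultimately have "b x x / (norm x)\<^sup>2 \<le> b e e" by simp
      then show ?thesis using False by (simp add: pos_divide_le_eq)
    qed
    have orth0: "b e y = 0" if y: "y \<in> V" "orthogonal e y" for y
    proof (rule ccontr)
      assume nz: "b e y \<noteq> 0"
      define c where "c = b e e * (norm y)\<^sup>2 - b y y"
      have *: "2 * s * b e y \<le> s\<^sup>2 * c" for s
      proof -
        have sV: "s *\<^sub>R y \<in> V" "e + s *\<^sub>R y \<in> V" using y eV V by (auto intro: subspace_add subspace_scale)
        have "b (e + s *\<^sub>R y) (e + s *\<^sub>R y) = b e e + 2 * s * b e y + s\<^sup>2 * b y y"
          using sym_form_onD(2-)[OF b] sV y eV V by (simp add: power2_eq_square algebra_simps)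
        moreover have "(norm (e + s *\<^sub>R y))\<^sup>2 = 1 + s\<^sup>2 * (norm y)\<^sup>2"
          using y e1 by (simp add: norm_add_Pythagorean orthogonal_clauses power_mult_distrib)
        ultimately have "b e e + 2 * s * b e y + s\<^sup>2 * b y y \<le> b e e * (1 + s\<^sup>2 * (norm y)\<^sup>2)"
          using ray[OF sV(2)] by simp
        then show ?thesis by (simp add: c_def algebra_simps)
      qed
      define s where "s = b e y / (\<bar>c\<bar> + 1)"
      have "s\<^sup>2 * c \<le> s\<^sup>2 * (\<bar>c\<bar> + 1)" by (intro mult_left_mono) auto
      also have "\<dots> = s * b e y" by (simp add: s_def power2_eq_square)
      finally have "s * b e y \<le> 0" using *[of s] by simp
      moreover have "s * b e y = (b e y)\<^sup>2 / (\<bar>c\<bar> + 1)" by (simp add: s_def power2_eq_square)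
      moreover have "(b e y)\<^sup>2 / (\<bar>c\<bar> + 1) > 0" using nz by (intro divide_pos_pos) auto
      ultimately show False by simp
    qed
    define V' where "V' = {y \<in> V. orthogonal e y}"
    have V': "subspace V'" using V
      by (auto simp: V'_def subspace_def orthogonal_clauses)
    have sub: "V' \<subseteq> V" by (auto simp: V'_def)
    have enV': "e \<notin> V'" using e1 by (auto simp: V'_def orthogonal_self)
    have "dim V' < dim V"
      using dim_psubset[of V' V] V V' sub eV enV' by (metis psubsetI span_eq_iff)
    then obtain B where B: "B \<subseteq> V'" "finite B" "pairwise orthogonal B" "\<forall>x\<in>B. norm x = 1"
        "span B = V'" "\<forall>x\<in>B. \<forall>y\<in>B. x \<noteq> y \<longrightarrow> b x y = 0"
      using less.hyps[OF _ sym_form_on_subspace[OF b V' sub]] by blast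
    have "span (insert e B) = V"
    proof
      show "span (insert e B) \<subseteq> V" using B sub eV V by (intro span_minimal) auto
      show "V \<subseteq> span (insert e B)"
      proof
        fix x assume x: "x \<in> V"
        have "x - (x \<bullet> e) *\<^sub>R e \<in> V'"
          using x eV V e1
          by (auto simp: V'_def orthogonal_def inner_diff_right inner_commute subspace_diff
              subspace_scale power2_norm_eq_inner[symmetric])
        then have "x - (x \<bullet> e) *\<^sub>R e \<in> span (insert e B)"
          using B(5) span_mono[of B "insert e B"] by auto
        moreover have "(x \<bullet> e) *\<^sub>R e \<in> span (insert e B)" by (simp add: span_base span_scale)
        ultimately show "x \<in> span (insert e B)"
          by (metis diff_add_cancel span_add)
      qed
    qed
    moreover have "\<forall>x\<in>insert e B. \<forall>y\<in>insert e B. x \<noteq> y \<longrightarrow> b x y = 0"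
    proof -
      have "b e y = 0 \<and> b y e = 0" if "y \<in> B" for y
        using orth0[of y] that B(1) sym_form_onD(2)[OF b, of e y] eV by (auto simp: V'_def)
      then show ?thesis using B(6) by auto
    qed
    moreover have "pairwise orthogonal (insert e B)"
      using B(1,3) by (auto simp: pairwise_insert V'_def orthogonal_commute)
    ultimately show ?thesis
      using B eV e1 sub by (intro exI[of _ "insert e B"]) auto
  qed
qed

subsection \<open>Counting negative squares\<close>

lemma finite_negative_dims:
  fixes V :: "'a::euclidean_space set"
  shows "finite {dim W | W. subspace W \<and> W \<subseteq> V \<and> (\<forall>x\<in>W. x \<noteq> 0 \<longrightarrow> Q x < (0::real))}"
  by (rule finite_subset[of _ "{..DIM('a)}"]) (auto intro: dim_subset_UNIV)

lemma n_neg_witness: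
  fixes V :: "'a::euclidean_space set"
  assumes "0 \<in> V"
  shows "\<exists>W. subspace W \<and> W \<subseteq> V \<and> (\<forall>x\<in>W. x \<noteq> 0 \<longrightarrow> Q x < 0) \<and> dim W = n_neg V Q"
proof -
  let ?D = "{dim W | W. subspace W \<and> W \<subseteq> V \<and> (\<forall>x\<in>W. x \<noteq> 0 \<longrightarrow> Q x < 0)}"
  have "dim ({0}::'a set) \<in> ?D" using assms by (intro CollectI exI[of _ "{0}"]) auto
  then have "Max ?D \<in> ?D" using finite_negative_dims[of V Q] Max_in by blast
  then show ?thesis unfolding n_neg_def by force
qed

lemma n_neg_ge:
  fixes V :: "'a::euclidean_space set"
  assumes "subspace W" "W \<subseteq> V" "\<forall>x\<in>W. x \<noteq> 0 \<longrightarrow> Q x < 0"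
  shows "dim W \<le> n_neg V Q"
  unfolding n_neg_def using assms finite_negative_dims[of V Q] by (intro Max_ge) auto

lemma n_pos_eq_n_neg: "n_pos V Q = n_neg V (\<lambda>x. - Q x)"
  by (simp add: n_pos_def n_neg_def)

lemma n_neg_cong: "(\<And>x. x \<in> V \<Longrightarrow> Q x = R x) \<Longrightarrow> n_neg V Q = n_neg V R"
  unfolding n_neg_def by (metis (no_types, opaque_lifting) subsetD)

lemma n_neg_scale: "c > 0 \<Longrightarrow> n_neg V (\<lambda>x. c * Q x) = n_neg V Q"
  by (simp add: n_neg_def mult_less_0_iff)

lemma dim_negative_plus_nonneg:
  fixes V :: "'a::euclidean_space set"
  assumes "subspace V" "subspace W" "W \<subseteq> V" "\<forall>x\<in>W. x \<noteq> 0 \<longrightarrow> Q x < 0"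
    and "subspace P" "P \<subseteq> V" "\<forall>x\<in>P. (0::real) \<le> Q x"
  shows "dim W + dim P \<le> dim V"
proof -
  have "x = 0" if "x \<in> W" "x \<in> P" for x
    using bspec[OF assms(4) that(1)] bspec[OF assms(7) that(2)] by fastforce
  then have "W \<inter> P = {0}" using subspace_0[OF assms(2)] subspace_0[OF assms(5)] by blast
  moreover have "dim {x + y |x y. x \<in> W \<and> y \<in> P} + dim (W \<inter> P) = dim W + dim P"
    using dim_sums_Int[OF assms(2,5)] .
  moreover have "dim {x + y |x y. x \<in> W \<and> y \<in> P} \<le> dim V"
    using assms by (intro dim_subset) (auto intro: subspace_add)
  ultimately show ?thesis by simp
qed

text \<open>
  A family whose Gram matrix is close to a negative diagonal matrix is diagonally dominant, so the
  form is negative definite on its span.  The bound on the error is quantitative in order that it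
  can be applied along limits.
\<close>

lemma negative_subspace_of_almost_diagonal:
  fixes c :: "'i \<Rightarrow> 'a::euclidean_space"
  assumes b: "sym_form_on V b" and I: "finite I" "\<And>i. i \<in> I \<Longrightarrow> c i \<in> V"
    and near: "\<And>i j. i \<in> I \<Longrightarrow> j \<in> I \<Longrightarrow> \<bar>b (c i) (c j) - (if i = j then \<beta> i else 0)\<bar> \<le> \<eta>"
    and neg: "\<And>i. i \<in> I \<Longrightarrow> \<beta> i \<le> - \<mu>" and small: "\<eta> * card I < \<mu>" "0 < \<mu>"
  shows "\<exists>W. subspace W \<and> W \<subseteq> V \<and> (\<forall>x\<in>W. x \<noteq> 0 \<longrightarrow> b x x < 0) \<and> dim W = card I"
proof -
  have V: "subspace V" using sym_form_onD(1)[OF b] .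
  have negdef: "b (\<Sum>i\<in>I. a i *\<^sub>R c i) (\<Sum>i\<in>I. a i *\<^sub>R c i) < 0" if nz: "\<exists>i\<in>I. a i \<noteq> 0" for a
  proof -
    have I0: "I \<noteq> {}" using nz by auto
    have s0: "0 < (\<Sum>i\<in>I. (a i)\<^sup>2)"
      using nz I(1) by (auto intro!: sum_pos2)
    have \<eta>0: "0 \<le> \<eta>" using near I0 by (meson abs_ge_zero all_not_in_conv order_trans)
    have "b (\<Sum>i\<in>I. a i *\<^sub>R c i) (\<Sum>i\<in>I. a i *\<^sub>R c i) = (\<Sum>i\<in>I. \<Sum>j\<in>I. a i * a j * b (c i) (c j))"
      by (rule sym_form_on_sum_sum[OF b I])
    also have "\<dots> \<le> (\<Sum>i\<in>I. \<Sum>j\<in>I. a i * a j * (if i = j then \<beta> i else 0) + \<eta> * (\<bar>a i\<bar> * \<bar>a j\<bar>))"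
    proof (intro sum_mono)
      fix i j assume ij: "i \<in> I" "j \<in> I"
      let ?d = "b (c i) (c j) - (if i = j then \<beta> i else 0)"
      have "a i * a j * ?d \<le> \<bar>a i * a j * ?d\<bar>" by simp
      also have "\<dots> = \<bar>a i\<bar> * \<bar>a j\<bar> * \<bar>?d\<bar>" by (simp add: abs_mult)
      also have "\<dots> \<le> \<bar>a i\<bar> * \<bar>a j\<bar> * \<eta>" using near[OF ij] by (intro mult_left_mono) auto
      finally show "a i * a j * b (c i) (c j) \<le>
          a i * a j * (if i = j then \<beta> i else 0) + \<eta> * (\<bar>a i\<bar> * \<bar>a j\<bar>)"
        by (simp add: algebra_simps)
    qed
    also have "\<dots> = (\<Sum>i\<in>I. (a i)\<^sup>2 * \<beta> i) + \<eta> * (\<Sum>i\<in>I. \<bar>a i\<bar>)\<^sup>2"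
    proof -
      have "(\<Sum>j\<in>I. a i * a j * (if i = j then \<beta> i else 0)) = (a i)\<^sup>2 * \<beta> i" if "i \<in> I" for i
        using that I(1) by (simp add: power2_eq_square if_distrib sum.delta cong: if_cong)
      then have "(\<Sum>i\<in>I. \<Sum>j\<in>I. a i * a j * (if i = j then \<beta> i else 0)) = (\<Sum>i\<in>I. (a i)\<^sup>2 * \<beta> i)"
        by simp
      moreover have "(\<Sum>i\<in>I. \<Sum>j\<in>I. \<eta> * (\<bar>a i\<bar> * \<bar>a j\<bar>)) = \<eta> * (\<Sum>i\<in>I. \<bar>a i\<bar>)\<^sup>2"
        unfolding power2_eq_square sum_product by (simp only: sum_distrib_left)
      ultimately show ?thesis by (simp add: sum.distrib)
    qed
    also have "\<dots> \<le> (\<Sum>i\<in>I. (a i)\<^sup>2 * (- \<mu>)) + \<eta> * ((\<Sum>i\<in>I. (a i)\<^sup>2) * card I)"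
      using sum_squared_le_sum_of_squares[of "\<lambda>i. \<bar>a i\<bar>" I] \<eta>0 neg
      by (intro add_mono sum_mono mult_left_mono) auto
    also have "\<dots> = (\<Sum>i\<in>I. (a i)\<^sup>2) * (\<eta> * card I - \<mu>)"
      by (simp add: sum_distrib_left[symmetric] sum_distrib_right[symmetric] sum_negf algebra_simps)
    also have "\<dots> < 0" using s0 small by (intro mult_pos_neg) auto
    finally show ?thesis .
  qed
  have b00: "b 0 0 = 0" using sym_form_onD(3)[OF b, of 0 0 0] subspace_0[OF V] by simp
  have inj: "inj_on c I"
  proof (rule inj_onI, rule ccontr)
    fix i j assume ij: "i \<in> I" "j \<in> I" "c i = c j" "i \<noteq> j"
    let ?a = "\<lambda>k. if k = i then 1 else if k = j then -1 else (0::real)"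
    have "(\<Sum>k\<in>I. ?a k *\<^sub>R c k) = (\<Sum>k\<in>{i,j}. ?a k *\<^sub>R c k)"
      using ij I(1) by (intro sum.mono_neutral_right) auto
    also have "\<dots> = 0" using ij by simp
    finally have "(\<Sum>k\<in>I. ?a k *\<^sub>R c k) = 0" .
    moreover have "\<exists>k\<in>I. ?a k \<noteq> 0" using ij(1) by (intro bexI[of _ i]) auto
    ultimately show False using negdef[of ?a] b00 by (metis less_irrefl)
  qed
  have "independent (c ` I)"
  proof (rule independent_if_scalars_zero)
    show "finite (c ` I)" using I by simp
  next
    fix f x assume z: "(\<Sum>x\<in>c ` I. f x *\<^sub>R x) = 0" and x: "x \<in> c ` I"
    have "(\<Sum>i\<in>I. f (c i) *\<^sub>R c i) = 0" using z inj by (simp add: sum.reindex)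
    then have "\<not> (\<exists>i\<in>I. f (c i) \<noteq> 0)" using negdef[of "\<lambda>i. f (c i)"] b00 by auto
    then show "f x = 0" using x by auto
  qed
  then have "dim (span (c ` I)) = card I"
    using dim_span_eq_card_independent inj by (metis card_image)
  moreover have "b x x < 0" if x: "x \<in> span (c ` I)" "x \<noteq> 0" for x
  proof -
    obtain f where "x = (\<Sum>v\<in>c ` I. f v *\<^sub>R v)" using x(1) I(1) by (auto simp: span_finite)
    then have xe: "x = (\<Sum>i\<in>I. f (c i) *\<^sub>R c i)" using inj by (simp add: sum.reindex)
    then have "\<exists>i\<in>I. f (c i) \<noteq> 0" using x(2) by (metis (mono_tags, lifting) scaleR_zero_left sum.neutral)
    then show ?thesis using negdef[of "\<lambda>i. f (c i)"] xe by simp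
  qed
  moreover have "span (c ` I) \<subseteq> V" using I V by (intro span_minimal) auto
  ultimately show ?thesis by (intro exI[of _ "span (c ` I)"]) auto
qed

lemma negative_subspace_of_diagonal:
  assumes b: "sym_form_on V b" and B: "finite B" "B \<subseteq> V"
    and diag: "\<forall>x\<in>B. \<forall>y\<in>B. x \<noteq> y \<longrightarrow> b x y = 0"
  shows "\<exists>W. subspace W \<and> W \<subseteq> V \<and> (\<forall>x\<in>W. x \<noteq> 0 \<longrightarrow> b x x < 0) \<and> dim W = card {e \<in> B. b e e < 0}"
proof -
  let ?I = "{e \<in> B. b e e < 0}"
  define \<mu> where "\<mu> = Min (insert 1 ((\<lambda>e. - b e e) ` ?I))"
  have fin: "finite (insert 1 ((\<lambda>e. - b e e) ` ?I))" using B by simp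
  have "0 < \<mu>" unfolding \<mu>_def using fin by (subst Min_gr_iff) auto
  moreover have "b e e \<le> - \<mu>" if "e \<in> ?I" for e
  proof -
    have "\<mu> \<le> - b e e" unfolding \<mu>_def by (rule Min_le[OF fin]) (use that in blast)
    then show ?thesis by simp
  qed
  ultimately show ?thesis
    using B diag
    by (intro negative_subspace_of_almost_diagonal[OF b, where c = "\<lambda>e. e" and \<beta> = "\<lambda>e. b e e" and \<eta> = 0 and \<mu> = \<mu>])
      auto
qed

lemma n_neg_diagonal:
  fixes V :: "'a::euclidean_space set"
  assumes b: "sym_form_on V b" and B: "independent B" "span B = V"
    and diag: "\<forall>x\<in>B. \<forall>y\<in>B. x \<noteq> y \<longrightarrow> b x y = 0"
  shows "n_neg V (\<lambda>x. b x x) = card {e \<in> B. b e e < 0}"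
proof (rule antisym)
  have V: "subspace V" using sym_form_onD(1)[OF b] .
  have fB: "finite B" using B(1) independent_imp_finite by blast
  have BV: "B \<subseteq> V" using B(2) span_superset by blast
  show "card {e \<in> B. b e e < 0} \<le> n_neg V (\<lambda>x. b x x)"
    using negative_subspace_of_diagonal[OF b fB BV diag] n_neg_ge[of _ V "\<lambda>x. b x x"] by metis
  let ?P = "{e \<in> B. \<not> b e e < 0}"
  have "0 \<le> b x x" if xP: "x \<in> span ?P" for x
  proof -
    have fP: "finite ?P" and PV: "\<And>i. i \<in> ?P \<Longrightarrow> i \<in> V" using fB BV by auto
    obtain f where x: "x = (\<Sum>v\<in>?P. f v *\<^sub>R v)" using xP unfolding span_finite[OF fP] by blast
    have "b x x = (\<Sum>i\<in>?P. \<Sum>j\<in>?P. f i * f j * b i j)"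
      unfolding x by (rule sym_form_on_sum_sum[OF b fP PV])
    also have "\<dots> = (\<Sum>i\<in>?P. \<Sum>j\<in>?P. if i = j then f i * f i * b i i else 0)"
      using diag by (intro sum.cong refl) auto
    also have "\<dots> = (\<Sum>i\<in>?P. f i * f i * b i i)" using fP by (simp add: sum.delta)
    also have "\<dots> \<ge> 0" by (intro sum_nonneg) (auto simp: mult_nonneg_nonneg)
    finally show ?thesis .
  qed
  moreover have "span ?P \<subseteq> V" using B(2) by (metis (no_types, lifting) mem_Collect_eq span_mono subsetI)
  moreover obtain W where W: "subspace W" "W \<subseteq> V" "\<forall>x\<in>W. x \<noteq> 0 \<longrightarrow> b x x < 0" "dim W = n_neg V (\<lambda>x. b x x)"
    using n_neg_witness[of V "\<lambda>x. b x x"] subspace_0[OF V] by blast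
  ultimately have "dim W + dim (span ?P) \<le> dim V"
    using dim_negative_plus_nonneg[OF V W(1-3), of "span ?P"] by auto
  moreover have "dim (span ?P) = card ?P"
    using B(1) by (intro dim_span_eq_card_independent) (metis (no_types, lifting) independent_mono mem_Collect_eq subsetI)
  moreover have "dim V = card B" using B dim_span_eq_card_independent by blast
  moreover have "card B = card {e \<in> B. b e e < 0} + card ?P"
    using fB by (subst card_Un_disjoint[symmetric]) (auto intro!: arg_cong[where f = card])
  ultimately show "n_neg V (\<lambda>x. b x x) \<le> card {e \<in> B. b e e < 0}"
    using W(4) by simp
qed

text \<open>
  Negative and positive subspaces persist under small perturbations.  If the limiting diagonal
  form has no kernel, the two persisting subspaces already fill the whole space, and the number of
  negative squares cannot change.
\<close>

lemma n_neg_eventually_diagonal: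
  fixes M :: "'p \<Rightarrow> 'a::euclidean_space set" and c :: "'i \<Rightarrow> 'p \<Rightarrow> 'a"
  assumes b: "sym_form_on UNIV b" and I: "finite I"
    and M: "\<forall>\<^sub>F t in F. subspace (M t) \<and> dim (M t) = card I"
    and c: "\<And>i. i \<in> I \<Longrightarrow> \<forall>\<^sub>F t in F. c i t \<in> M t"
    and lim: "\<And>i j. i \<in> I \<Longrightarrow> j \<in> I \<Longrightarrow>
      ((\<lambda>t. b (c i t) (c j t)) \<longlongrightarrow> (if i = j then \<beta> i else 0)) F"
    and nz: "\<And>i. i \<in> I \<Longrightarrow> \<beta> i \<noteq> 0"
  shows "\<forall>\<^sub>F t in F. n_neg (M t) (\<lambda>x. b x x) = card {i \<in> I. \<beta> i < 0} \<and>
    (\<forall>x\<in>M t. (\<forall>y\<in>M t. b x y = 0) \<longrightarrow> x = 0)"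
proof -
  define \<mu> where "\<mu> = Min (insert 1 ((\<lambda>i. \<bar>\<beta> i\<bar>) ` I))"
  have fin: "finite (insert 1 ((\<lambda>i. \<bar>\<beta> i\<bar>) ` I))" using I by simp
  have \<mu>0: "0 < \<mu>" unfolding \<mu>_def using fin nz by (subst Min_gr_iff) auto
  have \<mu>: "\<mu> \<le> \<bar>\<beta> i\<bar>" if "i \<in> I" for i
    unfolding \<mu>_def by (rule Min_le[OF fin]) (use that in blast)
  define \<eta> where "\<eta> = \<mu> / (2 * (real (card I) + 1))"
  have \<eta>0: "0 < \<eta>" using \<mu>0 by (simp add: \<eta>_def)
  have \<eta>I: "\<eta> * card J < \<mu>" if "J \<subseteq> I" for J
  proof -
    have "card J \<le> card I" using that I by (simp add: card_mono)
    then have "\<eta> * real (card J) \<le> \<eta> * real (card I)" using \<eta>0 by simp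
    also have "\<dots> = \<mu> * (card I / (2 * (real (card I) + 1)))" by (simp add: \<eta>_def)
    also have "\<dots> < \<mu> * 1" using \<mu>0 by (intro mult_strict_left_mono) (auto simp: field_simps)
    finally show ?thesis by simp
  qed
  have "\<forall>\<^sub>F t in F. \<forall>i\<in>I. \<forall>j\<in>I. \<bar>b (c i t) (c j t) - (if i = j then \<beta> i else 0)\<bar> \<le> \<eta>"
  proof (intro eventually_ball_finite ballI I)
    fix i j assume "i \<in> I" "j \<in> I"
    from tendstoD[OF lim[OF this] \<eta>0]
    show "\<forall>\<^sub>F t in F. \<bar>b (c i t) (c j t) - (if i = j then \<beta> i else 0)\<bar> \<le> \<eta>"
      by eventually_elim (simp add: dist_real_def)
  qed
  moreover have "\<forall>\<^sub>F t in F. \<forall>i\<in>I. c i t \<in> M t" using c I by (intro eventually_ball_finite) auto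
  ultimately show ?thesis using M
  proof eventually_elim
    case (elim t)
    have M: "subspace (M t)" "dim (M t) = card I" using elim by auto
    have bM: "sym_form_on (M t) b" using sym_form_on_subspace[OF b M(1)] by simp
    let ?N = "{i \<in> I. \<beta> i < 0}" and ?P = "{i \<in> I. 0 < \<beta> i}"
    have "\<exists>W. subspace W \<and> W \<subseteq> M t \<and> (\<forall>x\<in>W. x \<noteq> 0 \<longrightarrow> b x x < 0) \<and> dim W = card ?N"
      using elim I \<mu> \<eta>I[of ?N] \<mu>0
      by (intro negative_subspace_of_almost_diagonal[OF bM, where c = "\<lambda>i. c i t" and \<beta> = \<beta> and \<eta> = \<eta> and \<mu> = \<mu>])
         force+
    then obtain W where W: "subspace W" "W \<subseteq> M t" "\<forall>x\<in>W. x \<noteq> 0 \<longrightarrow> b x x < 0" "dim W = card ?N" by blast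
    have "\<bar>- b (c i t) (c j t) - (if i = j then - \<beta> i else 0)\<bar> \<le> \<eta>" if "i \<in> ?P" "j \<in> ?P" for i j
      using bspec[OF bspec[OF elim(1)], of i j] that by (auto split: if_splits)
    then have "\<exists>W. subspace W \<and> W \<subseteq> M t \<and> (\<forall>x\<in>W. x \<noteq> 0 \<longrightarrow> - b x x < 0) \<and> dim W = card ?P"
      using elim I \<mu> \<eta>I[of ?P] \<mu>0
      by (intro negative_subspace_of_almost_diagonal[OF sym_form_on_uminus[OF bM],
            where c = "\<lambda>i. c i t" and \<beta> = "\<lambda>i. - \<beta> i" and \<eta> = \<eta> and \<mu> = \<mu>])
         force+
    then obtain P where P: "subspace P" "P \<subseteq> M t" "\<forall>x\<in>P. x \<noteq> 0 \<longrightarrow> - b x x < 0" "dim P = card ?P" by blast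
    have b0: "b x 0 = 0" "b 0 x = 0" for x
      using sym_form_onD(3,4)[OF b, of x x 0] sym_form_onD(3,4)[OF b, of 0 x 0] by auto
    have sum: "card I = card ?N + card ?P"
      using I nz by (subst card_Un_disjoint[symmetric]) (auto intro!: arg_cong[where f = card] simp: neq_iff)
    have P0: "\<forall>x\<in>P. 0 \<le> b x x" using P(3) b0 by force
    obtain W' where W': "subspace W'" "W' \<subseteq> M t" "\<forall>x\<in>W'. x \<noteq> 0 \<longrightarrow> b x x < 0" "dim W' = n_neg (M t) (\<lambda>x. b x x)"
      using n_neg_witness[of "M t" "\<lambda>x. b x x"] subspace_0[OF M(1)] by blast
    have "dim W' + dim P \<le> dim (M t)"
      using dim_negative_plus_nonneg[OF M(1) W'(1-3) P(1,2) P0] .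
    moreover have "dim W \<le> n_neg (M t) (\<lambda>x. b x x)" using n_neg_ge[OF W(1-3)] .
    ultimately have "n_neg (M t) (\<lambda>x. b x x) = card ?N"
      using sum W(4) P(4) W'(4) M(2) by simp
    moreover have "x = 0" if x: "x \<in> M t" "\<forall>y\<in>M t. b x y = 0" for x
    proof (rule ccontr)
      assume "x \<noteq> 0"
      have "x \<notin> P" using P(3) x \<open>x \<noteq> 0\<close> by force
      then have d: "dim (span (insert x P)) = dim P + 1"
        using P(1) by (simp add: dim_insert span_eq_iff[THEN iffD2])
      have "0 \<le> b y y" if yP: "y \<in> span (insert x P)" for y
      proof -
        have "span P = P" using P(1) span_eq_iff by blast
        moreover obtain k where "y - k *\<^sub>R x \<in> span P" using yP span_breakdown_eq[of y x P] by blast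
        ultimately have k: "y - k *\<^sub>R x \<in> P" by metis
        define p where "p = y - k *\<^sub>R x"
        have pM: "p \<in> M t" using k P(2) by (auto simp: p_def)
        have y: "y = p + k *\<^sub>R x" by (simp add: p_def)
        have kx: "k *\<^sub>R x \<in> M t" using x(1) M(1) subspace_scale by blast
        have "b x p = 0" "b x x = 0" using x pM by auto
        moreover have "b p x = b x p" by (rule sym_form_onD(2)[OF b]) auto
        ultimately have "b y y = b p p"
          unfolding y using sym_form_onD(3-)[OF b] by simp
        then show ?thesis using bspec[OF P0 k] by (simp add: p_def)
      qed
      moreover have "span (insert x P) \<subseteq> M t" using x(1) P(2) M(1) by (intro span_minimal) auto
      ultimately have "dim W + dim (span (insert x P)) \<le> dim (M t)"
        using dim_negative_plus_nonneg[OF M(1) W(1-3), of "span (insert x P)"] by auto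
      then show False using d W(4) P(4) sum M(2) by simp
    qed
    ultimately show ?case by blast
  qed
qed

section \<open>Orthogonal projections and convergence of subspaces\<close>

lemma closest_point_subspace:
  fixes M :: "'a::euclidean_space set"
  assumes "subspace M"
  shows closest_point_in_subspace: "closest_point M x \<in> M"
    and closest_point_orthogonal: "m \<in> M \<Longrightarrow> (x - closest_point M x) \<bullet> m = 0"
proof -
  have cl: "closed M" and cv: "convex M" and ne: "M \<noteq> {}"
    using assms by (auto simp: closed_subspace subspace_imp_convex dest: subspace_0)
  show in_M: "closest_point M x \<in> M" using closest_point_in_set cl ne by blast
  assume m: "m \<in> M"
  let ?p = "closest_point M x"
  have "(x - ?p) \<bullet> ((?p + m) - ?p) \<le> 0" "(x - ?p) \<bullet> ((?p - m) - ?p) \<le> 0"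
    using closest_point_dot[OF cv cl, of _ x] in_M m assms subspace_add subspace_diff by metis+
  then show "(x - ?p) \<bullet> m = 0" by simp
qed

lemma closest_point_eqI:
  fixes M :: "'a::euclidean_space set"
  assumes "subspace M" "p \<in> M" "\<And>m. m \<in> M \<Longrightarrow> (x - p) \<bullet> m = 0"
  shows "closest_point M x = p"
proof -
  let ?d = "closest_point M x - p"
  have d: "?d \<in> M" using closest_point_in_subspace assms(1,2) subspace_diff by blast
  have "?d \<bullet> ?d = (x - p) \<bullet> ?d - (x - closest_point M x) \<bullet> ?d" by (simp add: inner_diff_left)
  also have "\<dots> = 0" using assms(3) closest_point_orthogonal[OF assms(1)] d by simp
  finally show ?thesis by simp
qed

lemma linear_closest_point:
  fixes M :: "'a::euclidean_space set"
  assumes "subspace M"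
  shows "linear (closest_point M)"
proof (rule linearI)
  note cp = closest_point_in_subspace[OF assms] closest_point_orthogonal[OF assms]
  show "closest_point M (x + y) = closest_point M x + closest_point M y" for x y
  proof (rule closest_point_eqI[OF assms subspace_add[OF assms cp(1) cp(1)]])
    fix m assume "m \<in> M"
    from cp(2)[OF this, of x] cp(2)[OF this, of y]
    show "(x + y - (closest_point M x + closest_point M y)) \<bullet> m = 0"
      by (simp add: inner_diff_left inner_add_left)
  qed
  show "closest_point M (c *\<^sub>R x) = c *\<^sub>R closest_point M x" for c x
  proof (rule closest_point_eqI[OF assms subspace_scale[OF assms cp(1)]])
    fix m assume "m \<in> M"
    from cp(2)[OF this, of x]
    show "(c *\<^sub>R x - c *\<^sub>R closest_point M x) \<bullet> m = 0"
      by (simp add: inner_diff_left)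
  qed
qed

text \<open>
  As in \<open>lagrangian_topology\<close>, subspaces are compared through their orthogonal projections.
\<close>

definition subspace_tendsto :: "('p \<Rightarrow> 'a::euclidean_space set) \<Rightarrow> 'a set \<Rightarrow> 'p filter \<Rightarrow> bool" where
  "subspace_tendsto M M0 F \<longleftrightarrow> (\<forall>x. ((\<lambda>t. closest_point (M t) x) \<longlongrightarrow> closest_point M0 x) F)"

lemma linear_tendsto_zero_uniform:
  fixes f :: "'p \<Rightarrow> 'a::euclidean_space \<Rightarrow> 'b::real_normed_vector"
  assumes lin: "\<forall>\<^sub>F t in F. linear (f t)" and lim: "\<And>x. ((\<lambda>t. f t x) \<longlongrightarrow> 0) F" and "0 < \<eta>"
  shows "\<forall>\<^sub>F t in F. \<forall>x. norm (f t x) \<le> \<eta> * norm x"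
proof -
  have "((\<lambda>t. \<Sum>i\<in>Basis. norm (f t i)) \<longlongrightarrow> (\<Sum>i::'a\<in>Basis. norm (0::'b))) F"
    by (intro tendsto_intros lim)
  then have "((\<lambda>t. \<Sum>i\<in>Basis. norm (f t i)) \<longlongrightarrow> 0) F" by simp
  then have "\<forall>\<^sub>F t in F. (\<Sum>i\<in>Basis. norm (f t i)) < \<eta>"
    using order_tendstoD(2) \<open>0 < \<eta>\<close> by blast
  with lin show ?thesis
  proof eventually_elim
    case (elim t)
    show ?case
    proof
      fix x
      have "f t x = f t (\<Sum>i\<in>Basis. (x \<bullet> i) *\<^sub>R i)" by (simp add: euclidean_representation)
      also have "\<dots> = (\<Sum>i\<in>Basis. (x \<bullet> i) *\<^sub>R f t i)"
        using elim(1) by (simp add: linear_sum linear_scale)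
      finally have fx: "f t x = (\<Sum>i\<in>Basis. (x \<bullet> i) *\<^sub>R f t i)" .
      have "norm (f t x) \<le> (\<Sum>i\<in>Basis. norm ((x \<bullet> i) *\<^sub>R f t i))"
        unfolding fx by (rule norm_sum)
      also have "\<dots> \<le> (\<Sum>i\<in>Basis. norm x * norm (f t i))"
        by (intro sum_mono) (simp add: Basis_le_norm mult_right_mono)
      also have "\<dots> = (\<Sum>i\<in>Basis. norm (f t i)) * norm x" by (simp add: sum_distrib_left mult.commute)
      also have "\<dots> \<le> \<eta> * norm x" using elim(2) by (intro mult_right_mono) auto
      finally show "norm (f t x) \<le> \<eta> * norm x" .
    qed
  qed
qed

lemma subspace_tendsto_uniform:
  assumes M: "\<forall>\<^sub>F t in F. subspace (M t)" "subspace M0" and lim: "subspace_tendsto M M0 F" and "0 < \<eta>"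
  shows "\<forall>\<^sub>F t in F. \<forall>x. norm (closest_point (M t) x - closest_point M0 x) \<le> \<eta> * norm x"
proof (rule linear_tendsto_zero_uniform[OF _ _ \<open>0 < \<eta>\<close>])
  show "\<forall>\<^sub>F t in F. linear (\<lambda>x. closest_point (M t) x - closest_point M0 x)"
    using M(1) by eventually_elim
      (intro linear_compose_sub linear_closest_point M(2))
  show "((\<lambda>t. closest_point (M t) x - closest_point M0 x) \<longlongrightarrow> 0) F" for x
    using lim unfolding subspace_tendsto_def using LIM_zero by blast
qed

text \<open>
  A linear map injective on \<open>M0\<close> is bounded below there, and the bound survives on nearby
  subspaces because the projections converge uniformly on bounded sets.
\<close>

lemma eventually_bounded_below_on_subspaces:
  fixes M0 :: "'a::euclidean_space set" and Z :: "'a \<Rightarrow> 'b::euclidean_space"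
  assumes M: "\<forall>\<^sub>F t in F. subspace (M t)" "subspace M0" and lim: "subspace_tendsto M M0 F"
    and Z: "bounded_linear Z" "\<And>m. m \<in> M0 \<Longrightarrow> Z m = 0 \<Longrightarrow> m = 0"
  shows "\<exists>c>0. \<forall>\<^sub>F t in F. \<forall>m\<in>M t. c * norm m \<le> norm (Z m)"
proof -
  obtain e where e: "0 < e" "\<And>m. m \<in> M0 \<Longrightarrow> e * norm m \<le> norm (Z m)"
    using injective_imp_isometric[OF closed_subspace[OF M(2)] M(2) Z(1)] Z(2) by blast
  obtain B where B: "0 < B" "\<And>m. norm (Z m) \<le> norm m * B"
    using bounded_linear.pos_bounded[OF Z(1)] by blast
  define \<eta> where "\<eta> = min (1/2) (e / (4 * B))"
  have \<eta>: "0 < \<eta>" "\<eta> \<le> 1/2" "\<eta> * B \<le> e / 4" using e B by (auto simp: \<eta>_def min_def field_simps)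
  have "\<forall>\<^sub>F t in F. \<forall>m\<in>M t. (e/4) * norm m \<le> norm (Z m)"
    using subspace_tendsto_uniform[OF M lim \<eta>(1)] M(1)
  proof eventually_elim
    case (elim t)
    show ?case
    proof
      fix m assume m: "m \<in> M t"
      let ?p = "closest_point M0 m"
      have d: "norm (m - ?p) \<le> \<eta> * norm m"
        using spec[OF elim(1), of m] closest_point_self[OF m] by simp
      have "norm m \<le> norm ?p + norm (m - ?p)" using norm_triangle_ineq[of ?p "m - ?p"] by simp
      then have "norm m \<le> norm ?p + \<eta> * norm m" using d by linarith
      moreover have "\<eta> * norm m \<le> (1/2) * norm m" using \<eta> by (intro mult_right_mono) auto
      ultimately have p: "norm m / 2 \<le> norm ?p" by simp
      have "norm (Z ?p) \<le> norm (Z m) + norm (Z (m - ?p))"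
        using norm_triangle_ineq4[of "Z m" "Z (m - ?p)"]
        by (simp add: linear_diff[OF bounded_linear.linear[OF Z(1)]])
      moreover have "norm (Z (m - ?p)) \<le> (\<eta> * norm m) * B"
        using B(2)[of "m - ?p"] d B(1) by (meson less_imp_le mult_right_mono order_trans)
      moreover have "(\<eta> * norm m) * B \<le> (e/4) * norm m"
        using mult_right_mono[OF \<eta>(3), of "norm m"] by (simp add: mult_ac)
      moreover have "e * (norm m / 2) \<le> norm (Z ?p)"
        using e(2)[OF closest_point_in_subspace[OF M(2)], of m] mult_left_mono[OF p, of e] e(1) by linarith
      ultimately show "(e/4) * norm m \<le> norm (Z m)" by simp
    qed
  qed
  then show ?thesis using e(1) by (intro exI[of _ "e/4"]) auto
qed

section \<open>Lagrangian subspaces\<close>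

definition vertical :: "'n::finite phase set" where
  "vertical = {0} \<times> UNIV"

lemma mem_vertical: "q \<in> vertical \<longleftrightarrow> fst q = 0"
  by (cases q) (simp add: vertical_def)

lemma subspace_vertical: "subspace vertical"
  by (auto simp: subspace_def mem_vertical)

lemma omega_pair: "omega x y = fst x \<bullet> snd y - snd x \<bullet> fst y"
  by (simp add: omega_def J_map_def inner_prod_def)

lemma lagrangianD:
  fixes M :: "'n::finite phase set"
  assumes "M \<in> lagrangians"
  shows "subspace M" "dim M = CARD('n)" "\<And>x y. x \<in> M \<Longrightarrow> y \<in> M \<Longrightarrow> omega x y = 0"
  using assms by (auto simp: lagrangians_def)

lemma lagrangian_inner_commute:
  "M \<in> lagrangians \<Longrightarrow> x \<in> M \<Longrightarrow> y \<in> M \<Longrightarrow> fst x \<bullet> snd y = fst y \<bullet> snd x"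
  using lagrangianD(3)[of M x y] by (simp add: omega_pair inner_commute)

text \<open>
  The annihilator of \<open>M\<close> with respect to \<open>\<omega>\<close> is the orthogonal complement of \<open>J M\<close>, hence has
  dimension \<open>n\<close>; as it contains \<open>M\<close>, it equals \<open>M\<close>.
\<close>

lemma lagrangian_maximal:
  fixes M :: "'n::finite phase set"
  assumes M: "M \<in> lagrangians" and v: "\<And>m. m \<in> M \<Longrightarrow> omega m v = 0"
  shows "v \<in> M"
proof -
  have lin: "linear (J_map :: 'n phase \<Rightarrow> 'n phase)"
    by (intro linearI) (auto simp: J_map_def)
  have inj: "inj (J_map :: 'n phase \<Rightarrow> 'n phase)"
    by (intro injI) (auto simp: J_map_def prod_eq_iff)
  let ?A = "{y \<in> UNIV. \<forall>x\<in>J_map ` M. orthogonal x y}"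
  have sJ: "subspace (J_map ` M)" using linear_subspace_image[OF lin lagrangianD(1)[OF M]] .
  have "dim (J_map ` M) = dim M"
    using dim_image_eq[OF lin, of M] inj inj_on_subset by blast
  moreover have "dim ?A + dim (J_map ` M) = dim (UNIV :: 'n phase set)"
    by (rule dim_subspace_orthogonal_to_vectors[OF sJ subspace_UNIV]) simp
  ultimately have "dim ?A = CARD('n)" using lagrangianD(2)[OF M] by (simp add: dim_UNIV)
  moreover have "subspace ?A" by (auto simp: subspace_def orthogonal_clauses)
  moreover have "M \<subseteq> ?A" using lagrangianD(3)[OF M] by (auto simp: orthogonal_def omega_def)
  ultimately have "M = ?A"
    using lagrangianD(1,2)[OF M] by (intro subspace_dim_equal) auto
  moreover have "v \<in> ?A" using v by (auto simp: orthogonal_def omega_def)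
  ultimately show ?thesis by blast
qed

text \<open>
  A basis adapted to the vertical space: \<open>Y\<close> spans the vertical part of \<open>M\<close>, and the
  remaining basis vectors lie on the lines of slopes \<open>lam x\<close> over orthonormal vectors \<open>x\<close>.
\<close>

definition slope_basis ::
    "'n::finite phase set \<Rightarrow> (real^'n) set \<Rightarrow> (real^'n) set \<Rightarrow> (real^'n \<Rightarrow> real) \<Rightarrow> bool" where
  "slope_basis M X Y lam \<longleftrightarrow> finite X \<and> finite Y \<and> (\<forall>x\<in>X. norm x = 1) \<and> (\<forall>y\<in>Y. norm y = 1) \<and>
     pairwise orthogonal X \<and> pairwise orthogonal Y \<and> (\<forall>x\<in>X. \<forall>y\<in>Y. x \<bullet> y = 0) \<and>
     card X + card Y = CARD('n) \<and> span X = fst ` M \<and> span (Pair 0 ` Y) = M \<inter> vertical \<and>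
     independent ((\<lambda>x. (x, lam x *\<^sub>R x)) ` X \<union> Pair 0 ` Y) \<and>
     span ((\<lambda>x. (x, lam x *\<^sub>R x)) ` X \<union> Pair 0 ` Y) = M"

lemma slope_basisD:
  fixes M :: "'n::finite phase set"
  assumes "slope_basis M X Y lam"
  shows "finite X" "finite Y" "\<And>x. x \<in> X \<Longrightarrow> norm x = 1" "\<And>y. y \<in> Y \<Longrightarrow> norm y = 1"
    "pairwise orthogonal X" "pairwise orthogonal Y" "\<And>x y. x \<in> X \<Longrightarrow> y \<in> Y \<Longrightarrow> x \<bullet> y = 0"
    "card X + card Y = CARD('n)" "span X = fst ` M" "span (Pair 0 ` Y) = M \<inter> vertical"
    "independent ((\<lambda>x. (x, lam x *\<^sub>R x)) ` X \<union> Pair 0 ` Y)"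
    "span ((\<lambda>x. (x, lam x *\<^sub>R x)) ` X \<union> Pair 0 ` Y) = M"
    "(\<lambda>x. (x, lam x *\<^sub>R x)) ` X \<union> Pair 0 ` Y \<subseteq> M"
proof -
  note sb = assms[unfolded slope_basis_def]
  show "finite X" "finite Y" "pairwise orthogonal X" "pairwise orthogonal Y"
    "card X + card Y = CARD('n)" "span X = fst ` M" "span (Pair 0 ` Y) = M \<inter> vertical"
    "independent ((\<lambda>x. (x, lam x *\<^sub>R x)) ` X \<union> Pair 0 ` Y)"
    by (insert sb, elim conjE, assumption)+
  show span: "span ((\<lambda>x. (x, lam x *\<^sub>R x)) ` X \<union> Pair 0 ` Y) = M"
    by (insert sb, elim conjE, assumption)
  show "(\<lambda>x. (x, lam x *\<^sub>R x)) ` X \<union> Pair 0 ` Y \<subseteq> M"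
    by (rule subset_trans[OF span_superset]) (rule eq_refl[OF span])
  have "\<forall>x\<in>X. norm x = 1" "\<forall>y\<in>Y. norm y = 1" "\<forall>x\<in>X. \<forall>y\<in>Y. x \<bullet> y = 0"
    by (insert sb, elim conjE, assumption)+
  then show "\<And>x. x \<in> X \<Longrightarrow> norm x = 1" "\<And>y. y \<in> Y \<Longrightarrow> norm y = 1"
    "\<And>x y. x \<in> X \<Longrightarrow> y \<in> Y \<Longrightarrow> x \<bullet> y = 0" by blast+
qed

text \<open>
  A Lagrangian subspace is the sum of a vertical part \<open>{0} \<times> H\<^sup>\<bottom>\<close> and of the graph of a symmetric
  operator on \<open>H = fst ` M\<close>, which can be diagonalized.  In the resulting basis all the forms used
  below are diagonal.
\<close>

lemma lagrangian_slope_basis: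
  fixes M :: "'n::finite phase set"
  assumes M: "M \<in> lagrangians"
  shows "\<exists>X Y lam. slope_basis M X Y lam"
proof -
  note sub = lagrangianD(1)[OF M]
  define H where "H = fst ` M"
  have H: "subspace H" unfolding H_def by (rule linear_subspace_image[OF linear_fst sub])
  define s where "s x = (SOME y. (x, y) \<in> M)" for x
  have s: "(x, s x) \<in> M" if "x \<in> H" for x
    using that unfolding s_def H_def by (metis (mono_tags, lifting) imageE prod.collapse someI_ex)
  have "sym_form_on H (\<lambda>x y. x \<bullet> s y)"
    using H lagrangian_inner_commute[OF M s s] by (auto simp: sym_form_on_def inner_add_left)
  from sym_form_on_diagonalize[OF this] obtain X where X: "X \<subseteq> H" "finite X"
    "pairwise orthogonal X" "\<forall>x\<in>X. norm x = 1" "span X = H" "\<forall>x\<in>X. \<forall>y\<in>X. x \<noteq> y \<longrightarrow> x \<bullet> s y = 0"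
    by auto
  define lam where "lam x = x \<bullet> s x" for x
  define C where "C = {y \<in> UNIV. \<forall>x\<in>H. orthogonal x y}"
  have C: "subspace C" by (auto simp: C_def subspace_def orthogonal_clauses)
  obtain Y where Y: "Y \<subseteq> C" "pairwise orthogonal Y" "\<And>y. y \<in> Y \<Longrightarrow> norm y = 1"
    "independent Y" "card Y = dim C" "span Y = C"
    using orthonormal_basis_subspace[OF C] by metis
  have fY: "finite Y" using Y(4) independent_imp_finite by blast
  have indX: "independent X"
    using X(3,4) by (intro pairwise_orthogonal_independent) auto
  have cardX: "card X = dim H" using X(5) indX dim_span_eq_card_independent by metis
  have "dim C + dim H = dim (UNIV :: (real^'n) set)"
    unfolding C_def by (rule dim_subspace_orthogonal_to_vectors[OF H subspace_UNIV]) simp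
  then have cards: "card X + card Y = CARD('n)" using cardX Y(5) by (simp add: dim_UNIV)
  have vert: "(0, y) \<in> M \<longleftrightarrow> y \<in> C" for y
  proof
    assume y: "(0, y) \<in> M"
    have "orthogonal x y" if "x \<in> H" for x
      using lagrangian_inner_commute[OF M s[OF that] y] by (simp add: orthogonal_def)
    then show "y \<in> C" by (simp add: C_def)
  next
    assume "y \<in> C"
    then have y: "x \<bullet> y = 0" if "x \<in> H" for x using that by (auto simp: C_def orthogonal_def)
    show "(0, y) \<in> M"
    proof (rule lagrangian_maximal[OF M])
      fix m assume "m \<in> M"
      then show "omega m (0, y) = 0" using y[of "fst m"] by (simp add: omega_pair H_def)
    qed
  qed
  have graph: "(x, lam x *\<^sub>R x) \<in> M" if x: "x \<in> X" for x
  proof -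
    have xH: "x \<in> H" using x X(1) by blast
    let ?d = "s x - lam x *\<^sub>R x"
    have perp: "orthogonal ?d y" if y: "y \<in> X" for y
    proof -
      have "y \<bullet> s x = lam x * (y \<bullet> x)"
      proof (cases "y = x")
        case True
        then show ?thesis using X(4) x by (simp add: lam_def power2_norm_eq_inner[symmetric])
      next
        case False
        then show ?thesis using X(3,6) x y by (auto simp: pairwise_def orthogonal_def)
      qed
      then show "orthogonal ?d y"
        by (simp add: orthogonal_def inner_diff_right inner_commute[of _ y])
    qed
    have "orthogonal ?d z" if "z \<in> H" for z
      using orthogonal_to_span[of z X ?d] perp that X(5) by blast
    then have "?d \<in> C" by (auto simp: C_def orthogonal_commute)
    then have "(0, ?d) \<in> M" using vert by blast
    then have "(x, s x) - (0, ?d) \<in> M" using s[OF xH] sub subspace_diff by blast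
    then show ?thesis by simp
  qed
  have xy: "x \<bullet> y = 0" if "x \<in> X" "y \<in> Y" for x y
    using that X(1) Y(1) by (auto simp: C_def orthogonal_def)
  let ?G = "(\<lambda>x. (x, lam x *\<^sub>R x)) ` X" and ?V = "Pair 0 ` Y :: 'n phase set"
  have lin: "linear (Pair 0 :: real^'n \<Rightarrow> 'n phase)" by (intro linearI) auto
  have spanV: "span ?V = M \<inter> vertical"
  proof -
    have "span ?V = Pair 0 ` span Y" by (rule linear_span_image[OF lin])
    also have "\<dots> = M \<inter> vertical" using Y(6) vert by (force simp: vertical_def)
    finally show ?thesis .
  qed
  have EM: "?G \<union> ?V \<subseteq> M" using graph Y(1) vert by blast
  have ind: "independent (?G \<union> ?V)"
  proof (rule pairwise_orthogonal_independent)
    have "x \<noteq> 0" if "x \<in> X" for x using X(4) that by auto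
    moreover have "y \<noteq> 0" if "y \<in> Y" for y using Y(3)[OF that] by auto
    ultimately show "0 \<notin> ?G \<union> ?V" by (auto simp: zero_prod_def)
    have "(x, lam x *\<^sub>R x) \<bullet> (u, lam u *\<^sub>R u) = 0"
      if "x \<in> X" "u \<in> X" "(x, lam x *\<^sub>R x) \<noteq> (u, lam u *\<^sub>R u)" for x u
    proof -
      have "x \<noteq> u" using that(3) by blast
      then show ?thesis using X(3) that(1,2) by (simp add: pairwise_def orthogonal_def)
    qed
    moreover have "(0, y) \<bullet> (0::real^'n, z) = 0" if "y \<in> Y" "z \<in> Y" "(0::real^'n, y) \<noteq> (0, z)" for y z
      using Y(2) that by (simp add: pairwise_def orthogonal_def)
    moreover have "(x, lam x *\<^sub>R x) \<bullet> (0, y) = 0" "(0, y) \<bullet> (x, lam x *\<^sub>R x) = 0" if "x \<in> X" "y \<in> Y" for x y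
      using xy that by (simp_all add: inner_commute)
    ultimately show "pairwise orthogonal (?G \<union> ?V)"
      unfolding pairwise_def orthogonal_def by blast
  qed
  have disj: "?G \<inter> ?V = {}" using X(4) by force
  have "card (?G \<union> ?V) = card X + card Y"
    using X(2) fY disj by (subst card_Un_disjoint) (auto simp: card_image inj_on_def)
  then have spanM: "span (?G \<union> ?V) = M"
    using card_ge_dim_independent[OF EM ind] cards lagrangianD(2)[OF M] span_minimal[OF EM sub] by auto
  show ?thesis
    using X Y(2,3) fY xy cards spanV ind spanM
    by (intro exI[of _ X] exI[of _ Y] exI[of _ lam]) (simp add: slope_basis_def H_def)
qed

subsection \<open>Transversality and the number of steep directions\<close>

definition transv :: "real \<Rightarrow> 'n::finite phase set \<Rightarrow> bool" where
  "transv \<tau> M \<longleftrightarrow> (\<forall>m\<in>M. snd m = \<tau> *\<^sub>R fst m \<longrightarrow> m = 0)"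

text \<open>
  For \<open>m = d + k\<close> with \<open>d\<close> vertical and \<open>k\<close> in the Lagrangian of slope \<open>\<tau>\<close>, the value
  \<open>slope_form \<tau> m m\<close> is \<open>\<omega> d k\<close>; this is its polarization.
\<close>

definition slope_form :: "real \<Rightarrow> 'n::finite phase \<Rightarrow> 'n phase \<Rightarrow> real" where
  "slope_form \<tau> m k = \<tau> * (fst m \<bullet> fst k) - (fst m \<bullet> snd k + fst k \<bullet> snd m) / 2"

definition steep :: "real \<Rightarrow> 'n::finite phase set \<Rightarrow> nat" where
  "steep \<tau> M = n_neg M (\<lambda>m. slope_form \<tau> m m)"

text \<open>
  At \<open>(x, \<lambda> x)\<close> the quadratic form is \<open>(\<lambda> - \<tau>) (\<lambda> - \<sigma>) \<bar>x\<bar>\<^sup>2\<close>, which is negative exactly for the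
  slopes \<open>\<lambda>\<close> between \<open>\<tau>\<close> and \<open>\<sigma>\<close>; on vertical vectors it is positive.
\<close>

definition slope_gap_form :: "real \<Rightarrow> real \<Rightarrow> 'n::finite phase \<Rightarrow> 'n phase \<Rightarrow> real" where
  "slope_gap_form \<tau> \<sigma> m k =
    ((snd m - \<tau> *\<^sub>R fst m) \<bullet> (snd k - \<sigma> *\<^sub>R fst k) + (snd k - \<tau> *\<^sub>R fst k) \<bullet> (snd m - \<sigma> *\<^sub>R fst m)) / 2"

lemma sym_form_on_slope_form: "sym_form_on UNIV (slope_form \<tau>)"
  unfolding sym_form_on_def
proof (intro conjI ballI allI)
  show "slope_form \<tau> (x + y) z = slope_form \<tau> x z + slope_form \<tau> y z" for x y z :: "'n::finite phase"
    by (simp add: slope_form_def inner_add_left inner_add_right field_simps)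
  show "slope_form \<tau> (c *\<^sub>R x) y = c * slope_form \<tau> x y" for c and x y :: "'n::finite phase"
    by (simp add: slope_form_def field_simps)
  show "slope_form \<tau> x y = slope_form \<tau> y x" for x y :: "'n::finite phase"
    by (simp add: slope_form_def inner_commute add.commute)
qed simp

lemma sym_form_on_slope_gap_form: "sym_form_on UNIV (slope_gap_form \<tau> \<sigma>)"
  unfolding sym_form_on_def
proof (intro conjI ballI allI)
  have add: "snd (x + y) - a *\<^sub>R fst (x + y) = (snd x - a *\<^sub>R fst x) + (snd y - a *\<^sub>R fst y)"
    for a and x y :: "'n::finite phase" by (simp add: scaleR_add_right)
  have scale: "snd (c *\<^sub>R x) - a *\<^sub>R fst (c *\<^sub>R x) = c *\<^sub>R (snd x - a *\<^sub>R fst x)"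
    for a c and x :: "'n::finite phase" by (simp add: scaleR_diff_right)
  show "slope_gap_form \<tau> \<sigma> (x + y) z = slope_gap_form \<tau> \<sigma> x z + slope_gap_form \<tau> \<sigma> y z"
    for x y z :: "'n::finite phase"
    unfolding slope_gap_form_def add inner_add_left inner_add_right by (simp add: field_simps)
  show "slope_gap_form \<tau> \<sigma> (c *\<^sub>R x) y = c * slope_gap_form \<tau> \<sigma> x y" for c and x y :: "'n::finite phase"
    unfolding slope_gap_form_def scale inner_scaleR_left inner_scaleR_right by (simp add: field_simps)
  show "slope_gap_form \<tau> \<sigma> x y = slope_gap_form \<tau> \<sigma> y x" for x y :: "'n::finite phase"
    unfolding slope_gap_form_def by (simp add: add.commute)
qed simp

lemma slope_form_lines:
  "slope_form \<tau> (x, a *\<^sub>R x) (u, b *\<^sub>R u) = (\<tau> - (a + b) / 2) * (x \<bullet> u)"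
  "slope_form \<tau> (x, a *\<^sub>R x) (0, y) = (- 1 / 2) * (x \<bullet> y)"
  "slope_form \<tau> (0, y) (0, z) = 0 * (y \<bullet> z)"
  unfolding slope_form_def fst_conv snd_conv
  by (simp_all add: inner_commute algebra_simps add_divide_distrib diff_divide_distrib)

lemma slope_gap_form_lines:
  "slope_gap_form \<tau> \<sigma> (x, a *\<^sub>R x) (u, b *\<^sub>R u) =
    (((a - \<tau>) * (b - \<sigma>) + (b - \<tau>) * (a - \<sigma>)) / 2) * (x \<bullet> u)"
  "slope_gap_form \<tau> \<sigma> (x, a *\<^sub>R x) (0, y) = (((a - \<tau>) + (a - \<sigma>)) / 2) * (x \<bullet> y)"
  "slope_gap_form \<tau> \<sigma> (0, y) (x, a *\<^sub>R x) = (((a - \<tau>) + (a - \<sigma>)) / 2) * (x \<bullet> y)"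
  "slope_gap_form \<tau> \<sigma> (0, y) (0, z) = 1 * (y \<bullet> z)"
  unfolding slope_gap_form_def fst_conv snd_conv scaleR_left_diff_distrib[symmetric]
  by (simp_all add: inner_commute algebra_simps add_divide_distrib diff_divide_distrib inner_diff_left inner_diff_right)

lemma transv_slopes:
  assumes M: "M \<in> lagrangians" and sb: "slope_basis M X Y lam"
  shows "transv \<tau> M \<longleftrightarrow> \<tau> \<notin> lam ` X"
proof
  assume t: "transv \<tau> M"
  show "\<tau> \<notin> lam ` X"
  proof
    assume "\<tau> \<in> lam ` X"
    then obtain x where "x \<in> X" "\<tau> = lam x" by blast
    then have "(x, \<tau> *\<^sub>R x) \<in> M" using slope_basisD(13)[OF sb] by auto
    then have "(x, \<tau> *\<^sub>R x) = 0" using t by (auto simp: transv_def)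
    then show False using slope_basisD(3)[OF sb \<open>x \<in> X\<close>] by (simp add: zero_prod_def)
  qed
next
  assume t: "\<tau> \<notin> lam ` X"
  show "transv \<tau> M" unfolding transv_def
  proof (intro ballI impI)
    fix m assume m: "m \<in> M" "snd m = \<tau> *\<^sub>R fst m"
    have "\<forall>x\<in>X. orthogonal (fst m) x"
    proof
      fix x assume x: "x \<in> X"
      then have "fst m \<bullet> (lam x *\<^sub>R x) = x \<bullet> (\<tau> *\<^sub>R fst m)"
        using lagrangian_inner_commute[OF M m(1), of "(x, lam x *\<^sub>R x)"] m(2) slope_basisD(13)[OF sb] by auto
      then have "(lam x - \<tau>) * (fst m \<bullet> x) = 0" by (simp add: algebra_simps inner_commute)
      then show "orthogonal (fst m) x" using t x by (auto simp: orthogonal_def)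
    qed
    moreover have "fst m \<in> span X" using m(1) slope_basisD(9)[OF sb] by auto
    ultimately have "orthogonal (fst m) (fst m)" using orthogonal_to_span[of "fst m" X "fst m"] by blast
    then have "fst m = 0" by (simp add: orthogonal_self)
    then show "m = 0" using m(2) by (simp add: prod_eq_iff)
  qed
qed

text \<open>
  A Lagrangian subspace has at most \<open>n\<close> slopes, and any other \<open>\<tau>\<close> will do.
\<close>

lemma transv_exists:
  fixes M :: "'n::finite phase set"
  assumes M: "M \<in> lagrangians"
  shows "\<exists>\<tau>. transv \<tau> M"
proof -
  obtain X Y lam where sb: "slope_basis M X Y lam" using lagrangian_slope_basis[OF M] by blast
  have "infinite (UNIV :: real set)" by (rule infinite_UNIV_char_0)
  then obtain \<tau> where "\<tau> \<notin> lam ` X" using slope_basisD(1)[OF sb] by (metis ex_new_if_finite finite_imageI)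
  then show ?thesis using transv_slopes[OF M sb] by blast
qed

text \<open>
  Forms built from the inner product alone see the two orthonormal systems \<open>X\<close> and \<open>Y\<close> as
  orthogonal, so that a slope basis diagonalizes all of them at once.
\<close>

lemma slope_basis_diagonal:
  assumes b: "sym_form_on UNIV b" and sb: "slope_basis M X Y lam"
    and diag: "\<And>x u. b (x, lam x *\<^sub>R x) (u, lam u *\<^sub>R u) = f x u * (x \<bullet> u)"
      "\<And>x y. b (x, lam x *\<^sub>R x) (0, y) = g x * (x \<bullet> y)"
      "\<And>y z. b (0, y) (0, z) = k * (y \<bullet> z)"
    and that: "e \<in> (\<lambda>x. (x, lam x *\<^sub>R x)) ` X \<union> Pair 0 ` Y"
      "e' \<in> (\<lambda>x. (x, lam x *\<^sub>R x)) ` X \<union> Pair 0 ` Y" "e \<noteq> e'"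
  shows "b e e' = 0"
proof -
  let ?G = "(\<lambda>x. (x, lam x *\<^sub>R x)) ` X" and ?V = "Pair 0 ` Y"
  have sym: "b e e' = b e' e" by (rule sym_form_onD(2)[OF b]) auto
  show ?thesis
    using that(1)
  proof
    assume "e \<in> ?G"
    then obtain x where x: "x \<in> X" "e = (x, lam x *\<^sub>R x)" by blast
    show ?thesis using that(2)
    proof
      assume "e' \<in> ?G"
      then obtain u where u: "u \<in> X" "e' = (u, lam u *\<^sub>R u)" by blast
      then have "x \<bullet> u = 0" using slope_basisD(5)[OF sb] x that(3) by (auto simp: pairwise_def orthogonal_def)
      then show ?thesis using x u diag(1) by simp
    next
      assume "e' \<in> ?V"
      then show ?thesis using x diag(2) slope_basisD(7)[OF sb] by auto
    qed
  next
    assume "e \<in> ?V"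
    then obtain y where y: "y \<in> Y" "e = (0, y)" by blast
    show ?thesis using that(2)
    proof
      assume "e' \<in> ?G"
      then show ?thesis using y diag(2) slope_basisD(7)[OF sb] sym by auto
    next
      assume "e' \<in> ?V"
      then obtain z where z: "z \<in> Y" "e' = (0, z)" by blast
      then have "y \<bullet> z = 0" using slope_basisD(6)[OF sb] y that(3) by (auto simp: pairwise_def orthogonal_def)
      then show ?thesis using y z diag(3) by simp
    qed
  qed
qed

lemma slope_basis_card:
  fixes M :: "'n::finite phase set"
  assumes "M \<in> lagrangians" "slope_basis M X Y lam"
  shows "card ((\<lambda>x. (x, lam x *\<^sub>R x)) ` X \<union> Pair 0 ` Y) = CARD('n)"
  using dim_span_eq_card_independent[OF slope_basisD(11)[OF assms(2)]]
  unfolding slope_basisD(12)[OF assms(2)] lagrangianD(2)[OF assms(1)] by (rule sym)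

lemma n_neg_slopes:
  assumes M: "M \<in> lagrangians" and b: "sym_form_on UNIV b"
    and sb: "slope_basis M X Y lam"
    and diag: "\<And>x u. b (x, lam x *\<^sub>R x) (u, lam u *\<^sub>R u) = f x u * (x \<bullet> u)"
      "\<And>x y. b (x, lam x *\<^sub>R x) (0, y) = g x * (x \<bullet> y)"
      "\<And>y z. b (0, y) (0, z) = k * (y \<bullet> z)" "0 \<le> k"
  shows "n_neg M (\<lambda>m. b m m) = card {x \<in> X. f x x < 0}"
proof -
  let ?G = "(\<lambda>x. (x, lam x *\<^sub>R x)) ` X" and ?V = "Pair 0 ` Y"
  have bM: "sym_form_on M b"
    using sym_form_on_subspace[OF b lagrangianD(1)[OF M]] by simp
  have "n_neg M (\<lambda>m. b m m) = card {e \<in> ?G \<union> ?V. b e e < 0}"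
  proof (rule n_neg_diagonal[OF bM slope_basisD(11,12)[OF sb]], intro ballI impI)
    fix e e' assume "e \<in> ?G \<union> ?V" "e' \<in> ?G \<union> ?V" "e \<noteq> e'"
    then show "b e e' = 0" by (rule slope_basis_diagonal[OF b sb diag(1-3)])
  qed
  also have "{e \<in> ?G \<union> ?V. b e e < 0} = (\<lambda>x. (x, lam x *\<^sub>R x)) ` {x \<in> X. f x x < 0}"
  proof -
    have "b (x, lam x *\<^sub>R x) (x, lam x *\<^sub>R x) = f x x" if "x \<in> X" for x
      using diag(1)[of x x] slope_basisD(3)[OF sb that] by (simp add: power2_norm_eq_inner[symmetric])
    moreover have "\<not> b (0, y) (0, y) < 0" for y using diag(3)[of y y] diag(4) by (simp add: not_less)
    ultimately show ?thesis by auto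
  qed
  also have "card \<dots> = card {x \<in> X. f x x < 0}" by (rule card_image) (auto simp: inj_on_def)
  finally show ?thesis .
qed

text \<open>
  The vertical part of \<open>M\<close> is isotropic for the form and does not count.
\<close>

lemma steep_slopes:
  assumes "M \<in> lagrangians" "slope_basis M X Y lam"
  shows "steep \<tau> M = card {x \<in> X. \<tau> < lam x}"
proof -
  have "steep \<tau> M = card {x \<in> X. \<tau> - (lam x + lam x) / 2 < 0}"
    unfolding steep_def
    by (rule n_neg_slopes[OF assms(1) sym_form_on_slope_form assms(2),
          where f = "\<lambda>x u. \<tau> - (lam x + lam u) / 2" and g = "\<lambda>x. - 1 / 2" and k = 0])
       (rule slope_form_lines order_refl)+
  then show ?thesis by simp
qed

text \<open>
  The slopes between \<open>\<tau>\<close> and \<open>\<sigma>\<close> are counted by a form that is nondegenerate on \<open>M\<close> as long as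
  neither \<open>\<tau>\<close> nor \<open>\<sigma>\<close> is a slope.  This is what makes the comparison of two charts locally
  constant, although the two numbers being compared jump whenever \<open>M\<close> meets the vertical space.
\<close>

lemma steep_diff_eq_n_neg:
  fixes M :: "'n::finite phase set"
  assumes M: "M \<in> lagrangians" and "transv \<sigma> M" "\<tau> < \<sigma>"
  shows "steep \<tau> M = steep \<sigma> M + n_neg M (\<lambda>m. slope_gap_form \<tau> \<sigma> m m)"
proof -
  obtain X Y lam where sb: "slope_basis M X Y lam" using lagrangian_slope_basis[OF M] by blast
  note nf = slope_basisD[OF sb]
  have "n_neg M (\<lambda>m. slope_gap_form \<tau> \<sigma> m m) =
      card {x \<in> X. ((lam x - \<tau>) * (lam x - \<sigma>) + (lam x - \<tau>) * (lam x - \<sigma>)) / 2 < 0}"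
    by (rule n_neg_slopes[OF M sym_form_on_slope_gap_form sb,
          where f = "\<lambda>x u. ((lam x - \<tau>) * (lam u - \<sigma>) + (lam u - \<tau>) * (lam x - \<sigma>)) / 2"
            and g = "\<lambda>x. ((lam x - \<tau>) + (lam x - \<sigma>)) / 2" and k = 1])
       (rule slope_gap_form_lines zero_le_one)+
  then have "n_neg M (\<lambda>m. slope_gap_form \<tau> \<sigma> m m) = card {x \<in> X. (lam x - \<tau>) * (lam x - \<sigma>) < 0}"
    by (simp add: mult.commute)
  moreover have "{x \<in> X. (lam x - \<tau>) * (lam x - \<sigma>) < 0} = {x \<in> X. \<tau> < lam x \<and> lam x < \<sigma>}"
    using \<open>\<tau> < \<sigma>\<close> by (auto simp: mult_less_0_iff)
  moreover have "\<sigma> \<notin> lam ` X"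
    using transv_slopes[OF M sb] assms(2) by blast
  then have "{x \<in> X. \<tau> < lam x} = {x \<in> X. \<sigma> < lam x} \<union> {x \<in> X. \<tau> < lam x \<and> lam x < \<sigma>}"
    using \<open>\<tau> < \<sigma>\<close> by force
  moreover have "card ({x \<in> X. \<sigma> < lam x} \<union> {x \<in> X. \<tau> < lam x \<and> lam x < \<sigma>}) =
      card {x \<in> X. \<sigma> < lam x} + card {x \<in> X. \<tau> < lam x \<and> lam x < \<sigma>}"
    using nf(1) by (intro card_Un_disjoint) auto
  ultimately show ?thesis
    using steep_slopes[OF M sb] by simp
qed

lemma bounded_linear_slope_map: "bounded_linear (\<lambda>m::'n::finite phase. snd m - \<tau> *\<^sub>R fst m)"
  by (intro bounded_linear_intros)

text \<open>
  Transversality says that the linear map \<open>m \<mapsto> snd m - \<tau> fst m\<close> is injective on the subspace.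
\<close>

lemma eventually_transv:
  assumes M: "\<forall>\<^sub>F t in F. M t \<in> lagrangians" "M0 \<in> lagrangians" and lim: "subspace_tendsto M M0 F"
    and t: "transv \<tau> M0"
  shows "\<forall>\<^sub>F t in F. transv \<tau> (M t)"
proof -
  have sub: "\<forall>\<^sub>F t in F. subspace (M t)" using M(1) by eventually_elim (rule lagrangianD)
  have "\<exists>c>0. \<forall>\<^sub>F t in F. \<forall>m\<in>M t. c * norm m \<le> norm (snd m - \<tau> *\<^sub>R fst m)"
    by (rule eventually_bounded_below_on_subspaces[OF sub lagrangianD(1)[OF M(2)] lim bounded_linear_slope_map])
       (use t in \<open>auto simp: transv_def\<close>)
  then obtain c where c: "c > 0" "\<forall>\<^sub>F t in F. \<forall>m\<in>M t. c * norm m \<le> norm (snd m - \<tau> *\<^sub>R fst m)" by blast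
  from c(2) show ?thesis
  proof eventually_elim
    case (elim t)
    show ?case unfolding transv_def
    proof (intro ballI impI)
      fix m assume "m \<in> M t" "snd m = \<tau> *\<^sub>R fst m"
      then have "c * norm m \<le> 0" using elim by fastforce
      then show "m = 0" using c(1) by (simp add: mult_le_0_iff)
    qed
  qed
qed

lemma tendsto_inner_forms:
  assumes "(f \<longlongrightarrow> (u :: 'n::finite phase)) F" "(g \<longlongrightarrow> v) F"
  shows "((\<lambda>t. slope_form \<tau> (f t) (g t)) \<longlongrightarrow> slope_form \<tau> u v) F"
    and "((\<lambda>t. slope_gap_form \<tau> \<sigma> (f t) (g t)) \<longlongrightarrow> slope_gap_form \<tau> \<sigma> u v) F"
    and "((\<lambda>t. omega (f t) (g t)) \<longlongrightarrow> omega u v) F"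
  unfolding slope_form_def slope_gap_form_def omega_pair using assms by (auto intro!: tendsto_intros)

lemma steep_diff_locally_constant_aux:
  fixes M :: "'p \<Rightarrow> 'n::finite phase set"
  assumes M: "\<forall>\<^sub>F t in F. M t \<in> lagrangians" "M0 \<in> lagrangians" and lim: "subspace_tendsto M M0 F"
    and t: "transv \<tau> M0" "transv \<sigma> M0" "\<tau> < \<sigma>"
  shows "\<forall>\<^sub>F t in F. int (steep \<tau> (M t)) - int (steep \<sigma> (M t)) = int (steep \<tau> M0) - int (steep \<sigma> M0)"
proof -
  obtain X Y lam where sb: "slope_basis M0 X Y lam" using lagrangian_slope_basis[OF M(2)] by blast
  define E where "E = (\<lambda>x. (x, lam x *\<^sub>R x)) ` X \<union> Pair 0 ` Y"
  let ?b = "slope_gap_form \<tau> \<sigma>"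
  have EM: "E \<subseteq> M0" unfolding E_def by (rule slope_basisD(13)[OF sb])
  have fE: "finite E" using slope_basisD(1,2)[OF sb] by (simp add: E_def)
  have cE: "card E = CARD('n)" unfolding E_def by (rule slope_basis_card[OF M(2) sb])
  have diag: "?b e e' = 0" if "e \<in> E" "e' \<in> E" "e \<noteq> e'" for e e'
    using slope_basis_diagonal[OF sym_form_on_slope_gap_form sb,
        where f = "\<lambda>x u. ((lam x - \<tau>) * (lam u - \<sigma>) + (lam u - \<tau>) * (lam x - \<sigma>)) / 2"
          and g = "\<lambda>x. ((lam x - \<tau>) + (lam x - \<sigma>)) / 2" and k = 1,
        OF slope_gap_form_lines(1,2,4), of e e'] that by (simp add: E_def)
  have nz: "?b e e \<noteq> 0" if "e \<in> E" for e
    using that unfolding E_def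
  proof
    assume "e \<in> (\<lambda>x. (x, lam x *\<^sub>R x)) ` X"
    then obtain x where x: "x \<in> X" "e = (x, lam x *\<^sub>R x)" by blast
    then have "lam x \<noteq> \<tau>" "lam x \<noteq> \<sigma>" using transv_slopes[OF M(2) sb] t by blast+
    moreover have "x \<bullet> x = 1" using slope_basisD(3)[OF sb x(1)] by (simp add: norm_eq_1)
    ultimately show ?thesis unfolding x(2) slope_gap_form_lines by simp
  next
    assume "e \<in> Pair 0 ` Y"
    then obtain y where y: "y \<in> Y" "e = (0, y)" by blast
    then have "y \<bullet> y = 1" using slope_basisD(4)[OF sb y(1)] by (simp add: norm_eq_1)
    then show ?thesis unfolding y(2) slope_gap_form_lines by simp
  qed
  have conv: "((\<lambda>t. closest_point (M t) e) \<longlongrightarrow> e) F" if "e \<in> E" for e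
  proof -
    have "closest_point M0 e = e" using EM that by (intro closest_point_self) blast
    then show ?thesis using lim unfolding subspace_tendsto_def by (metis (no_types))
  qed
  have count: "\<forall>\<^sub>F t in F. n_neg (M t) (\<lambda>x. ?b x x) = card {e \<in> E. ?b e e < 0} \<and>
      (\<forall>x\<in>M t. (\<forall>y\<in>M t. ?b x y = 0) \<longrightarrow> x = 0)"
  proof (rule n_neg_eventually_diagonal[OF sym_form_on_slope_gap_form fE])
    show "\<forall>\<^sub>F t in F. subspace (M t) \<and> dim (M t) = card E"
      using M(1) by eventually_elim (simp add: cE lagrangianD)
    show "\<forall>\<^sub>F t in F. closest_point (M t) e \<in> M t" for e
      using M(1) by eventually_elim (simp add: closest_point_in_subspace lagrangianD)
    show "((\<lambda>t. ?b (closest_point (M t) e) (closest_point (M t) e')) \<longlongrightarrow> (if e = e' then ?b e e else 0)) F"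
      if "e \<in> E" "e' \<in> E" for e e'
      using tendsto_inner_forms(2)[OF conv[OF that(1)] conv[OF that(2)], of \<tau> \<sigma>] diag[OF that]
      by (cases "e = e'") simp_all
  qed (rule nz)
  have count0: "n_neg M0 (\<lambda>x. ?b x x) = card {e \<in> E. ?b e e < 0}"
    using slope_basisD(11,12)[OF sb] diag unfolding E_def
    by (intro n_neg_diagonal sym_form_on_subspace[OF sym_form_on_slope_gap_form]
        lagrangianD(1)[OF M(2)] ballI impI) auto
  from count M(1) eventually_transv[OF M lim t(2)] show ?thesis
  proof eventually_elim
    case (elim t)
    then show ?case
      using steep_diff_eq_n_neg[of "M t" \<sigma> \<tau>] steep_diff_eq_n_neg[of M0 \<sigma> \<tau>] M(2) t count0 by simp
  qed
qed

lemma steep_diff_locally_constant: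
  fixes M :: "'p \<Rightarrow> 'n::finite phase set"
  assumes M: "\<forall>\<^sub>F t in F. M t \<in> lagrangians" "M0 \<in> lagrangians" and lim: "subspace_tendsto M M0 F"
    and t: "transv \<tau> M0" "transv \<sigma> M0"
  shows "\<forall>\<^sub>F t in F. int (steep \<tau> (M t)) - int (steep \<sigma> (M t)) = int (steep \<tau> M0) - int (steep \<sigma> M0)"
proof (cases \<tau> \<sigma> rule: linorder_cases)
  case less
  then show ?thesis using steep_diff_locally_constant_aux[OF M lim t] by blast
next
  case equal
  then show ?thesis by simp
next
  case greater
  then show ?thesis using steep_diff_locally_constant_aux[OF M lim t(2,1)] by (auto elim: eventually_mono)
qed

section \<open>Potentials and homotopy invariance\<close>

definition lag_continuous_on :: "'p::topological_space set \<Rightarrow> ('p \<Rightarrow> 'n::finite phase set) \<Rightarrow> bool" where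
  "lag_continuous_on S H \<longleftrightarrow>
     (\<forall>p\<in>S. H p \<in> lagrangians) \<and> (\<forall>x. continuous_on S (\<lambda>p. closest_point (H p) x))"

lemma lag_continuous_onD:
  assumes "lag_continuous_on S H"
  shows "p \<in> S \<Longrightarrow> H p \<in> lagrangians"
    and "p \<in> S \<Longrightarrow> subspace_tendsto H (H p) (at p within S)"
    and "\<forall>\<^sub>F q in at p within S. H q \<in> lagrangians"
  using assms unfolding lag_continuous_on_def subspace_tendsto_def continuous_on_def
  by (auto simp: eventually_at_filter)

lemma lag_continuous_on_compose:
  assumes "lag_continuous_on S H" "continuous_on T f" "f ` T \<subseteq> S"
  shows "lag_continuous_on T (\<lambda>t. H (f t))"
  unfolding lag_continuous_on_def
proof (intro conjI ballI allI)
  show "H (f p) \<in> lagrangians" if "p \<in> T" for p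
    using assms that by (auto simp: lag_continuous_on_def)
  show "continuous_on T (\<lambda>p. closest_point (H (f p)) x)" for x
    using assms(1) continuous_on_compose2[OF _ assms(2,3), of "\<lambda>p. closest_point (H p) x"]
    unfolding lag_continuous_on_def by blast
qed

lemma lag_continuous_on_subset:
  "lag_continuous_on S H \<Longrightarrow> T \<subseteq> S \<Longrightarrow> lag_continuous_on T H"
  using lag_continuous_on_compose[of S H T "\<lambda>x. x"] by auto

lemma lag_continuous_on_iff_continuous_map:
  "lag_continuous_on S H \<longleftrightarrow> continuous_map (top_of_set S) lagrangian_topology H"
proof
  assume H: "lag_continuous_on S H"
  have "continuous_on S (\<lambda>p. closest_point (H p))"
    using H by (intro continuous_on_coordinatewise_then_product) (auto simp: lag_continuous_on_def)
  then show "continuous_map (top_of_set S) lagrangian_topology H"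
    using H unfolding lagrangian_topology_def
    by (intro continuous_map_pullback') (auto simp: lag_continuous_on_def o_def)
next
  assume H: "continuous_map (top_of_set S) lagrangian_topology H"
  have "H p \<in> lagrangians" if "p \<in> S" for p
    using continuous_map_image_subset_topspace[OF H] that
    by (auto simp: lagrangian_topology_def topspace_pullback_topology)
  moreover have "continuous_on S (\<lambda>p. closest_point (H p) x)" for x
  proof -
    have "continuous_map euclidean euclidean (\<lambda>f::'b phase \<Rightarrow> 'b phase. f x)"
      by (simp add: continuous_on_product_coordinates)
    then have "continuous_map lagrangian_topology euclidean ((\<lambda>f::'b phase \<Rightarrow> 'b phase. f x) \<circ> closest_point)"
      unfolding lagrangian_topology_def by (rule continuous_map_pullback)
    from continuous_map_compose[OF H this] show ?thesis by (simp add: o_def)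
  qed
  ultimately show "lag_continuous_on S H" by (simp add: lag_continuous_on_def)
qed

text \<open>
  The numbers \<open>steep \<tau> (H p)\<close> are only defined, for each \<open>\<tau>\<close>, where \<open>H p\<close> is transversal to
  the Lagrangian of slope \<open>\<tau>\<close>, and they are not continuous.  But on overlaps they differ by locally
  constant functions, so that they have a common integer-valued potential up to locally constant
  functions whenever the parameter space has no obstruction.  The drop of the potential along a
  path is its Maslov index.
\<close>

definition maslov_potential ::
    "'p::topological_space set \<Rightarrow> ('p \<Rightarrow> 'n::finite phase set) \<Rightarrow> ('p \<Rightarrow> int) \<Rightarrow> bool" where
  "maslov_potential S H G \<longleftrightarrow> (\<forall>p\<in>S. \<forall>\<tau>. transv \<tau> (H p) \<longrightarrow>
     (\<forall>\<^sub>F q in nhds p. q \<in> S \<longrightarrow> int (steep \<tau> (H q)) - G q = int (steep \<tau> (H p)) - G p))"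

lemma maslov_potentialI:
  fixes H :: "'p::topological_space \<Rightarrow> 'n::finite phase set"
  assumes H: "lag_continuous_on S H"
    and ex: "\<And>p. p \<in> S \<Longrightarrow> \<exists>\<tau>. transv \<tau> (H p) \<and>
      (\<forall>\<^sub>F q in nhds p. q \<in> S \<longrightarrow> int (steep \<tau> (H q)) - G q = int (steep \<tau> (H p)) - G p)"
  shows "maslov_potential S H G"
  unfolding maslov_potential_def
proof (intro ballI allI impI)
  fix p \<sigma> assume p: "p \<in> S" and s: "transv \<sigma> (H p)"
  from ex[OF p] obtain \<tau> where t: "transv \<tau> (H p)"
    "\<forall>\<^sub>F q in nhds p. q \<in> S \<longrightarrow> int (steep \<tau> (H q)) - G q = int (steep \<tau> (H p)) - G p" by blast
  have "\<forall>\<^sub>F q in at p within S. int (steep \<tau> (H q)) - int (steep \<sigma> (H q)) =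
      int (steep \<tau> (H p)) - int (steep \<sigma> (H p))"
    using lag_continuous_onD[OF H] p
    by (intro steep_diff_locally_constant t(1) s) auto
  then have "\<forall>\<^sub>F q in nhds p. q \<in> S \<longrightarrow> int (steep \<tau> (H q)) - int (steep \<sigma> (H q)) =
      int (steep \<tau> (H p)) - int (steep \<sigma> (H p))"
    unfolding eventually_at_filter by eventually_elim auto
  with t(2) show "\<forall>\<^sub>F q in nhds p. q \<in> S \<longrightarrow> int (steep \<sigma> (H q)) - G q = int (steep \<sigma> (H p)) - G p"
    by eventually_elim auto
qed

lemma maslov_potential_compose:
  assumes G: "maslov_potential S H G" and f: "continuous_on T f" "f ` T \<subseteq> S"
  shows "maslov_potential T (\<lambda>t. H (f t)) (\<lambda>t. G (f t))"
  unfolding maslov_potential_def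
proof (intro ballI allI impI)
  fix p \<tau> assume p: "p \<in> T" and t: "transv \<tau> (H (f p))"
  have fp: "f p \<in> S" using p f by auto
  have ev: "\<forall>\<^sub>F q in nhds (f p). q \<in> S \<longrightarrow> int (steep \<tau> (H q)) - G q = int (steep \<tau> (H (f p))) - G (f p)"
    using G fp t unfolding maslov_potential_def by blast
  have "filterlim f (nhds (f p)) (at p within T)"
    using f(1) p by (simp add: continuous_on_def)
  from eventually_compose_filterlim[OF ev this]
  show "\<forall>\<^sub>F q in nhds p. q \<in> T \<longrightarrow> int (steep \<tau> (H (f q))) - G (f q) = int (steep \<tau> (H (f p))) - G (f p)"
    unfolding eventually_at_filter by eventually_elim (use f(2) in auto)
qed

lemma maslov_potential_subset:
  "maslov_potential S H G \<Longrightarrow> T \<subseteq> S \<Longrightarrow> maslov_potential T H G"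
  using maslov_potential_compose[of S H G T "\<lambda>x. x"] by auto

text \<open>
  Two potentials both follow the same number \<open>steep \<tau>\<close> near each point, so their difference is
  locally constant.
\<close>

lemma maslov_potential_unique:
  fixes H :: "'p::topological_space \<Rightarrow> 'n::finite phase set"
  assumes H: "lag_continuous_on S H" and S: "connected S"
    and G: "maslov_potential S H G" "maslov_potential S H G'" and pq: "p \<in> S" "q \<in> S"
  shows "G p - G' p = G q - G' q"
proof (rule connected_local_const[where f = "\<lambda>p. G p - G' p", OF S pq], intro ballI)
  fix a assume a: "a \<in> S"
  obtain \<tau> where "transv \<tau> (H a)" using transv_exists lag_continuous_onD(1)[OF H a] by blast
  with G a have "\<forall>\<^sub>F q in nhds a. q \<in> S \<longrightarrow> int (steep \<tau> (H q)) - G q = int (steep \<tau> (H a)) - G a"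
    "\<forall>\<^sub>F q in nhds a. q \<in> S \<longrightarrow> int (steep \<tau> (H q)) - G' q = int (steep \<tau> (H a)) - G' a"
    unfolding maslov_potential_def by blast+
  then have "\<forall>\<^sub>F q in nhds a. q \<noteq> a \<longrightarrow> q \<in> S \<longrightarrow> G a - G' a = G q - G' q"
    by eventually_elim auto
  then show "\<forall>\<^sub>F q in at a within S. G a - G' a = G q - G' q"
    unfolding eventually_at_filter .
qed

lemma maslov_potential_single_chart:
  assumes "lag_continuous_on S H" "\<And>p. p \<in> S \<Longrightarrow> transv \<tau> (H p)"
  shows "maslov_potential S H (\<lambda>p. int (steep \<tau> (H p)))"
  using assms by (intro maslov_potentialI exI[of _ \<tau>]) auto

text \<open>
  On the connected overlap the two potentials differ by a constant, which is subtracted from one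
  of them.
\<close>

lemma maslov_potential_glue:
  fixes H :: "'p::topological_space \<Rightarrow> 'n::finite phase set"
  assumes H: "lag_continuous_on (A \<union> B) H" and cl: "closed A" "closed B" and con: "connected (A \<inter> B)"
    and G: "maslov_potential A H GA" "maslov_potential B H GB"
  shows "\<exists>G. maslov_potential (A \<union> B) H G"
proof -
  have HAB: "lag_continuous_on (A \<inter> B) H" using lag_continuous_on_subset[OF H] by blast
  have GAB: "maslov_potential (A \<inter> B) H GA" "maslov_potential (A \<inter> B) H GB"
    using maslov_potential_subset G by blast+
  obtain k where k: "\<And>p. p \<in> A \<inter> B \<Longrightarrow> GA p - GB p = k"
    using maslov_potential_unique[OF HAB con GAB] by metis
  define G where "G p = (if p \<in> A then GA p else GB p + k)" for p
  have GB: "G p = GB p + k" if "p \<in> B" for p using k[of p] that by (auto simp: G_def)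
  have near: "\<forall>\<^sub>F q in nhds p. q \<in> C \<longrightarrow> int (steep \<tau> (H q)) - G q = int (steep \<tau> (H p)) - G p"
    if C: "C = A \<or> C = B" and p: "p \<in> A \<union> B" and t: "transv \<tau> (H p)" for C p \<tau>
  proof (cases "p \<in> C")
    case True
    from C show ?thesis
    proof
      assume "C = A"
      with G(1) True t show ?thesis unfolding maslov_potential_def
        by (auto simp: G_def elim!: eventually_mono dest!: bspec[of A _ p])
    next
      assume "C = B"
      with G(2) True t have "\<forall>\<^sub>F q in nhds p. q \<in> B \<longrightarrow> int (steep \<tau> (H q)) - GB q = int (steep \<tau> (H p)) - GB p"
        unfolding maslov_potential_def by blast
      then show ?thesis
        by eventually_elim (use True \<open>C = B\<close> GB in auto)
    qed
  next
    case False
    then have "\<forall>\<^sub>F q in nhds p. q \<in> - C"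
      using C cl by (intro eventually_nhds_in_open) auto
    then show ?thesis by eventually_elim auto
  qed
  have "maslov_potential (A \<union> B) H G"
    unfolding maslov_potential_def
  proof (intro ballI allI impI)
    fix p \<tau> assume "p \<in> A \<union> B" "transv \<tau> (H p)"
    from near[OF _ this, of A] near[OF _ this, of B]
    show "\<forall>\<^sub>F q in nhds p. q \<in> A \<union> B \<longrightarrow> int (steep \<tau> (H q)) - G q = int (steep \<tau> (H p)) - G p"
      by (auto elim: eventually_elim2)
  qed
  then show ?thesis by blast
qed

text \<open>
  Potentials exist on small rectangles and can be glued along a common side, which is connected.
  Subdividing first one side and then the other yields a potential on every rectangle.
\<close>

lemma maslov_potential_rectangle:
  fixes H :: "real \<times> real \<Rightarrow> 'n::finite phase set"
  assumes H: "lag_continuous_on ({a..b} \<times> {c..d}) H" and "a \<le> b" "c \<le> d"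
  shows "\<exists>G. maslov_potential ({a..b} \<times> {c..d}) H G"
proof -
  let ?S = "{a..b} \<times> {c..d}"
  define pot where "pot s1 s2 x y \<longleftrightarrow> (\<exists>G. maslov_potential ({s1..s2} \<times> {x..y}) H G)" for s1 s2 x y
  have box: "\<exists>e>0. \<forall>s1 s2 x y. a \<le> s1 \<and> s1 \<le> s \<and> s \<le> s2 \<and> s2 \<le> b \<and> s2 - s1 < e \<and>
      c \<le> x \<and> x \<le> t \<and> t \<le> y \<and> y \<le> d \<and> y - x < e \<longrightarrow> pot s1 s2 x y"
    if st: "(s, t) \<in> ?S" for s t
  proof -
    obtain \<tau> where \<tau>: "transv \<tau> (H (s, t))" using transv_exists lag_continuous_onD(1)[OF H st] by blast
    have "\<forall>\<^sub>F q in at (s, t) within ?S. transv \<tau> (H q)"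
      using lag_continuous_onD[OF H] st \<tau> by (intro eventually_transv) auto
    then obtain e where e: "e > 0" "\<And>q. q \<in> ?S \<Longrightarrow> dist q (s, t) < e \<Longrightarrow> transv \<tau> (H q)"
      using \<tau> unfolding eventually_at by (metis)
    have "pot s1 s2 x y" if *: "a \<le> s1" "s1 \<le> s" "s \<le> s2" "s2 \<le> b" "s2 - s1 < e / 2"
      "c \<le> x" "x \<le> t" "t \<le> y" "y \<le> d" "y - x < e / 2" for s1 s2 x y
    proof -
      have sub: "{s1..s2} \<times> {x..y} \<subseteq> ?S" using * by auto
      have "transv \<tau> (H q)" if q: "q \<in> {s1..s2} \<times> {x..y}" for q
      proof (rule e(2))
        show "q \<in> ?S" using q sub by blast
        have "s1 \<le> fst q" "fst q \<le> s2" "x \<le> snd q" "snd q \<le> y" using q by (cases q; auto)+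
        then have "\<bar>fst q - s\<bar> < e / 2" "\<bar>snd q - t\<bar> < e / 2" using * by linarith+
        moreover have "dist q (s, t) \<le> \<bar>fst q - s\<bar> + \<bar>snd q - t\<bar>"
          by (cases q) (simp add: dist_Pair_Pair dist_real_def sqrt_sum_squares_le_sum_abs)
        ultimately show "dist q (s, t) < e" by simp
      qed
      then show ?thesis
        unfolding pot_def
        using maslov_potential_single_chart[OF lag_continuous_on_subset[OF H sub]] by blast
    qed
    then show ?thesis using e(1) by (intro exI[of _ "e/2"]) auto
  qed
  have glue: "pot s1 s3 x z"
    if "pot s1 s2 x y" "pot s2' s3 x' z" "a \<le> s1" "s3 \<le> b" "c \<le> x" "z \<le> d"
      "s1 \<le> s2 \<and> s2 = s2' \<and> s2 \<le> s3 \<and> x = x' \<and> y = z \<or> s1 = s2' \<and> s2 = s3 \<and> x \<le> y \<and> y = x' \<and> y \<le> z"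
    for s1 s2 s2' s3 x x' y z
  proof -
    have un: "{s1..s3} \<times> {x..z} = {s1..s2} \<times> {x..y} \<union> {s2'..s3} \<times> {x'..z}" using that(7) by force
    have "connected ({s1..s2} \<times> {x..y} \<inter> {s2'..s3} \<times> {x'..z})"
      unfolding Times_Int_Times
      using that(7) by (intro connected_Times) (auto simp: Int_atLeastAtMost)
    moreover have "lag_continuous_on ({s1..s2} \<times> {x..y} \<union> {s2'..s3} \<times> {x'..z}) H"
      unfolding un[symmetric] using that by (intro lag_continuous_on_subset[OF H]) auto
    ultimately show ?thesis
      using that(1,2) maslov_potential_glue[of "{s1..s2} \<times> {x..y}" "{s2'..s3} \<times> {x'..z}" H]
      unfolding pot_def un by (auto simp: closed_Times)
  qed
  have strip: "\<exists>e>0. \<forall>s1 s2. a \<le> s1 \<and> s1 \<le> s \<and> s \<le> s2 \<and> s2 \<le> b \<and> s2 - s1 < e \<longrightarrow> pot s1 s2 c d"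
    if s: "s \<in> {a..b}" for s
  proof -
    define P where "P x y \<longleftrightarrow> (c \<le> x \<and> y \<le> d \<longrightarrow> (\<exists>e>0. \<forall>s1 s2. a \<le> s1 \<and> s1 \<le> s \<and> s \<le> s2 \<and> s2 \<le> b \<and> s2 - s1 < e \<longrightarrow>
      pot s1 s2 x y))" for x y
    have "P c d"
      using \<open>c \<le> d\<close>
    proof (induction rule: Bolzano)
      case (trans x y z)
      show ?case unfolding P_def
      proof (intro impI)
        assume xz: "c \<le> x \<and> z \<le> d"
        from trans xz obtain e1 where e1: "e1 > 0"
          "\<And>s1 s2. a \<le> s1 \<and> s1 \<le> s \<and> s \<le> s2 \<and> s2 \<le> b \<and> s2 - s1 < e1 \<Longrightarrow> pot s1 s2 x y"
          unfolding P_def by (metis order_trans)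
        from trans xz obtain e2 where e2: "e2 > 0"
          "\<And>s1 s2. a \<le> s1 \<and> s1 \<le> s \<and> s \<le> s2 \<and> s2 \<le> b \<and> s2 - s1 < e2 \<Longrightarrow> pot s1 s2 y z"
          unfolding P_def by (metis order_trans)
        have "pot s1 s2 x z" if "a \<le> s1 \<and> s1 \<le> s \<and> s \<le> s2 \<and> s2 \<le> b \<and> s2 - s1 < min e1 e2" for s1 s2
          using glue[OF e1(2) e2(2), of s1 s2 s1 s2] that trans xz by auto
        then show "\<exists>e>0. \<forall>s1 s2. a \<le> s1 \<and> s1 \<le> s \<and> s \<le> s2 \<and> s2 \<le> b \<and> s2 - s1 < e \<longrightarrow> pot s1 s2 x z"
          using e1(1) e2(1) by (intro exI[of _ "min e1 e2"]) auto
      qed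
    next
      case (local t)
      with s have "(s, t) \<in> ?S" by auto
      from box[OF this] obtain e where "e > 0" "\<And>s1 s2 x y. a \<le> s1 \<and> s1 \<le> s \<and> s \<le> s2 \<and> s2 \<le> b \<and> s2 - s1 < e \<and>
        c \<le> x \<and> x \<le> t \<and> t \<le> y \<and> y \<le> d \<and> y - x < e \<Longrightarrow> pot s1 s2 x y" by metis
      then show ?case unfolding P_def by (intro exI[of _ e]) auto
    qed
    then show ?thesis unfolding P_def by auto
  qed
  have "a \<le> a \<and> b \<le> b \<longrightarrow> pot a b c d"
    using \<open>a \<le> b\<close>
  proof (induction rule: Bolzano[where P = "\<lambda>x y. a \<le> x \<and> y \<le> b \<longrightarrow> pot x y c d"])
    case (trans x y z)
    then show ?case using glue[of x y c d y z c d] by auto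
  next
    case (local s)
    then have "s \<in> {a..b}" by simp
    from strip[OF this] obtain e where "e > 0"
      "\<And>s1 s2. a \<le> s1 \<and> s1 \<le> s \<and> s \<le> s2 \<and> s2 \<le> b \<and> s2 - s1 < e \<Longrightarrow> pot s1 s2 c d" by metis
    then show ?case by (intro exI[of _ e]) auto
  qed
  then show ?thesis by (simp add: pot_def)
qed

text \<open>
  At most one \<open>k\<close> qualifies for a continuous path, because potentials on an interval differ by
  constants.
\<close>

definition path_index :: "(real \<Rightarrow> 'n::finite phase set) \<Rightarrow> real \<Rightarrow> real \<Rightarrow> int \<Rightarrow> bool" where
  "path_index \<Gamma> a b k \<longleftrightarrow> (\<exists>G. maslov_potential {a..b} \<Gamma> G \<and> k = G a - G b)"

lemma path_index_unique:
  assumes "lag_continuous_on {a..b} \<Gamma>" "a \<le> b" "path_index \<Gamma> a b k" "path_index \<Gamma> a b k'"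
  shows "k = k'"
proof -
  obtain G G' where G: "maslov_potential {a..b} \<Gamma> G" "k = G a - G b"
    "maslov_potential {a..b} \<Gamma> G'" "k' = G' a - G' b"
    using assms(3,4) unfolding path_index_def by blast
  have "G a - G' a = G b - G' b"
    using assms(2) by (intro maslov_potential_unique[OF assms(1) _ G(1,3)]) auto
  then show ?thesis using G by simp
qed

lemma path_index_single_chart:
  assumes "lag_continuous_on {a..b} \<Gamma>" "\<And>t. t \<in> {a..b} \<Longrightarrow> transv \<tau> (\<Gamma> t)"
  shows "path_index \<Gamma> a b (int (steep \<tau> (\<Gamma> a)) - int (steep \<tau> (\<Gamma> b)))"
  using maslov_potential_single_chart[OF assms] unfolding path_index_def by auto

text \<open>
  A potential on the square of the homotopy is constant along the two sides on which the path is
  held fixed, because it is a potential of a constant path there.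
\<close>

lemma path_index_homotopic:
  fixes \<Gamma> :: "real \<Rightarrow> 'n::finite phase set"
  assumes hom: "homotopic_with (\<lambda>\<gamma>. \<gamma> a = \<Gamma> a \<and> \<gamma> b = \<Gamma> b) (top_of_set {a..b}) lagrangian_topology \<Gamma> \<Delta>"
    and "a \<le> b"
  shows "\<exists>k. path_index \<Gamma> a b k \<and> path_index \<Delta> a b k"
proof -
  obtain h where h: "continuous_map (prod_topology (top_of_set {0..1::real}) (top_of_set {a..b})) lagrangian_topology h"
    "\<And>t. h (0, t) = \<Gamma> t" "\<And>t. h (1, t) = \<Delta> t" "\<And>s. s \<in> {0..1} \<Longrightarrow> h (s, a) = \<Gamma> a \<and> h (s, b) = \<Gamma> b"
    using hom unfolding homotopic_with_def by auto
  let ?S = "{0..1::real} \<times> {a..b}"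
  have H: "lag_continuous_on ?S h"
    using h(1) by (simp add: lag_continuous_on_iff_continuous_map)
  obtain G where G: "maslov_potential ?S h G"
    using maslov_potential_rectangle[OF H] \<open>a \<le> b\<close> by auto
  have side: "G (0, x) = G (1, x)" if x: "x \<in> {a..b}" "\<And>s. s \<in> {0..1} \<Longrightarrow> h (s, x) = \<Gamma> x" for x
  proof -
    have c: "continuous_on {0..1::real} (\<lambda>s. (s, x))" "(\<lambda>s. (s, x)) ` {0..1} \<subseteq> ?S"
      using x by (auto intro!: continuous_intros)
    have L: "lag_continuous_on {0..1::real} (\<lambda>s. h (s, x))" by (rule lag_continuous_on_compose[OF H c])
    have "\<Gamma> x \<in> lagrangians" using lag_continuous_onD(1)[OF L, of 0] x(2)[of 0] by simp
    then obtain \<tau> where "transv \<tau> (\<Gamma> x)" using transv_exists by blast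
    then have "maslov_potential {0..1::real} (\<lambda>s. h (s, x)) (\<lambda>s. int (steep \<tau> (h (s, x))))"
      using x(2) by (intro maslov_potential_single_chart[OF L]) simp
    from maslov_potential_unique[OF L _ maslov_potential_compose[OF G c] this, of 0 1]
    show ?thesis using x(2)[of 0] x(2)[of 1] by simp
  qed
  have "maslov_potential {a..b} (\<lambda>t. h (s, t)) (\<lambda>t. G (s, t))" if "s \<in> {0..1}" for s
    by (rule maslov_potential_compose[OF G]) (use that in \<open>auto intro!: continuous_intros\<close>)
  from this[of 0] this[of 1] have "maslov_potential {a..b} \<Gamma> (\<lambda>t. G (0, t))" "maslov_potential {a..b} \<Delta> (\<lambda>t. G (1, t))"
    using h(2,3) by simp_all
  then have "path_index \<Gamma> a b (G (0, a) - G (0, b))" "path_index \<Delta> a b (G (1, a) - G (1, b))"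
    unfolding path_index_def by blast+
  moreover have "G (0, a) = G (1, a)" "G (0, b) = G (1, b)"
    using h(4) \<open>a \<le> b\<close> by (auto intro!: side)
  ultimately show ?thesis by auto
qed

section \<open>The change of the number of steep directions at a crossing\<close>

lemma n_neg_trivial [simp]: "n_neg {0} Q = 0"
proof -
  obtain W where "W \<subseteq> {0::'a}" "dim W = n_neg {0} Q"
    using n_neg_witness[of "{0}" Q] by auto
  then show ?thesis using dim_subset[of W "{0}"] by simp
qed

text \<open>
  Near a crossing, \<open>M t\<close> contains vectors close to the non-vertical basis vectors of \<open>M0\<close>, on
  which the form is close to its value at \<open>M0\<close>, and curves \<open>c\<close> issuing from the vertical vectors.
  The latter become visible after division by the square root of the time scale \<open>\<delta>\<close>: the form of
  \<open>c / \<surd>\<delta>\<close> converges to \<open>b\<close>.  The mixed terms vanish in the limit because \<open>M t\<close> is isotropic.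
  The scale \<open>\<delta>\<close> is linear at a regular crossing and quadratic if the crossing form vanishes.
\<close>

lemma steep_eventually_near_crossing:
  fixes M :: "'p \<Rightarrow> 'n::finite phase set"
  assumes M: "\<forall>\<^sub>F t in F. M t \<in> lagrangians" "M0 \<in> lagrangians" and lim: "subspace_tendsto M M0 F"
    and \<tau>: "transv \<tau> M0"
    and \<delta>: "\<forall>\<^sub>F t in F. 0 < \<delta> t" "(\<delta> \<longlongrightarrow> 0) F"
    and b: "sym_form_on (M0 \<inter> vertical) b"
    and nondeg: "\<And>x. x \<in> M0 \<inter> vertical \<Longrightarrow> \<forall>y\<in>M0 \<inter> vertical. b x y = 0 \<Longrightarrow> x = 0"
    and curve: "\<And>q. q \<in> M0 \<inter> vertical \<Longrightarrow> \<exists>c C. (\<forall>\<^sub>F t in F. c t \<in> M t) \<and> (c \<longlongrightarrow> q) F \<and>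
      (\<forall>\<^sub>F t in F. norm (fst (c t)) \<le> C * \<delta> t) \<and>
      (\<forall>q'\<in>M0 \<inter> vertical. ((\<lambda>t. omega q' (c t) / \<delta> t) \<longlongrightarrow> b q' q) F)"
  shows "\<forall>\<^sub>F t in F. steep \<tau> (M t) = steep \<tau> M0 + n_neg (M0 \<inter> vertical) (\<lambda>q. b q q) \<and>
    M t \<inter> vertical = {0}"
proof -
  let ?K = "M0 \<inter> vertical"
  let ?b = "slope_form \<tau>"
  note sub0 = lagrangianD(1)[OF M(2)]
  have sub: "\<forall>\<^sub>F t in F. subspace (M t)" using M(1) by eventually_elim (rule lagrangianD)
  obtain X Y lam where sb: "slope_basis M0 X Y lam" using lagrangian_slope_basis[OF M(2)] by blast
  obtain B where B: "B \<subseteq> ?K" "finite B" "pairwise orthogonal B" "\<forall>x\<in>B. norm x = 1"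
    "span B = ?K" "\<forall>x\<in>B. \<forall>y\<in>B. x \<noteq> y \<longrightarrow> b x y = 0"
    using sym_form_on_diagonalize[OF b] by blast
  have indB: "independent B" using B(3,4) by (intro pairwise_orthogonal_independent) auto
  define L where "L = (\<lambda>x. (x, lam x *\<^sub>R x)) ` X"
  have LM: "L \<subseteq> M0" using slope_basisD(13)[OF sb] by (simp add: L_def)
  have fL: "finite L" using slope_basisD(1)[OF sb] by (simp add: L_def)
  have Lfst: "fst e \<noteq> 0" if "e \<in> L" for e
    using that slope_basisD(3)[OF sb] by (force simp: L_def)
  have disj: "L \<inter> B = {}" using Lfst B(1) by (fastforce simp: mem_vertical)
  have bnz: "b e e \<noteq> 0" if e: "e \<in> B" for e
  proof
    assume ee: "b e e = 0"
    have eK: "e \<in> ?K" using e B(1) by blast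
    have "b e y = 0" if yK: "y \<in> ?K" for y
    proof -
      obtain f where y: "y = (\<Sum>v\<in>B. f v *\<^sub>R v)" using yK span_finite[OF B(2)] B(5) by auto
      have "b y e = (\<Sum>v\<in>B. f v * b v e)"
        unfolding y by (rule sym_form_on_sum[OF b B(2) _ eK]) (use B(1) in blast)
      also have "\<dots> = 0" using B(6) e ee by (intro sum.neutral) auto
      finally show ?thesis using sym_form_onD(2)[OF b eK yK] by simp
    qed
    then have "e = 0" using nondeg[OF eK] by blast
    then show False using B(4) e by auto
  qed
  have cardB: "card B = card Y"
  proof -
    have "independent (Pair 0 ` Y :: 'n phase set)"
      by (rule independent_mono[OF slope_basisD(11)[OF sb]]) blast
    then have "dim (span (Pair 0 ` Y :: 'n phase set)) = card (Pair 0 ` Y :: 'n phase set)"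
      by (rule dim_span_eq_card_independent)
    also have "\<dots> = card Y" by (rule card_image) (auto simp: inj_on_def)
    finally have "dim ?K = card Y" unfolding slope_basisD(10)[OF sb] .
    moreover have "dim ?K = card B"
      using dim_span_eq_card_independent[OF indB] unfolding B(5) .
    ultimately show ?thesis by simp
  qed
  have cardE: "card (L \<union> B) = CARD('n)"
  proof -
    have "card L = card X" unfolding L_def by (rule card_image) (auto simp: inj_on_def)
    then show ?thesis
      using card_Un_disjoint[OF fL B(2) disj] cardB slope_basisD(8)[OF sb] by simp
  qed
  define R where "R q c C \<longleftrightarrow> (\<forall>\<^sub>F t in F. c t \<in> M t) \<and> (c \<longlongrightarrow> q) F \<and>
      (\<forall>\<^sub>F t in F. norm (fst (c t)) \<le> C * \<delta> t) \<and>
      (\<forall>q'\<in>?K. ((\<lambda>t. omega q' (c t) / \<delta> t) \<longlongrightarrow> b q' q) F)" for q c C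
  have "\<forall>q\<in>?K. \<exists>c C. R q c C" using curve unfolding R_def by blast
  then obtain cv C where "\<And>q. q \<in> ?K \<Longrightarrow> R q (cv q) (C q)" by metis
  then have cv: "\<And>q. q \<in> ?K \<Longrightarrow> (\<forall>\<^sub>F t in F. cv q t \<in> M t) \<and> (cv q \<longlongrightarrow> q) F \<and>
      (\<forall>\<^sub>F t in F. norm (fst (cv q t)) \<le> C q * \<delta> t) \<and>
      (\<forall>q'\<in>?K. ((\<lambda>t. omega q' (cv q t) / \<delta> t) \<longlongrightarrow> b q' q) F)"
    unfolding R_def .
  \<comment> \<open>The family that replaces the basis of \<open>M0\<close>: its Gram matrix converges to the diagonal matrix \<open>\<beta>\<close>.\<close>
  define c where "c e t = (if e \<in> B then (1 / sqrt (\<delta> t)) *\<^sub>R cv e t else closest_point (M t) e)" for e t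
  define \<beta> where "\<beta> e = (if e \<in> B then b e e else ?b e e)" for e
  have cM: "\<forall>\<^sub>F t in F. c e t \<in> M t" if "e \<in> L \<union> B" for e
  proof (cases "e \<in> B")
    case True
    then have "\<forall>\<^sub>F t in F. cv e t \<in> M t" using cv B(1) by blast
    with sub show ?thesis by eventually_elim (simp add: c_def True subspace_scale)
  next
    case False
    then show ?thesis
      using sub by (auto simp: c_def closest_point_in_subspace elim: eventually_mono)
  qed
  have conv: "(c e \<longlongrightarrow> e) F" if "e \<in> L" for e
  proof -
    have "closest_point M0 e = e" using LM that by (intro closest_point_self) blast
    moreover have "((\<lambda>t. closest_point (M t) e) \<longlongrightarrow> closest_point M0 e) F"
      using lim unfolding subspace_tendsto_def by blast
    moreover have "c e = (\<lambda>t. closest_point (M t) e)" 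
    proof -
      have "e \<notin> B" using that disj by blast
      then show ?thesis by (intro ext) (simp add: c_def)
    qed
    ultimately show ?thesis by simp
  qed
  have swap: "\<forall>\<^sub>F t in F. ?b (c e t) (c e' t) = \<tau> * (fst (c e t) \<bullet> fst (c e' t)) - fst (c e' t) \<bullet> snd (c e t)"
    if "e \<in> L \<union> B" "e' \<in> L \<union> B" for e e'
    using cM[OF that(1)] cM[OF that(2)] M(1)
  proof eventually_elim
    case (elim t)
    then have "fst (c e t) \<bullet> snd (c e' t) = fst (c e' t) \<bullet> snd (c e t)"
      by (intro lagrangian_inner_commute)
    then show ?case by (simp add: slope_form_def)
  qed
  have small: "((\<lambda>t. fst (c e t)) \<longlongrightarrow> 0) F" if e: "e \<in> B" for e
  proof (rule Lim_null_comparison)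
    have "\<forall>\<^sub>F t in F. norm (fst (cv e t)) \<le> C e * \<delta> t" using cv e B(1) by blast
    with \<delta>(1) show "\<forall>\<^sub>F t in F. norm (fst (c e t)) \<le> C e * sqrt (\<delta> t)"
    proof eventually_elim
      case (elim t)
      have "norm (fst (c e t)) = norm (fst (cv e t)) / sqrt (\<delta> t)"
        using elim(1) e by (simp add: c_def)
      also have "\<dots> \<le> (C e * \<delta> t) / sqrt (\<delta> t)" using elim by (intro divide_right_mono) auto
      also have "\<dots> = C e * sqrt (\<delta> t)" using real_div_sqrt[of "\<delta> t"] elim(1) by (metis less_imp_le times_divide_eq_right)
      finally show ?case .
    qed
    have "((\<lambda>t. C e * sqrt (\<delta> t)) \<longlongrightarrow> C e * sqrt 0) F" by (intro tendsto_intros \<delta>(2))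
    then show "((\<lambda>t. C e * sqrt (\<delta> t)) \<longlongrightarrow> 0) F" by simp
  qed
  have mixed: "((\<lambda>t. ?b (c e t) (c e' t)) \<longlongrightarrow> 0) F" if "e \<in> L" "e' \<in> B" for e e'
  proof -
    have "((\<lambda>t. \<tau> * (fst (c e t) \<bullet> fst (c e' t)) - fst (c e' t) \<bullet> snd (c e t)) \<longlongrightarrow>
        \<tau> * (fst e \<bullet> 0) - 0 \<bullet> snd e) F"
      by (intro tendsto_intros conv small that)
    moreover have "\<forall>\<^sub>F t in F. ?b (c e t) (c e' t) = \<tau> * (fst (c e t) \<bullet> fst (c e' t)) - fst (c e' t) \<bullet> snd (c e t)"
      using that by (intro swap) auto
    ultimately show ?thesis by (subst tendsto_cong) simp_all
  qed
  have vert: "((\<lambda>t. ?b (c e t) (c e' t)) \<longlongrightarrow> b e e') F" if e: "e \<in> B" "e' \<in> B" for e e'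
  proof -
    have eK: "e \<in> ?K" "e' \<in> ?K" using e B(1) by auto
    have 1: "((\<lambda>t. \<tau> * (fst (c e t) \<bullet> fst (c e' t))) \<longlongrightarrow> \<tau> * ((0::real^'n) \<bullet> 0)) F"
      by (intro tendsto_intros small e)
    have 2: "((\<lambda>t. (fst (cv e' t) \<bullet> (snd (cv e t) - snd e)) / \<delta> t) \<longlongrightarrow> 0) F"
    proof (rule Lim_null_comparison)
      have "\<forall>\<^sub>F t in F. norm (fst (cv e' t)) \<le> C e' * \<delta> t" using cv eK by blast
      with \<delta>(1) show "\<forall>\<^sub>F t in F. norm ((fst (cv e' t) \<bullet> (snd (cv e t) - snd e)) / \<delta> t) \<le>
          C e' * norm (snd (cv e t) - snd e)"
      proof eventually_elim
        case (elim t)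
        have "norm (fst (cv e' t) \<bullet> (snd (cv e t) - snd e)) \<le>
            norm (fst (cv e' t)) * norm (snd (cv e t) - snd e)"
          using Cauchy_Schwarz_ineq2 by auto
        also have "\<dots> \<le> (C e' * \<delta> t) * norm (snd (cv e t) - snd e)"
          using elim by (intro mult_right_mono) auto
        finally show ?case using elim(1) by (simp add: field_simps)
      qed
      have "(cv e \<longlongrightarrow> e) F" using cv eK by blast
      then have "((\<lambda>t. C e' * norm (snd (cv e t) - snd e)) \<longlongrightarrow> C e' * norm (snd e - snd e)) F"
        by (intro tendsto_intros)
      then show "((\<lambda>t. C e' * norm (snd (cv e t) - snd e)) \<longlongrightarrow> 0) F" by simp
    qed
    have 3: "((\<lambda>t. omega e (cv e' t) / \<delta> t) \<longlongrightarrow> b e e') F" using cv eK by blast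
    have "((\<lambda>t. \<tau> * (fst (c e t) \<bullet> fst (c e' t)) - (fst (cv e' t) \<bullet> (snd (cv e t) - snd e)) / \<delta> t
        + omega e (cv e' t) / \<delta> t) \<longlongrightarrow> \<tau> * ((0::real^'n) \<bullet> 0) - 0 + b e e') F"
      by (intro tendsto_intros 1 2 3)
    moreover have "\<forall>\<^sub>F t in F. ?b (c e t) (c e' t) =
        \<tau> * (fst (c e t) \<bullet> fst (c e' t)) - (fst (cv e' t) \<bullet> (snd (cv e t) - snd e)) / \<delta> t
        + omega e (cv e' t) / \<delta> t"
      using swap[OF UnI2[OF e(1)] UnI2[OF e(2)]] \<delta>(1)
    proof eventually_elim
      fix t assume sw: "?b (c e t) (c e' t) = \<tau> * (fst (c e t) \<bullet> fst (c e' t)) - fst (c e' t) \<bullet> snd (c e t)"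
        and pos: "0 < \<delta> t"
      have "fst (c e' t) \<bullet> snd (c e t) = (fst (cv e' t) \<bullet> snd (cv e t)) / \<delta> t"
        using e pos by (simp add: c_def)
      moreover have "omega e (cv e' t) = - (fst (cv e' t) \<bullet> snd e)"
        using eK by (simp add: omega_pair mem_vertical inner_commute)
      ultimately show "?b (c e t) (c e' t) =
          \<tau> * (fst (c e t) \<bullet> fst (c e' t)) - (fst (cv e' t) \<bullet> (snd (cv e t) - snd e)) / \<delta> t
          + omega e (cv e' t) / \<delta> t"
        using sw by (simp add: inner_diff_right diff_divide_distrib)
    qed
    ultimately show ?thesis by (subst tendsto_cong) simp_all
  qed
  have diagL: "?b e e' = 0" if "e \<in> L" "e' \<in> L" "e \<noteq> e'" for e e'
    using slope_basis_diagonal[OF sym_form_on_slope_form sb,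
        where f = "\<lambda>x u. \<tau> - (lam x + lam u) / 2" and g = "\<lambda>x. - 1 / 2" and k = 0,
        OF slope_form_lines(1-3), of e e'] that by (simp add: L_def)
  have lims: "((\<lambda>t. ?b (c e t) (c e' t)) \<longlongrightarrow> (if e = e' then \<beta> e else 0)) F"
    if "e \<in> L \<union> B" "e' \<in> L \<union> B" for e e'
  proof (cases "e \<in> B")
    case True
    show ?thesis
    proof (cases "e' \<in> B")
      case e': True
      then show ?thesis using vert[OF True e'] B(6) True by (auto simp: \<beta>_def)
    next
      case False
      then have "e' \<in> L" using that by blast
      from mixed[OF this True] have "((\<lambda>t. ?b (c e t) (c e' t)) \<longlongrightarrow> 0) F"
        using sym_form_onD(2)[OF sym_form_on_slope_form, of "c e' _"] by simp
      then show ?thesis using True False by auto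
    qed
  next
    case False
    then have e: "e \<in> L" using that by blast
    show ?thesis
    proof (cases "e' \<in> B")
      case True
      then show ?thesis using mixed[OF e True] False by auto
    next
      case e': False
      then have "e' \<in> L" using that by blast
      then show ?thesis
        using tendsto_inner_forms(1)[OF conv[OF e] conv, of e' \<tau>] diagL[OF e, of e'] False
        by (cases "e = e'") (simp_all add: \<beta>_def)
    qed
  qed
  have slope: "?b (x, lam x *\<^sub>R x) (x, lam x *\<^sub>R x) = \<tau> - lam x" if "x \<in> X" for x
    using slope_form_lines(1)[of \<tau> x "lam x" x "lam x"] slope_basisD(3)[OF sb that]
    by (simp add: norm_eq_1)
  have \<beta>nz: "\<beta> e \<noteq> 0" if eE: "e \<in> L \<union> B" for e
  proof (cases "e \<in> B")
    case True
    then show ?thesis using bnz by (simp add: \<beta>_def)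
  next
    case False
    then obtain x where x: "x \<in> X" "e = (x, lam x *\<^sub>R x)" using eE by (auto simp: L_def)
    then have "lam x \<noteq> \<tau>" using transv_slopes[OF M(2) sb] \<tau> by blast
    then show ?thesis using slope[OF x(1)] False x(2) by (simp add: \<beta>_def)
  qed
  have count: "\<forall>\<^sub>F t in F. n_neg (M t) (\<lambda>x. ?b x x) = card {e \<in> L \<union> B. \<beta> e < 0} \<and>
      (\<forall>x\<in>M t. (\<forall>y\<in>M t. ?b x y = 0) \<longrightarrow> x = 0)"
  proof (rule n_neg_eventually_diagonal[OF sym_form_on_slope_form, where c = c and \<beta> = \<beta>])
    show "finite (L \<union> B)" using fL B(2) by simp
    show "\<forall>\<^sub>F t in F. subspace (M t) \<and> dim (M t) = card (L \<union> B)"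
      using M(1) by eventually_elim (simp add: cardE lagrangianD)
  qed (rule cM lims \<beta>nz; assumption)+
  have total: "card {e \<in> L \<union> B. \<beta> e < 0} = steep \<tau> M0 + n_neg ?K (\<lambda>q. b q q)"
  proof -
    have "n_neg ?K (\<lambda>q. b q q) = card {e \<in> B. b e e < 0}"
      by (rule n_neg_diagonal[OF b indB B(5,6)])
    moreover have "steep \<tau> M0 = card {e \<in> L. ?b e e < 0}"
    proof -
      have "{e \<in> L. ?b e e < 0} = (\<lambda>x. (x, lam x *\<^sub>R x)) ` {x \<in> X. \<tau> < lam x}"
        using slope by (auto simp: L_def)
      then have "card {e \<in> L. ?b e e < 0} = card {x \<in> X. \<tau> < lam x}"
        by (simp only:) (rule card_image, auto simp: inj_on_def)
      then show ?thesis using steep_slopes[OF M(2) sb] by simp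
    qed
    moreover have "{e \<in> L \<union> B. \<beta> e < 0} = {e \<in> L. ?b e e < 0} \<union> {e \<in> B. b e e < 0}"
      using disj by (auto simp: \<beta>_def)
    moreover have "card ({e \<in> L. ?b e e < 0} \<union> {e \<in> B. b e e < 0}) =
        card {e \<in> L. ?b e e < 0} + card {e \<in> B. b e e < 0}"
      using fL B(2) disj by (intro card_Un_disjoint) auto
    ultimately show ?thesis by simp
  qed
  from count M(1) show ?thesis
  proof eventually_elim
    case (elim t)
    have "d = 0" if d: "d \<in> M t" "d \<in> vertical" for d
    proof -
      have "?b d m = 0" if "m \<in> M t" for m
        using lagrangian_inner_commute[OF elim(2) d(1) that] d(2)
        by (simp add: slope_form_def mem_vertical)
      then show ?thesis using elim(1) d(1) by blast
    qed
    moreover have "0 \<in> M t" using lagrangianD(1)[OF elim(2)] subspace_0 by blast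
    ultimately have "M t \<inter> vertical = {0}" by (auto simp: mem_vertical)
    then show ?case using elim(1) total unfolding steep_def by simp
  qed
qed

section \<open>Continuously differentiable paths\<close>

lemma has_vector_derivative_iff_quotient:
  "(f has_vector_derivative D) (at t within S) \<longleftrightarrow>
    ((\<lambda>s. (f s - f t) /\<^sub>R (s - t)) \<longlongrightarrow> D) (at t within S)"
proof -
  have "norm ((1 / norm (s - t)) *\<^sub>R (f s - (f t + (s - t) *\<^sub>R D))) =
      norm ((f s - f t) /\<^sub>R (s - t) - D)" if "s \<noteq> t" for s
  proof -
    have "(f s - f t) /\<^sub>R (s - t) - D = (1 / (s - t)) *\<^sub>R (f s - (f t + (s - t) *\<^sub>R D))"
    proof -
      have "(1 / (s - t)) *\<^sub>R ((s - t) *\<^sub>R D) = D" using that by simp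
      moreover have "f s - (f t + (s - t) *\<^sub>R D) = (f s - f t) - (s - t) *\<^sub>R D" by simp
      ultimately show ?thesis by (simp only: scaleR_diff_right inverse_eq_divide)
    qed
    then show ?thesis by simp
  qed
  then have "\<forall>\<^sub>F s in at t within S. norm ((1 / norm (s - t)) *\<^sub>R (f s - (f t + (s - t) *\<^sub>R D))) =
      norm ((f s - f t) /\<^sub>R (s - t) - D)"
    by (auto simp: eventually_at_filter)
  note cong = tendsto_cong[OF this, of 0]
  have "(f has_vector_derivative D) (at t within S) \<longleftrightarrow>
      ((\<lambda>s. (1 / norm (s - t)) *\<^sub>R (f s - (f t + (s - t) *\<^sub>R D))) \<longlongrightarrow> 0) (at t within S)"
    unfolding has_vector_derivative_def has_derivative_within by (simp add: bounded_linear_scaleR_left)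
  also have "\<dots> \<longleftrightarrow>
      ((\<lambda>s. norm ((1 / norm (s - t)) *\<^sub>R (f s - (f t + (s - t) *\<^sub>R D)))) \<longlongrightarrow> 0) (at t within S)"
    by (rule tendsto_norm_zero_iff[symmetric])
  also have "\<dots> \<longleftrightarrow> ((\<lambda>s. norm ((f s - f t) /\<^sub>R (s - t) - D)) \<longlongrightarrow> 0) (at t within S)"
    by (rule cong)
  also have "\<dots> \<longleftrightarrow> ((\<lambda>s. (f s - f t) /\<^sub>R (s - t) - D) \<longlongrightarrow> 0) (at t within S)"
    by (rule tendsto_norm_zero_iff)
  finally show ?thesis by (simp add: LIM_zero_iff)
qed

lemma bounded_bilinear_omega: "bounded_bilinear (omega :: 'n::finite phase \<Rightarrow> _)"
proof -
  have "bounded_linear (J_map :: 'n phase \<Rightarrow> _)"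
    unfolding linear_conv_bounded_linear[symmetric] by (intro linearI) (auto simp: J_map_def)
  then show ?thesis
    unfolding omega_def[abs_def] by (rule bounded_bilinear.comp1[OF bounded_bilinear_inner])
qed

lemmas omega_simps = bounded_bilinear.add_left[OF bounded_bilinear_omega]
  bounded_bilinear.add_right[OF bounded_bilinear_omega]
  bounded_bilinear.diff_left[OF bounded_bilinear_omega]
  bounded_bilinear.diff_right[OF bounded_bilinear_omega]
  bounded_bilinear.scaleR_left[OF bounded_bilinear_omega]
  bounded_bilinear.scaleR_right[OF bounded_bilinear_omega]

lemma omega_swap: "omega x y = - omega y x"
  by (simp add: omega_pair inner_commute)

text \<open>
  The derivative at \<open>q\<close> of the symplectic form along a curve in the path is the same for all curves
  through \<open>q\<close>, differentiable or not: as \<open>\<Gamma> t\<close> is isotropic, replacing a curve by the projection of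
  \<open>q\<close> changes the form only to higher order.
\<close>

lemma omega_along_curve:
  fixes \<Gamma> :: "real \<Rightarrow> 'n::finite phase set"
  assumes lag: "\<And>t. t \<in> S \<Longrightarrow> \<Gamma> t \<in> lagrangians" and t0: "t0 \<in> S" and q: "q \<in> \<Gamma> t0"
    and D: "((\<lambda>s. closest_point (\<Gamma> s) q) has_vector_derivative D) (at t0 within S)"
    and c: "\<forall>\<^sub>F t in at t0 within S. c t \<in> \<Gamma> t" "(c \<longlongrightarrow> q) (at t0 within S)"
  shows "((\<lambda>t. omega q (c t) / (t - t0)) \<longlongrightarrow> omega q D) (at t0 within S)"
proof -
  let ?P = "\<lambda>t. closest_point (\<Gamma> t) q"
  have P0: "?P t0 = q" using q by (rule closest_point_self)
  have "((\<lambda>t. - omega ((?P t - q) /\<^sub>R (t - t0)) (c t)) \<longlongrightarrow> - omega D q) (at t0 within S)"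
    using D c(2) unfolding has_vector_derivative_iff_quotient P0
    by (intro tendsto_minus bounded_bilinear.tendsto[OF bounded_bilinear_omega])
  moreover have "\<forall>\<^sub>F t in at t0 within S. - omega ((?P t - q) /\<^sub>R (t - t0)) (c t) = omega q (c t) / (t - t0)"
  proof -
    have "\<forall>\<^sub>F t in at t0 within S. t \<in> S" by (simp add: eventually_at_filter)
    with c(1) show ?thesis
    proof eventually_elim
      case (elim t)
      have "omega (?P t) (c t) = 0"
        using elim lag lagrangianD by (metis closest_point_in_subspace)
      then show ?case by (simp add: omega_simps divide_inverse)
    qed
  qed
  ultimately show ?thesis
    using omega_swap[of D q] by (subst (asm) tendsto_cong) auto
qed

lemma subspace_tendsto_projection_onto:
  assumes M: "\<forall>\<^sub>F t in F. M t \<in> lagrangians" "M0 \<in> lagrangians" and lim: "subspace_tendsto M M0 F"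
    and "0 < \<eta>" "\<eta> < 1"
  shows "\<forall>\<^sub>F t in F. (\<forall>m\<in>M t. norm (m - closest_point M0 m) \<le> \<eta> * norm m) \<and>
    (\<forall>m\<in>M t. closest_point M0 m = 0 \<longrightarrow> m = 0) \<and> closest_point M0 ` M t = M0"
proof -
  have sub: "\<forall>\<^sub>F t in F. subspace (M t)" using M(1) by eventually_elim (rule lagrangianD)
  note sub0 = lagrangianD(1)[OF M(2)]
  from subspace_tendsto_uniform[OF sub sub0 lim \<open>0 < \<eta>\<close>] M(1) show ?thesis
  proof eventually_elim
    case (elim t)
    have near: "norm (m - closest_point M0 m) \<le> \<eta> * norm m" if "m \<in> M t" for m
      using spec[OF elim(1), of m] closest_point_self[OF that] by simp
    have inj: "m = 0" if "m \<in> M t" "closest_point M0 m = 0" for m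
    proof (rule ccontr)
      assume "m \<noteq> 0"
      then have "\<eta> * norm m < 1 * norm m" using \<open>\<eta> < 1\<close> by (intro mult_strict_right_mono) auto
      then show False using near[OF that(1)] that(2) by simp
    qed
    have lin: "linear (closest_point M0)" by (rule linear_closest_point[OF sub0])
    note subt = lagrangianD(1)[OF elim(2)]
    have "inj_on (closest_point M0) (span (M t))"
    proof (rule inj_onI)
      fix x y assume "x \<in> span (M t)" "y \<in> span (M t)" "closest_point M0 x = closest_point M0 y"
      then have "x - y \<in> M t" "closest_point M0 (x - y) = 0"
        using subt by (simp_all add: linear_diff[OF lin] span_eq_iff[THEN iffD2] subspace_diff)
      then show "x = y" using inj by fastforce
    qed
    then have "dim (closest_point M0 ` M t) = dim (M t)" by (rule dim_image_eq[OF lin])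
    then have "closest_point M0 ` M t = M0"
      using lagrangianD(2)[OF elim(2)] lagrangianD(2)[OF M(2)]
      by (intro subspace_dim_equal linear_subspace_image[OF lin subt] sub0)
         (auto simp: closest_point_in_subspace[OF sub0])
    then show ?case using near inj by blast
  qed
qed

lemma C1_pathD:
  fixes \<Gamma> :: "real \<Rightarrow> 'n::finite phase set"
  assumes "C1_lagrangian_path \<Gamma> a b"
  shows "lag_continuous_on {a..b} \<Gamma>"
    and "t0 \<in> {a..b} \<Longrightarrow> \<exists>D. \<forall>x. ((\<lambda>s. closest_point (\<Gamma> s) x) has_vector_derivative D x) (at t0 within {a..b})"
proof -
  have ex: "\<exists>D. \<forall>x. ((\<lambda>s. closest_point (\<Gamma> s) x) has_vector_derivative D x) (at t within {a..b})"
    if "t \<in> {a..b}" for t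
  proof (rule choice, rule allI)
    show "\<exists>d. ((\<lambda>s. closest_point (\<Gamma> s) x) has_vector_derivative d) (at t within {a..b})" for x
      using conjunct2[OF assms[unfolded C1_lagrangian_path_def], rule_format, of x] that by blast
  qed
  then show "t0 \<in> {a..b} \<Longrightarrow> \<exists>D. \<forall>x. ((\<lambda>s. closest_point (\<Gamma> s) x) has_vector_derivative D x) (at t0 within {a..b})" .
  show "lag_continuous_on {a..b} \<Gamma>"
    unfolding lag_continuous_on_def
  proof (intro conjI ballI allI)
    show "\<Gamma> p \<in> lagrangians" if "p \<in> {a..b}" for p
      using assms that by (simp add: C1_lagrangian_path_def)
    show "continuous_on {a..b} (\<lambda>p. closest_point (\<Gamma> p) x)" for x
      unfolding continuous_on_eq_continuous_within
      using ex has_vector_derivative_continuous by blast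
  qed
qed

text \<open>
  The graph vectors \<open>q + R\<^sub>t q\<close> of the definition form a curve through \<open>q\<close>, so the derivative can be
  computed from the projections of \<open>q\<close> instead.
\<close>

lemma crossing_form_eq:
  fixes \<Gamma> :: "real \<Rightarrow> 'n::finite phase set"
  assumes C1: "C1_lagrangian_path \<Gamma> a b" and ab: "a < b" and t0: "t0 \<in> {a..b}" and q: "q \<in> \<Gamma> t0"
    and D: "((\<lambda>s. closest_point (\<Gamma> s) q) has_vector_derivative D) (at t0 within {a..b})"
  shows "crossing_form \<Gamma> a b t0 q = omega q D"
proof -
  let ?F = "at t0 within {a..b}" and ?W = "orthogonal_comp (\<Gamma> t0)"
  note lag = lag_continuous_onD[OF C1_pathD(1)[OF C1]]
  note sub0 = lagrangianD(1)[OF lag(1)[OF t0]]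
  define w where "w t = graph_map ?W (\<Gamma> t) q" for t
  have w: "w t \<in> ?W \<and> q + w t \<in> \<Gamma> t \<and> w t = (q + w t) - closest_point (\<Gamma> t0) (q + w t)"
    if inj: "\<forall>m\<in>\<Gamma> t. closest_point (\<Gamma> t0) m = 0 \<longrightarrow> m = 0"
      and onto: "closest_point (\<Gamma> t0) ` \<Gamma> t = \<Gamma> t0" and sub: "subspace (\<Gamma> t)" for t
  proof -
    have proj: "closest_point (\<Gamma> t0) (q + v) = q" if "v \<in> ?W" for v
      using that q by (intro closest_point_eqI[OF sub0])
        (auto simp: orthogonal_comp_def orthogonal_def inner_commute)
    obtain m where m: "m \<in> \<Gamma> t" "closest_point (\<Gamma> t0) m = q" using onto q by (metis imageE)
    have "\<exists>!v. v \<in> ?W \<and> q + v \<in> \<Gamma> t"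
    proof (rule ex1I[of _ "m - q"])
      show "m - q \<in> ?W \<and> q + (m - q) \<in> \<Gamma> t"
        using m closest_point_orthogonal[OF sub0, of _ m]
        by (auto simp: orthogonal_comp_def orthogonal_def inner_commute)
      fix v assume v: "v \<in> ?W \<and> q + v \<in> \<Gamma> t"
      then have "(q + v) - m \<in> \<Gamma> t" using m sub subspace_diff by blast
      moreover have "closest_point (\<Gamma> t0) ((q + v) - m) = 0"
        using linear_diff[OF linear_closest_point[OF sub0]] proj m(2) v by simp
      ultimately have "(q + v) - m = 0" using inj by blast
      then show "v = m - q" by (simp add: algebra_simps)
    qed
    from theI'[OF this] show ?thesis
      using proj unfolding w_def graph_map_def by simp
  qed
  have near: "\<forall>\<^sub>F t in ?F. w t \<in> ?W \<and> q + w t \<in> \<Gamma> t \<and> norm (w t) \<le> \<eta> * norm (q + w t)"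
    if \<eta>: "0 < \<eta>" "\<eta> < 1" for \<eta>
    using subspace_tendsto_projection_onto[OF lag(3) lag(1)[OF t0] lag(2)[OF t0] \<eta>] lag(3)
  proof eventually_elim
    case (elim t)
    from w[of t] elim have wt: "w t \<in> ?W" "q + w t \<in> \<Gamma> t" "w t = (q + w t) - closest_point (\<Gamma> t0) (q + w t)"
      by (auto simp: lagrangianD)
    then show ?case using elim(1) by metis
  qed
  have inG: "\<forall>\<^sub>F t in ?F. q + w t \<in> \<Gamma> t" using near[of "1/2"] by (auto elim: eventually_mono)
  have "(w \<longlongrightarrow> 0) ?F"
  proof (rule tendstoI)
    fix e :: real assume e: "0 < e"
    define \<eta> where "\<eta> = min (1/2) (e / (4 * (norm q + 1)))"
    have pos: "0 < norm q + 1" by (simp add: add_nonneg_pos)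
    then have "0 < e / (4 * (norm q + 1))" using e by (intro divide_pos_pos) auto
    then have \<eta>: "0 < \<eta>" "\<eta> \<le> 1/2" "\<eta> \<le> e / (4 * (norm q + 1))"
      unfolding \<eta>_def by (simp_all only: min_less_iff_conj min.cobounded1 min.cobounded2) simp
    have "\<eta> < 1" using \<eta>(2) by simp
    from near[OF \<eta>(1) this] show "\<forall>\<^sub>F t in ?F. dist (w t) 0 < e"
    proof eventually_elim
      case (elim t)
      have "norm (w t) \<le> \<eta> * (norm q + norm (w t))"
        using elim norm_triangle_ineq[of q "w t"] \<eta>(1) by (meson less_imp_le mult_left_mono order_trans)
      also have "\<dots> = \<eta> * norm q + \<eta> * norm (w t)" by (simp add: distrib_left)
      also have "\<eta> * norm (w t) \<le> (1/2) * norm (w t)" using \<eta>(2) by (intro mult_right_mono) auto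
      finally have "norm (w t) \<le> 2 * (\<eta> * norm q)" by simp
      also have "\<eta> * norm q \<le> e / (4 * (norm q + 1)) * (norm q + 1)"
        using \<eta> by (intro mult_mono) auto
      also have "e / (4 * N) * N = e / 4" if "0 < N" for N using that by simp
      from this[OF pos] have "e / (4 * (norm q + 1)) * (norm q + 1) = e / 4" .
      finally show ?case using e by simp
    qed
  qed
  then have "((\<lambda>t. q + w t) \<longlongrightarrow> q + 0) ?F" by (intro tendsto_add tendsto_const)
  then have qw: "((\<lambda>t. q + w t) \<longlongrightarrow> q) ?F" by simp
  have "omega q q = 0" by (simp add: omega_pair inner_commute)
  have w0: "w t0 = 0"
  proof -
    have id: "closest_point (\<Gamma> t0) m = m" if "m \<in> \<Gamma> t0" for m using that by (rule closest_point_self)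
    have "w t0 = (q + w t0) - closest_point (\<Gamma> t0) (q + w t0) \<and> q + w t0 \<in> \<Gamma> t0"
      using w[of t0] sub0 id by (auto simp: image_def)
    then show ?thesis using id[of "q + w t0"] by simp
  qed
  have "((\<lambda>t. omega q (w t)) has_vector_derivative omega q D) ?F"
    unfolding has_vector_derivative_iff_quotient
    using omega_along_curve[OF lag(1) t0 q D inG qw] \<open>omega q q = 0\<close>
    by (simp add: w0 omega_simps divide_inverse mult.commute bounded_bilinear.zero_right[OF bounded_bilinear_omega])
  then show ?thesis
    unfolding crossing_form_def using vector_derivative_within_closed_interval[OF ab t0] by (simp add: w_def)
qed

section \<open>The Maslov index of a regular path\<close>

text \<open>
  The curves needed at the crossing are the projections of a fixed vertical vector \<open>q\<close> onto \<open>\<Gamma> t\<close>,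
  which leave \<open>q\<close> at linear speed.
\<close>

lemma steep_near_regular_crossing:
  fixes \<Gamma> :: "real \<Rightarrow> 'n::finite phase set"
  assumes reg: "regular_path \<Gamma> vertical a b" and ab: "a < b" and t0: "t0 \<in> {a..b}"
    and \<tau>: "transv \<tau> (\<Gamma> t0)"
  shows "\<forall>\<^sub>F t in at t0 within {t0<..b}. steep \<tau> (\<Gamma> t) =
      steep \<tau> (\<Gamma> t0) + n_neg (\<Gamma> t0 \<inter> vertical) (crossing_form \<Gamma> a b t0) \<and> \<Gamma> t \<inter> vertical = {0}"
    and "\<forall>\<^sub>F t in at t0 within {a..<t0}. steep \<tau> (\<Gamma> t) =
      steep \<tau> (\<Gamma> t0) + n_pos (\<Gamma> t0 \<inter> vertical) (crossing_form \<Gamma> a b t0) \<and> \<Gamma> t \<inter> vertical = {0}"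
proof -
  let ?K = "\<Gamma> t0 \<inter> vertical" and ?F = "at t0 within {a..b}"
  let ?P = "\<lambda>t. closest_point (\<Gamma> t)"
  have C1: "C1_lagrangian_path \<Gamma> a b" using reg by (simp add: regular_path_def)
  note cont = C1_pathD(1)[OF C1]
  note lag = lag_continuous_onD[OF cont]
  note lag0 = lag(1)[OF t0]
  have K: "subspace ?K" by (intro subspace_inter lagrangianD(1)[OF lag0] subspace_vertical)
  obtain D where D: "\<And>x. ((\<lambda>s. ?P s x) has_vector_derivative D x) ?F"
    using C1_pathD(2)[OF C1 t0] by blast
  define b0 where "b0 x y = omega x (D y)" for x y
  have self: "?P t0 q = q" if "q \<in> \<Gamma> t0" for q using that by (rule closest_point_self)
  have quot: "((\<lambda>t. (?P t q - q) /\<^sub>R (t - t0)) \<longlongrightarrow> D q) ?F" if "q \<in> \<Gamma> t0" for q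
    using D[of q] unfolding has_vector_derivative_iff_quotient self[OF that] .
  have Pq: "((\<lambda>t. ?P t q) \<longlongrightarrow> q) ?F" if "q \<in> \<Gamma> t0" for q
    using lag(2)[OF t0] self[OF that] unfolding subspace_tendsto_def by metis
  have slope: "((\<lambda>t. omega q' (?P t q) / (t - t0)) \<longlongrightarrow> b0 q' q) ?F" if "q \<in> \<Gamma> t0" "q' \<in> \<Gamma> t0" for q q'
  proof -
    have "((\<lambda>t. omega q' ((?P t q - q) /\<^sub>R (t - t0))) \<longlongrightarrow> omega q' (D q)) ?F"
      by (intro bounded_bilinear.tendsto[OF bounded_bilinear_omega] tendsto_const quot that)
    moreover have "omega q' ((?P t q - q) /\<^sub>R (t - t0)) = omega q' (?P t q) / (t - t0)" for t
      using lagrangianD(3)[OF lag0 that(2,1)] by (simp add: omega_simps divide_inverse)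
    ultimately show ?thesis by (simp add: b0_def)
  qed
  have sym: "b0 x y = b0 y x" if "x \<in> \<Gamma> t0" "y \<in> \<Gamma> t0" for x y
  proof -
    have "((\<lambda>t. omega ((?P t x - x) /\<^sub>R (t - t0)) (?P t y)) \<longlongrightarrow> omega (D x) y) ?F"
      by (intro bounded_bilinear.tendsto[OF bounded_bilinear_omega] quot Pq that)
    from tendsto_add[OF this slope[OF that(2,1)]]
    have "((\<lambda>t. omega ((?P t x - x) /\<^sub>R (t - t0)) (?P t y) + omega x (?P t y) / (t - t0)) \<longlongrightarrow>
        omega (D x) y + b0 x y) ?F" .
    moreover have "\<forall>\<^sub>F t in ?F. omega ((?P t x - x) /\<^sub>R (t - t0)) (?P t y) + omega x (?P t y) / (t - t0) = 0"
      using lag(3)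
    proof eventually_elim
      case (elim t)
      have "omega (?P t x) (?P t y) = 0"
        using lagrangianD(3)[OF elim] closest_point_in_subspace[OF lagrangianD(1)[OF elim]] by blast
      then show ?case by (simp add: omega_simps divide_inverse)
    qed
    ultimately have "((\<lambda>t. 0) \<longlongrightarrow> omega (D x) y + b0 x y) ?F" by (subst (asm) tendsto_cong)
    moreover have "?F \<noteq> bot" using ab t0 by (simp add: trivial_limit_within islimpt_Icc)
    ultimately have "omega (D x) y + b0 x y = 0" using tendsto_const_iff by metis
    then show ?thesis using omega_swap[of "D x" y] by (simp add: b0_def)
  qed
  have symf: "sym_form_on ?K b0"
    unfolding sym_form_on_def using K sym by (auto simp: b0_def omega_simps)
  have form: "crossing_form \<Gamma> a b t0 q = b0 q q" if "q \<in> \<Gamma> t0" for q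
    unfolding b0_def by (rule crossing_form_eq[OF C1 ab t0 that D])
  have nondeg: "x = 0" if x: "x \<in> ?K" "\<forall>y\<in>?K. b0 x y = 0" for x
  proof (cases "crossing \<Gamma> vertical t0")
    case True
    then have nd: "nondegenerate_on ?K (crossing_form \<Gamma> a b t0)"
      using reg t0 by (simp add: regular_path_def)
    have "polar_form (crossing_form \<Gamma> a b t0) x y = 0" if "y \<in> ?K" for y
      using polar_form_diagonal[OF symf x(1) that, of "crossing_form \<Gamma> a b t0"] form x(2) that by simp
    then show ?thesis using nd x(1) unfolding nondegenerate_on_def by blast
  next
    case False
    then show ?thesis using x(1) by (auto simp: crossing_def)
  qed
  have bound: "\<forall>\<^sub>F t in ?F. norm (fst (?P t q)) \<le> (norm (D q) + 1) * \<bar>t - t0\<bar>" if q: "q \<in> ?K" for q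
  proof -
    have "((\<lambda>t. norm ((?P t q - q) /\<^sub>R (t - t0))) \<longlongrightarrow> norm (D q)) ?F"
      using q by (intro tendsto_norm quot) auto
    then have "\<forall>\<^sub>F t in ?F. norm ((?P t q - q) /\<^sub>R (t - t0)) < norm (D q) + 1"
      by (rule order_tendstoD) simp
    moreover have "\<forall>\<^sub>F t in ?F. t \<noteq> t0" by (simp add: eventually_at_filter)
    ultimately show ?thesis
    proof eventually_elim
      case (elim t)
      have "norm (fst (?P t q)) = norm (fst (?P t q - q))" using q by (simp add: mem_vertical)
      also have "\<dots> \<le> norm (?P t q - q)" using norm_fst_le[of "fst (?P t q - q)" "snd (?P t q - q)"] by (simp only: prod.collapse)
      also have "\<dots> \<le> (norm (D q) + 1) * \<bar>t - t0\<bar>"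
        using elim by (simp add: divide_simps split: if_splits)
      finally show ?case .
    qed
  qed
  \<comment> \<open>On the left of \<open>t0\<close> the time runs backwards, which reverses the sign of the form.\<close>
  have side: "\<forall>\<^sub>F t in at t0 within T. steep \<tau> (\<Gamma> t) =
      steep \<tau> (\<Gamma> t0) + n_neg ?K (\<lambda>q. \<sigma> * b0 q q) \<and> \<Gamma> t \<inter> vertical = {0}"
    if T: "T \<subseteq> {a..b}" and \<sigma>: "\<And>t. t \<in> T \<Longrightarrow> \<bar>t - t0\<bar> = \<sigma> * (t - t0)" "\<sigma> = 1 \<or> \<sigma> = -1" for T \<sigma>
  proof (rule steep_eventually_near_crossing[OF _ lag0 _ \<tau>,
        where b = "\<lambda>x y. \<sigma> * b0 x y" and \<delta> = "\<lambda>t. \<bar>t - t0\<bar>"])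
    have le: "at t0 within T \<le> ?F" by (rule at_le[OF T])
    show "\<forall>\<^sub>F t in at t0 within T. \<Gamma> t \<in> lagrangians"
      using filter_leD[OF le lag(3)] .
    show "subspace_tendsto \<Gamma> (\<Gamma> t0) (at t0 within T)"
      using lag(2)[OF t0] tendsto_mono[OF le] unfolding subspace_tendsto_def by blast
    show "\<forall>\<^sub>F t in at t0 within T. 0 < \<bar>t - t0\<bar>" by (simp add: eventually_at_filter)
    show "((\<lambda>t. \<bar>t - t0\<bar>) \<longlongrightarrow> 0) (at t0 within T)"
      by (rule tendsto_eq_intros refl)+ simp
    show "sym_form_on ?K (\<lambda>x y. \<sigma> * b0 x y)"
      using symf unfolding sym_form_on_def by (auto simp: algebra_simps)
    show "x = 0" if "x \<in> ?K" "\<forall>y\<in>?K. \<sigma> * b0 x y = 0" for x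
      using nondeg[OF that(1)] that(2) \<sigma>(2) by auto
    show "\<exists>c C. (\<forall>\<^sub>F t in at t0 within T. c t \<in> \<Gamma> t) \<and> (c \<longlongrightarrow> q) (at t0 within T) \<and>
      (\<forall>\<^sub>F t in at t0 within T. norm (fst (c t)) \<le> C * \<bar>t - t0\<bar>) \<and>
      (\<forall>q'\<in>?K. ((\<lambda>t. omega q' (c t) / \<bar>t - t0\<bar>) \<longlongrightarrow> \<sigma> * b0 q' q) (at t0 within T))" if q: "q \<in> ?K" for q
    proof (intro exI conjI ballI)
      show "\<forall>\<^sub>F t in at t0 within T. ?P t q \<in> \<Gamma> t"
        using filter_leD[OF le lag(3)]
        by eventually_elim (simp add: closest_point_in_subspace lagrangianD)
      show "((\<lambda>t. ?P t q) \<longlongrightarrow> q) (at t0 within T)"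
        using q by (intro tendsto_mono[OF le] Pq) auto
      show "\<forall>\<^sub>F t in at t0 within T. norm (fst (?P t q)) \<le> (norm (D q) + 1) * \<bar>t - t0\<bar>"
        by (rule filter_leD[OF le bound[OF q]])
      fix q' assume q': "q' \<in> ?K"
      have "((\<lambda>t. \<sigma> * (omega q' (?P t q) / (t - t0))) \<longlongrightarrow> \<sigma> * b0 q' q) (at t0 within T)"
        using q q' by (intro tendsto_mult tendsto_const tendsto_mono[OF le] slope) auto
      moreover have "\<forall>\<^sub>F t in at t0 within T. \<sigma> * (omega q' (?P t q) / (t - t0)) = omega q' (?P t q) / \<bar>t - t0\<bar>"
        unfolding eventually_at_filter using \<sigma>
        by (intro always_eventually allI impI) (auto simp: minus_divide_right simp del: divide_minus_right)
      ultimately show "((\<lambda>t. omega q' (?P t q) / \<bar>t - t0\<bar>) \<longlongrightarrow> \<sigma> * b0 q' q) (at t0 within T)"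
        by (subst (asm) tendsto_cong)
    qed
  qed
  have "n_neg ?K (\<lambda>q. 1 * b0 q q) = n_neg ?K (crossing_form \<Gamma> a b t0)"
    "n_neg ?K (\<lambda>q. - 1 * b0 q q) = n_pos ?K (crossing_form \<Gamma> a b t0)"
    unfolding n_pos_eq_n_neg using form by (auto intro!: n_neg_cong)
  moreover have "{t0<..b} \<subseteq> {a..b}" "{a..<t0} \<subseteq> {a..b}" using t0 by auto
  ultimately show "\<forall>\<^sub>F t in at t0 within {t0<..b}. steep \<tau> (\<Gamma> t) =
      steep \<tau> (\<Gamma> t0) + n_neg ?K (crossing_form \<Gamma> a b t0) \<and> \<Gamma> t \<inter> vertical = {0}"
    and "\<forall>\<^sub>F t in at t0 within {a..<t0}. steep \<tau> (\<Gamma> t) =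
      steep \<tau> (\<Gamma> t0) + n_pos ?K (crossing_form \<Gamma> a b t0) \<and> \<Gamma> t \<inter> vertical = {0}"
    using side[of "{t0<..b}" 1] side[of "{a..<t0}" "-1"] by auto
qed

lemma potential_near_regular_crossing:
  fixes \<Gamma> :: "real \<Rightarrow> 'n::finite phase set"
  assumes reg: "regular_path \<Gamma> vertical a b" and ab: "a < b" and t0: "t0 \<in> {a..b}"
    and G: "maslov_potential {a..b} \<Gamma> G"
  shows "\<exists>d>0. (\<forall>t\<in>{a..b}. t0 < t \<and> t < t0 + d \<longrightarrow> \<not> crossing \<Gamma> vertical t \<and>
      G t = G t0 + int (n_neg (\<Gamma> t0 \<inter> vertical) (crossing_form \<Gamma> a b t0))) \<and>
    (\<forall>t\<in>{a..b}. t0 - d < t \<and> t < t0 \<longrightarrow> \<not> crossing \<Gamma> vertical t \<and>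
      G t = G t0 + int (n_pos (\<Gamma> t0 \<inter> vertical) (crossing_form \<Gamma> a b t0)))"
proof -
  have "C1_lagrangian_path \<Gamma> a b" using reg by (simp add: regular_path_def)
  then have lag0: "\<Gamma> t0 \<in> lagrangians" using lag_continuous_onD(1)[OF C1_pathD(1)] t0 by blast
  obtain \<tau> where \<tau>: "transv \<tau> (\<Gamma> t0)" using transv_exists[OF lag0] by blast
  have "\<forall>\<^sub>F t in nhds t0. t \<in> {a..b} \<longrightarrow> int (steep \<tau> (\<Gamma> t)) - G t = int (steep \<tau> (\<Gamma> t0)) - G t0"
    using G t0 \<tau> unfolding maslov_potential_def by blast
  then obtain d0 where d0: "d0 > 0" "\<And>t. dist t t0 < d0 \<Longrightarrow> t \<in> {a..b} \<Longrightarrow>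
      int (steep \<tau> (\<Gamma> t)) - G t = int (steep \<tau> (\<Gamma> t0)) - G t0"
    unfolding eventually_nhds_metric by blast
  obtain d1 where d1: "d1 > 0" "\<And>t. t \<in> {t0<..b} \<Longrightarrow> dist t t0 < d1 \<Longrightarrow> steep \<tau> (\<Gamma> t) =
      steep \<tau> (\<Gamma> t0) + n_neg (\<Gamma> t0 \<inter> vertical) (crossing_form \<Gamma> a b t0) \<and> \<Gamma> t \<inter> vertical = {0}"
    using steep_near_regular_crossing(1)[OF reg ab t0 \<tau>] unfolding eventually_at by auto
  obtain d2 where d2: "d2 > 0" "\<And>t. t \<in> {a..<t0} \<Longrightarrow> dist t t0 < d2 \<Longrightarrow> steep \<tau> (\<Gamma> t) =
      steep \<tau> (\<Gamma> t0) + n_pos (\<Gamma> t0 \<inter> vertical) (crossing_form \<Gamma> a b t0) \<and> \<Gamma> t \<inter> vertical = {0}"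
    using steep_near_regular_crossing(2)[OF reg ab t0 \<tau>] unfolding eventually_at by auto
  show ?thesis
  proof (intro exI[of _ "min d0 (min d1 d2)"] conjI ballI impI)
    show "0 < min d0 (min d1 d2)" using d0 d1 d2 by simp
  next
    fix t assume t: "t \<in> {a..b}" "t0 < t \<and> t < t0 + min d0 (min d1 d2)"
    then have "t \<in> {t0<..b}" "dist t t0 < d0" "dist t t0 < d1" by (auto simp: dist_real_def)
    with d0(2)[of t] d1(2)[of t] t(1)
    show "\<not> crossing \<Gamma> vertical t"
      "G t = G t0 + int (n_neg (\<Gamma> t0 \<inter> vertical) (crossing_form \<Gamma> a b t0))"
      by (auto simp: crossing_def)
  next
    fix t assume t: "t \<in> {a..b}" "t0 - min d0 (min d1 d2) < t \<and> t < t0"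
    then have "t \<in> {a..<t0}" "dist t t0 < d0" "dist t t0 < d2" by (auto simp: dist_real_def)
    with d0(2)[of t] d2(2)[of t] t(1)
    show "\<not> crossing \<Gamma> vertical t"
      "G t = G t0 + int (n_pos (\<Gamma> t0 \<inter> vertical) (crossing_form \<Gamma> a b t0))"
      by (auto simp: crossing_def)
  qed
qed

text \<open>
  Passing a crossing from left to right first lowers the potential by the number of positive
  squares and then raises it by the number of negative squares of the crossing form.  Summing over
  all crossings gives the defining formula of the index.
\<close>

lemma path_index_regular:
  fixes \<Gamma> :: "real \<Rightarrow> 'n::finite phase set"
  assumes reg: "regular_path \<Gamma> vertical a b" and ab: "a < b" and k: "path_index \<Gamma> a b k"
  shows "k = regular_maslov \<Gamma> vertical a b"
proof -
  obtain G where G: "maslov_potential {a..b} \<Gamma> G" "k = G a - G b"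
    using k unfolding path_index_def by blast
  define C where "C = {t \<in> {a..b}. crossing \<Gamma> vertical t}"
  define m where "m t = int (n_neg (\<Gamma> t \<inter> vertical) (crossing_form \<Gamma> a b t))" for t
  define p where "p t = int (n_pos (\<Gamma> t \<inter> vertical) (crossing_form \<Gamma> a b t))" for t
  have lag: "\<Gamma> t \<in> lagrangians" if "t \<in> {a..b}" for t
    using reg lag_continuous_onD(1)[OF C1_pathD(1)] that by (auto simp: regular_path_def)
  have zero: "m t = 0" "p t = 0" if "t \<in> {a..b}" "t \<notin> C" for t
    using that by (auto simp: m_def p_def C_def crossing_def n_pos_eq_n_neg)
  define P where "P x y \<longleftrightarrow> (a \<le> x \<and> y \<le> b \<longrightarrow> finite (C \<inter> {x..y}) \<and>
      G x - G y = (\<Sum>t\<in>C \<inter> {x<..y}. p t) - (\<Sum>t\<in>C \<inter> {x..<y}. m t))" for x y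
  have "P a b"
    using less_imp_le[OF ab]
  proof (induction rule: Bolzano)
    case (trans x y z)
    show ?case unfolding P_def
    proof (intro impI)
      assume xz: "a \<le> x \<and> z \<le> b"
      with trans have 1: "finite (C \<inter> {x..y})" "G x - G y = (\<Sum>t\<in>C \<inter> {x<..y}. p t) - (\<Sum>t\<in>C \<inter> {x..<y}. m t)"
        and 2: "finite (C \<inter> {y..z})" "G y - G z = (\<Sum>t\<in>C \<inter> {y<..z}. p t) - (\<Sum>t\<in>C \<inter> {y..<z}. m t)"
        unfolding P_def by auto
      have "C \<inter> {x..z} = (C \<inter> {x..y}) \<union> (C \<inter> {y..z})" using trans by auto
      moreover have "C \<inter> {x<..z} = (C \<inter> {x<..y}) \<union> (C \<inter> {y<..z})" using trans by auto
      moreover have "C \<inter> {x..<z} = (C \<inter> {x..<y}) \<union> (C \<inter> {y..<z})" using trans by auto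
      moreover have "finite (C \<inter> {x<..y})" "finite (C \<inter> {x..<y})" "finite (C \<inter> {y<..z})" "finite (C \<inter> {y..<z})"
        by ((rule finite_subset[OF _ 1(1)] finite_subset[OF _ 2(1)], force)+)
      moreover have "(C \<inter> {x<..y}) \<inter> (C \<inter> {y<..z}) = {}" "(C \<inter> {x..<y}) \<inter> (C \<inter> {y..<z}) = {}" by auto
      ultimately show "finite (C \<inter> {x..z}) \<and> G x - G z = (\<Sum>t\<in>C \<inter> {x<..z}. p t) - (\<Sum>t\<in>C \<inter> {x..<z}. m t)"
        using 1 2 by (simp add: sum.union_disjoint)
    qed
  next
    case (local t0)
    then have t0: "t0 \<in> {a..b}" by simp
    obtain d where d: "d > 0"
      "\<And>t. t \<in> {a..b} \<Longrightarrow> t0 < t \<Longrightarrow> t < t0 + d \<Longrightarrow> t \<notin> C \<and> G t = G t0 + m t0"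
      "\<And>t. t \<in> {a..b} \<Longrightarrow> t0 - d < t \<Longrightarrow> t < t0 \<Longrightarrow> t \<notin> C \<and> G t = G t0 + p t0"
      using potential_near_regular_crossing[OF reg ab t0 G(1)] unfolding m_def p_def C_def by blast
    have "P x y" if "x \<le> t0 \<and> t0 \<le> y \<and> y - x < d" for x y
      unfolding P_def
    proof (intro impI)
      assume "a \<le> x \<and> y \<le> b"
      then have xy: "a \<le> x" "x \<le> t0" "t0 \<le> y" "y \<le> b" "y - x < d" using that by auto
      have C: "t = t0" if "t \<in> C" "x \<le> t" "t \<le> y" for t
        using d(2)[of t] d(3)[of t] that xy by (cases t t0 rule: linorder_cases) auto
      have Gx: "G x = G t0 + (if x < t0 then p t0 else 0)" using d(3)[of x] xy by (auto split: if_splits)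
      have Gy: "G y = G t0 + (if t0 < y then m t0 else 0)" using d(2)[of y] xy by (auto split: if_splits)
      have sub: "C \<inter> {x..y} \<subseteq> {t0}" using C by auto
      have sub1: "C \<inter> {x<..y} \<subseteq> {t0}" and sub2: "C \<inter> {x..<y} \<subseteq> {t0}"
        by (rule subset_trans[OF _ sub], force)+
      from sub have fin: "finite (C \<inter> {x..y})" using finite_subset by blast
      have "(\<Sum>t\<in>C \<inter> {x<..y}. p t) = (if x < t0 then p t0 else 0)"
      proof (cases "t0 \<in> C \<and> x < t0")
        case True
        then have "t0 \<in> C \<inter> {x<..y}" using xy by simp
        then have "C \<inter> {x<..y} = {t0}" using sub1 by blast
        then show ?thesis using True by simp
      next
        case False
        then have "t0 \<notin> C \<inter> {x<..y}" by auto
        then have "C \<inter> {x<..y} = {}" using sub1 by blast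
        then show ?thesis using False zero(2)[OF t0] by auto
      qed
      moreover have "(\<Sum>t\<in>C \<inter> {x..<y}. m t) = (if t0 < y then m t0 else 0)"
      proof (cases "t0 \<in> C \<and> t0 < y")
        case True
        then have "t0 \<in> C \<inter> {x..<y}" using xy by simp
        then have "C \<inter> {x..<y} = {t0}" using sub2 by blast
        then show ?thesis using True by simp
      next
        case False
        then have "t0 \<notin> C \<inter> {x..<y}" by auto
        then have "C \<inter> {x..<y} = {}" using sub2 by blast
        then show ?thesis using False zero(1)[OF t0] by auto
      qed
      ultimately show "finite (C \<inter> {x..y}) \<and> G x - G y = (\<Sum>t\<in>C \<inter> {x<..y}. p t) - (\<Sum>t\<in>C \<inter> {x..<y}. m t)"
        using fin Gx Gy by simp
    qed
    then show ?case using d(1) by blast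
  qed
  then have fin: "finite (C \<inter> {a..b})" and Gab: "G a - G b = (\<Sum>t\<in>C \<inter> {a<..b}. p t) - (\<Sum>t\<in>C \<inter> {a..<b}. m t)"
    unfolding P_def by auto
  let ?I = "{t. a < t \<and> t < b \<and> crossing \<Gamma> vertical t}"
  have finI: "finite ?I" using fin by (rule rev_finite_subset) (auto simp: C_def)
  have "(\<Sum>t\<in>C \<inter> {a<..b}. p t) = (\<Sum>t\<in>insert b ?I. p t)"
    using ab finI zero(2) by (intro sum.mono_neutral_left) (auto simp: C_def order.strict_iff_order)
  moreover have "(\<Sum>t\<in>C \<inter> {a..<b}. m t) = (\<Sum>t\<in>insert a ?I. m t)"
    using ab finI zero(1) by (intro sum.mono_neutral_left) (auto simp: C_def order.strict_iff_order)
  ultimately have "G a - G b = - m a + (\<Sum>t\<in>?I. p t - m t) + p b"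
    using Gab finI by (simp add: sum_subtractf)
  then show ?thesis
    using G(2) by (simp add: regular_maslov_def sign_form_def m_def p_def)
qed

section \<open>Subspaces given by frames\<close>

lemma linear_expand: "linear f \<Longrightarrow> f x = (\<Sum>i\<in>Basis. (x \<bullet> i) *\<^sub>R f i)" for x :: "'a::euclidean_space"
proof -
  assume f: "linear f"
  have "f x = f (\<Sum>i\<in>Basis. (x \<bullet> i) *\<^sub>R i)" by (simp add: euclidean_representation)
  also have "\<dots> = (\<Sum>i\<in>Basis. (x \<bullet> i) *\<^sub>R f i)" using f by (simp add: linear_sum linear_scale)
  finally show ?thesis .
qed

text \<open>
  Solutions of linear equations converge with the data if the operators are uniformly bounded
  below; pointwise convergence of the operators at the limit is enough.
\<close>

lemma coercive_solution_tendsto: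
  fixes A :: "'p \<Rightarrow> 'a::euclidean_space \<Rightarrow> 'a"
  assumes A: "\<forall>\<^sub>F t in F. linear (A t)" "((\<lambda>t. A t x0) \<longlongrightarrow> y0) F"
    and coer: "0 < \<kappa>" "\<forall>\<^sub>F t in F. \<forall>x. \<kappa> * norm x \<le> norm (A t x)"
    and sol: "\<forall>\<^sub>F t in F. A t (x t) = y t" "(y \<longlongrightarrow> y0) F"
  shows "(x \<longlongrightarrow> x0) F"
proof -
  have "((\<lambda>t. x t - x0) \<longlongrightarrow> 0) F"
  proof (rule Lim_null_comparison)
    show "\<forall>\<^sub>F t in F. norm (x t - x0) \<le> norm (y t - A t x0) / \<kappa>"
      using A(1) coer(2) sol(1)
    proof eventually_elim
      case (elim t)
      have "\<kappa> * norm (x t - x0) \<le> norm (A t (x t - x0))" using elim(2) by blast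
      also have "A t (x t - x0) = y t - A t x0" using elim by (simp add: linear_diff)
      finally show ?case using coer(1) by (simp add: field_simps)
    qed
    have "((\<lambda>t. norm (y t - A t x0) / \<kappa>) \<longlongrightarrow> norm (y0 - y0) / \<kappa>) F"
      using coer(1) by (intro tendsto_intros sol A(2)) auto
    then show "((\<lambda>t. norm (y t - A t x0) / \<kappa>) \<longlongrightarrow> 0) F" by simp
  qed
  then show ?thesis by (simp add: LIM_zero_iff)
qed

text \<open>The Gram operator \<open>F\<^sup>* F\<close> of a frame.\<close>

definition gram :: "('b::euclidean_space \<Rightarrow> 'a::euclidean_space) \<Rightarrow> 'b \<Rightarrow> 'b" where
  "gram f x = (\<Sum>i\<in>Basis. (f x \<bullet> f i) *\<^sub>R i)"

lemma linear_gram: "linear f \<Longrightarrow> linear (gram f)"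
  by (intro linearI)
    (simp_all add: gram_def linear_add linear_scale inner_add_left scaleR_add_left sum.distrib scaleR_sum_right)

lemma gram_coercive:
  assumes f: "linear f" and \<kappa>: "0 < \<kappa>" "\<And>x. \<kappa> * norm x \<le> norm (f x)"
  shows "\<kappa>\<^sup>2 * norm x \<le> norm (gram f x)"
proof (cases "x = 0")
  case False
  have "gram f x \<bullet> x = (\<Sum>i\<in>Basis. f x \<bullet> ((x \<bullet> i) *\<^sub>R f i))"
    unfolding gram_def inner_sum_left
    by (intro sum.cong refl) (simp add: inner_commute mult.commute)
  also have "\<dots> = f x \<bullet> (\<Sum>i\<in>Basis. (x \<bullet> i) *\<^sub>R f i)" by (simp add: inner_sum_right)
  also have "\<dots> = f x \<bullet> f x" using linear_expand[OF f] by metis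
  finally have "gram f x \<bullet> x = (norm (f x))\<^sup>2" by (simp add: power2_norm_eq_inner)
  moreover have "(\<kappa> * norm x)\<^sup>2 \<le> (norm (f x))\<^sup>2" using \<kappa> by (intro power_mono) auto
  moreover have "gram f x \<bullet> x \<le> norm (gram f x) * norm x" by (rule norm_cauchy_schwarz)
  ultimately have "(\<kappa>\<^sup>2 * norm x) * norm x \<le> norm (gram f x) * norm x"
    by (simp add: power_mult_distrib power2_eq_square mult_ac)
  then show ?thesis using False by simp
qed simp

lemma frame_coordinates_exist:
  assumes f: "linear f"
  shows "\<exists>x. f x = closest_point (range f) v \<and> gram f x = (\<Sum>i\<in>Basis. (v \<bullet> f i) *\<^sub>R i)"
proof -
  have sub: "subspace (range f)" using linear_subspace_image[OF f subspace_UNIV] .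
  obtain x where x: "closest_point (range f) v = f x" using closest_point_in_subspace[OF sub, of v] by blast
  have "f x \<bullet> f i = v \<bullet> f i" for i
    using closest_point_orthogonal[OF sub, of "f i" v] by (simp add: x inner_diff_left)
  then show ?thesis using x by (intro exI[of _ x]) (simp add: gram_def)
qed

text \<open>
  The coordinates in the frame of the orthogonal projection, which satisfy the normal equations.
\<close>

definition frame_coordinates :: "('b::euclidean_space \<Rightarrow> 'a::euclidean_space) \<Rightarrow> 'a \<Rightarrow> 'b" where
  "frame_coordinates f v =
    (SOME x. f x = closest_point (range f) v \<and> gram f x = (\<Sum>i\<in>Basis. (v \<bullet> f i) *\<^sub>R i))"

lemma frame_coordinates:
  assumes "linear f"
  shows "f (frame_coordinates f v) = closest_point (range f) v"
    and "gram f (frame_coordinates f v) = (\<Sum>i\<in>Basis. (v \<bullet> f i) *\<^sub>R i)"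
  using someI_ex[OF frame_coordinates_exist[OF assms, of v]] unfolding frame_coordinates_def by auto

lemma frame_coordinates_tendsto:
  fixes f :: "'p \<Rightarrow> 'b::euclidean_space \<Rightarrow> 'a::euclidean_space"
  assumes f: "\<forall>\<^sub>F t in F. linear (f t)" "linear f0" and lim: "\<And>x. ((\<lambda>t. f t x) \<longlongrightarrow> f0 x) F"
    and \<kappa>: "0 < \<kappa>" "\<forall>\<^sub>F t in F. \<forall>x. \<kappa> * norm x \<le> norm (f t x)"
  shows "((\<lambda>t. frame_coordinates (f t) v) \<longlongrightarrow> frame_coordinates f0 v) F"
proof (rule coercive_solution_tendsto)
  show "\<forall>\<^sub>F t in F. linear (gram (f t))" using f(1) by eventually_elim (rule linear_gram)
  show "\<forall>\<^sub>F t in F. \<forall>x. \<kappa>\<^sup>2 * norm x \<le> norm (gram (f t) x)"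
    using f(1) \<kappa>(2) by eventually_elim (use \<kappa>(1) gram_coercive in blast)
  show "((\<lambda>t. gram (f t) (frame_coordinates f0 v)) \<longlongrightarrow> (\<Sum>i\<in>Basis. (v \<bullet> f0 i) *\<^sub>R i)) F"
    unfolding frame_coordinates(2)[OF f(2), symmetric] unfolding gram_def
    by (intro tendsto_intros lim)
  show "\<forall>\<^sub>F t in F. gram (f t) (frame_coordinates (f t) v) = (\<Sum>i\<in>Basis. (v \<bullet> f t i) *\<^sub>R i)"
    using f(1) by eventually_elim (rule frame_coordinates(2))
  show "((\<lambda>t. \<Sum>i\<in>Basis. (v \<bullet> f t i) *\<^sub>R i) \<longlongrightarrow> (\<Sum>i\<in>Basis. (v \<bullet> f0 i) *\<^sub>R i)) F"
    by (intro tendsto_intros lim)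
qed (use \<kappa>(1) in auto)

lemma frame_apply_tendsto:
  fixes f :: "'p \<Rightarrow> 'b::euclidean_space \<Rightarrow> 'a::euclidean_space"
  assumes f: "\<forall>\<^sub>F t in F. linear (f t)" "linear f0" and lim: "\<And>x. ((\<lambda>t. f t x) \<longlongrightarrow> f0 x) F"
    and x: "(x \<longlongrightarrow> x0) F"
  shows "((\<lambda>t. f t (x t)) \<longlongrightarrow> f0 x0) F"
proof -
  have "((\<lambda>t. \<Sum>i\<in>Basis. (x t \<bullet> i) *\<^sub>R f t i) \<longlongrightarrow> (\<Sum>i\<in>Basis. (x0 \<bullet> i) *\<^sub>R f0 i)) F"
    by (intro tendsto_intros lim x)
  moreover have "\<forall>\<^sub>F t in F. (\<Sum>i\<in>Basis. (x t \<bullet> i) *\<^sub>R f t i) = f t (x t)"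
    using f(1) by eventually_elim (rule linear_expand[symmetric])
  ultimately show ?thesis
    unfolding linear_expand[OF f(2), of x0] by (subst (asm) tendsto_cong)
qed

lemma subspace_tendsto_frame:
  fixes f :: "'p \<Rightarrow> 'b::euclidean_space \<Rightarrow> 'a::euclidean_space"
  assumes f: "\<forall>\<^sub>F t in F. linear (f t)" "linear f0" and lim: "\<And>x. ((\<lambda>t. f t x) \<longlongrightarrow> f0 x) F"
    and \<kappa>: "0 < \<kappa>" "\<forall>\<^sub>F t in F. \<forall>x. \<kappa> * norm x \<le> norm (f t x)"
  shows "subspace_tendsto (\<lambda>t. range (f t)) (range f0) F"
  unfolding subspace_tendsto_def
proof
  fix v
  have "((\<lambda>t. f t (frame_coordinates (f t) v)) \<longlongrightarrow> f0 (frame_coordinates f0 v)) F"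
    by (rule frame_apply_tendsto[OF f lim frame_coordinates_tendsto[OF f lim \<kappa>]])
  moreover have "\<forall>\<^sub>F t in F. f t (frame_coordinates (f t) v) = closest_point (range (f t)) v"
    using f(1) by eventually_elim (rule frame_coordinates(1))
  ultimately show "((\<lambda>t. closest_point (range (f t)) v) \<longlongrightarrow> closest_point (range f0) v) F"
    unfolding frame_coordinates(1)[OF f(2)] by (subst (asm) tendsto_cong)
qed

text \<open>
  The coordinates \<open>x t\<close> of the projection solve the linear equation \<open>gram (f t) (x t) = y t\<close>.  The
  difference quotients of \<open>x\<close> solve an equation with the same coercive operator and a convergent
  right-hand side, and so does the derivative of \<open>x\<close>.
\<close>

lemma closest_point_frame_C1:
  fixes f f' :: "real \<Rightarrow> 'b::euclidean_space \<Rightarrow> 'a::euclidean_space"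
  assumes lin: "\<And>t. t \<in> S \<Longrightarrow> linear (f t)" "\<And>t. t \<in> S \<Longrightarrow> linear (f' t)"
    and der: "\<And>t x. t \<in> S \<Longrightarrow> ((\<lambda>s. f s x) has_vector_derivative f' t x) (at t within S)"
    and cont: "\<And>x. continuous_on S (\<lambda>t. f' t x)"
    and \<kappa>: "0 < \<kappa>" "\<And>t x. t \<in> S \<Longrightarrow> \<kappa> * norm x \<le> norm (f t x)"
  shows "\<exists>D. continuous_on S D \<and>
    (\<forall>t\<in>S. ((\<lambda>s. closest_point (range (f s)) v) has_vector_derivative D t) (at t within S))"
proof -
  define x where "x t = frame_coordinates (f t) v" for t
  define y where "y t = (\<Sum>i\<in>Basis. (v \<bullet> f t i) *\<^sub>R i)" for t
  define y' where "y' t = (\<Sum>i\<in>Basis. (v \<bullet> f' t i) *\<^sub>R i)" for t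
  define g' where "g' t u = (\<Sum>i\<in>Basis. (f t u \<bullet> f' t i + f' t u \<bullet> f t i) *\<^sub>R i)" for t u
  have inS: "\<forall>\<^sub>F s in at t within S. s \<in> S" for t by (simp add: eventually_at_filter)
  have evlin: "\<forall>\<^sub>F s in at t within S. linear (f s)" "\<forall>\<^sub>F s in at t within S. linear (f' s)"
      "\<forall>\<^sub>F s in at t within S. linear (gram (f s))" for t
    using inS[of t] by (auto elim!: eventually_mono intro: lin linear_gram)
  have ev\<kappa>: "\<forall>\<^sub>F s in at t within S. \<forall>x. \<kappa> * norm x \<le> norm (f s x)"
    "\<forall>\<^sub>F s in at t within S. \<forall>x. \<kappa>\<^sup>2 * norm x \<le> norm (gram (f s) x)" for t
  proof -
    show "\<forall>\<^sub>F s in at t within S. \<forall>x. \<kappa> * norm x \<le> norm (f s x)"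
      using inS by eventually_elim (use \<kappa>(2) in blast)
    show "\<forall>\<^sub>F s in at t within S. \<forall>x. \<kappa>\<^sup>2 * norm x \<le> norm (gram (f s) x)"
      using inS by eventually_elim (intro allI gram_coercive lin(1) \<kappa>)
  qed
  have fc: "((\<lambda>s. f s u) \<longlongrightarrow> f t u) (at t within S)" if "t \<in> S" for t u
    using has_vector_derivative_continuous[OF der[OF that]] by (simp add: continuous_within)
  have f'c: "((\<lambda>s. f' s u) \<longlongrightarrow> f' t u) (at t within S)" if "t \<in> S" for t u
    using cont that by (simp add: continuous_on_def)
  have xc: "(x \<longlongrightarrow> x t) (at t within S)" if "t \<in> S" for t
    unfolding x_def by (rule frame_coordinates_tendsto[OF evlin(1) lin(1)[OF that] fc[OF that] \<kappa>(1) ev\<kappa>(1)])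
  have gx: "gram (f t) (x t) = y t" if "t \<in> S" for t
    unfolding x_def y_def by (rule frame_coordinates(2)[OF lin(1)[OF that]])
  have "\<exists>u. gram (f t) u = y' t - g' t (x t)" if "t \<in> S" for t
  proof -
    have l: "linear (gram (f t))" by (rule linear_gram[OF lin(1)[OF that]])
    have "inj (gram (f t))"
    proof (rule injI)
      fix p q assume "gram (f t) p = gram (f t) q"
      then have "\<kappa>\<^sup>2 * norm (p - q) \<le> 0"
        using gram_coercive[OF lin(1)[OF that] \<kappa>(1) \<kappa>(2)[OF that], of "p - q"] by (simp add: linear_diff[OF l])
      then show "p = q" using \<kappa>(1) by (simp add: mult_le_0_iff)
    qed
    then have "surj (gram (f t))" using linear_injective_imp_surjective[OF l] by blast
    then show ?thesis by (metis surjD)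
  qed
  then obtain x' where x': "\<And>t. t \<in> S \<Longrightarrow> gram (f t) (x' t) = y' t - g' t (x t)" by metis
  have gram_der: "((\<lambda>s. gram (f s) u) has_vector_derivative g' t u) (at t within S)" if "t \<in> S" for t u
    unfolding gram_def g'_def
    by (intro has_vector_derivative_sum bounded_linear.has_vector_derivative[OF bounded_linear_scaleR_left]
        bounded_bilinear.has_vector_derivative[OF bounded_bilinear_inner] der that)
  have y_der: "(y has_vector_derivative y' t) (at t within S)" if "t \<in> S" for t
    unfolding y_def[abs_def] y'_def
    by (intro has_vector_derivative_sum bounded_linear.has_vector_derivative[OF bounded_linear_scaleR_left]
        bounded_linear.has_vector_derivative[OF bounded_linear_inner_right] der that)
  have x_der: "(x has_vector_derivative x' t) (at t within S)" if t: "t \<in> S" for t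
    unfolding has_vector_derivative_iff_quotient
  proof (rule coercive_solution_tendsto[OF evlin(3) _ _ ev\<kappa>(2)])
    have "((\<lambda>s. gram (f s) (x' t)) \<longlongrightarrow> gram (f t) (x' t)) (at t within S)"
      using has_vector_derivative_continuous[OF gram_der[OF t]] by (simp add: continuous_within)
    then show "((\<lambda>s. gram (f s) (x' t)) \<longlongrightarrow> y' t - g' t (x t)) (at t within S)" using x'[OF t] by simp
    show "\<forall>\<^sub>F s in at t within S. gram (f s) ((x s - x t) /\<^sub>R (s - t)) =
        (y s - y t) /\<^sub>R (s - t) - (gram (f s) (x t) - gram (f t) (x t)) /\<^sub>R (s - t)"
      using evlin(3) inS
    proof eventually_elim
      case (elim s)
      have "gram (f s) ((x s - x t) /\<^sub>R (s - t)) = (gram (f s) (x s) - gram (f s) (x t)) /\<^sub>R (s - t)"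
        using elim(1) by (simp add: linear_scale linear_diff)
      then show ?case using gx[OF t] gx[OF elim(2)] by (simp add: scaleR_diff_right)
    qed
    show "((\<lambda>s. (y s - y t) /\<^sub>R (s - t) - (gram (f s) (x t) - gram (f t) (x t)) /\<^sub>R (s - t)) \<longlongrightarrow>
        y' t - g' t (x t)) (at t within S)"
      using y_der[OF t] gram_der[OF t, of "x t"] unfolding has_vector_derivative_iff_quotient
      by (rule tendsto_diff)
  qed (use \<kappa>(1) in simp)
  have x'c: "(x' \<longlongrightarrow> x' t) (at t within S)" if t: "t \<in> S" for t
  proof (rule coercive_solution_tendsto[OF evlin(3) _ _ ev\<kappa>(2)])
    show "((\<lambda>s. gram (f s) (x' t)) \<longlongrightarrow> y' t - g' t (x t)) (at t within S)"
      using has_vector_derivative_continuous[OF gram_der[OF t]] x'[OF t] by (metis continuous_within)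
    show "\<forall>\<^sub>F s in at t within S. gram (f s) (x' s) = y' s - g' s (x s)"
      using inS by eventually_elim (rule x')
    show "((\<lambda>s. y' s - g' s (x s)) \<longlongrightarrow> y' t - g' t (x t)) (at t within S)"
      unfolding y'_def g'_def
      by (intro tendsto_intros f'c[OF t] fc[OF t] frame_apply_tendsto[OF evlin(1) lin(1)[OF t] fc[OF t] xc[OF t]]
          frame_apply_tendsto[OF evlin(2) lin(2)[OF t] f'c[OF t] xc[OF t]])
  qed (use \<kappa>(1) in simp)
  define D where "D t = (\<Sum>i\<in>Basis. (x t \<bullet> i) *\<^sub>R f' t i + (x' t \<bullet> i) *\<^sub>R f t i)" for t
  have "continuous_on S D"
    unfolding continuous_on_def D_def using xc x'c fc f'c by (intro ballI tendsto_intros) auto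
  moreover have "((\<lambda>s. closest_point (range (f s)) v) has_vector_derivative D t) (at t within S)"
    if t: "t \<in> S" for t
  proof (rule has_vector_derivative_transform[OF t])
    show "closest_point (range (f s)) v = (\<Sum>i\<in>Basis. (x s \<bullet> i) *\<^sub>R f s i)" if "s \<in> S" for s
      using frame_coordinates(1)[OF lin(1)[OF that], of v] linear_expand[OF lin(1)[OF that], of "x s"]
      by (simp add: x_def)
    have xi: "((\<lambda>s. x s \<bullet> i) has_real_derivative x' t \<bullet> i) (at t within S)" for i
      using bounded_linear.has_vector_derivative[OF bounded_linear_inner_left x_der[OF t]]
      by (simp add: has_real_derivative_iff_has_vector_derivative)
    show "((\<lambda>s. \<Sum>i\<in>Basis. (x s \<bullet> i) *\<^sub>R f s i) has_vector_derivative D t) (at t within S)"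
      unfolding D_def by (intro has_vector_derivative_sum has_vector_derivative_scaleR xi der t)
  qed
  ultimately show ?thesis by blast
qed

section \<open>Charts of the Lagrangian Grassmannian\<close>

text \<open>
  The Lagrangian subspaces transversal to the one of slope \<open>\<tau>\<close> are graphs over the vertical space
  and correspond to the symmetric operators.
\<close>

definition chart_frame :: "real \<Rightarrow> (real^'n \<Rightarrow> real^'n) \<Rightarrow> real^'n \<Rightarrow> 'n::finite phase" where
  "chart_frame \<tau> S z = (S z, z + \<tau> *\<^sub>R S z)"

lemma linear_chart_frame: "linear S \<Longrightarrow> linear (chart_frame \<tau> S)"
  by (intro linearI) (simp_all add: chart_frame_def linear_add linear_scale algebra_simps)

lemma chart_frame_bound: "norm z \<le> (1 + \<bar>\<tau>\<bar>) * norm (chart_frame \<tau> S z)"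
proof -
  let ?m = "chart_frame \<tau> S z"
  have "norm z = norm (snd ?m - \<tau> *\<^sub>R fst ?m)" by (simp add: chart_frame_def)
  also have "\<dots> \<le> norm (snd ?m) + \<bar>\<tau>\<bar> * norm (fst ?m)"
    using norm_triangle_ineq4[of "snd ?m" "\<tau> *\<^sub>R fst ?m"] by simp
  also have "\<dots> \<le> norm ?m + \<bar>\<tau>\<bar> * norm ?m"
    using norm_fst_le[of "fst ?m" "snd ?m"] norm_snd_le[of "snd ?m" "fst ?m"]
    by (intro add_mono mult_left_mono) auto
  finally show ?thesis by (simp add: algebra_simps)
qed

lemma chart_frame_coercive: "1 / (1 + \<bar>\<tau>\<bar>) * norm z \<le> norm (chart_frame \<tau> S z)"
  using chart_frame_bound[of z \<tau> S] by (simp add: field_simps)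

lemma chart_lagrangian:
  fixes S :: "real^'n::finite \<Rightarrow> real^'n"
  assumes S: "linear S" and sym: "\<And>x y. S x \<bullet> y = x \<bullet> S y"
  shows "range (chart_frame \<tau> S) \<in> lagrangians"
proof -
  note lin = linear_chart_frame[OF S, of \<tau>]
  have "inj (chart_frame \<tau> S)"
    by (intro injI) (auto simp: chart_frame_def)
  then have "dim (range (chart_frame \<tau> S)) = dim (UNIV :: (real^'n) set)"
    by (intro dim_image_eq[OF lin]) simp
  then have "dim (range (chart_frame \<tau> S)) = CARD('n)" by (simp add: dim_UNIV)
  moreover have "omega (chart_frame \<tau> S x) (chart_frame \<tau> S y) = 0" for x y
    using sym[of x y] sym[of "S x" y]
    by (simp add: omega_pair chart_frame_def inner_add_left inner_add_right inner_commute)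
  ultimately show ?thesis
    using linear_subspace_image[OF lin subspace_UNIV] by (auto simp: lagrangians_def)
qed

definition chart_op :: "real \<Rightarrow> 'n::finite phase set \<Rightarrow> real^'n \<Rightarrow> real^'n" where
  "chart_op \<tau> M z = fst (inv_into M (\<lambda>m. snd m - \<tau> *\<^sub>R fst m) z)"

lemma slope_map_bij:
  fixes M :: "'n::finite phase set"
  assumes M: "M \<in> lagrangians" and \<tau>: "transv \<tau> M"
  shows "bij_betw (\<lambda>m. snd m - \<tau> *\<^sub>R fst m) M UNIV"
proof -
  let ?Z = "\<lambda>m::'n phase. snd m - \<tau> *\<^sub>R fst m"
  have lin: "linear ?Z" using bounded_linear_slope_map bounded_linear.linear by blast
  note sub = lagrangianD(1)[OF M]
  have inj: "inj_on ?Z M"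
  proof (rule inj_onI)
    fix x y assume "x \<in> M" "y \<in> M" "?Z x = ?Z y"
    then have "x - y \<in> M" "snd (x - y) = \<tau> *\<^sub>R fst (x - y)"
      using sub by (auto simp: subspace_diff algebra_simps)
    then show "x = y" using \<tau> unfolding transv_def by fastforce
  qed
  have "span M = M" using sub span_eq_iff by blast
  then have "inj_on ?Z (span M)" using inj by (simp only:)
  then have "dim (?Z ` M) = dim M" by (rule dim_image_eq[OF lin])
  then have "dim (?Z ` M) = CARD('n)" using lagrangianD(2)[OF M] by simp
  then have "?Z ` M = UNIV"
    by (intro subspace_dim_equal linear_subspace_image[OF lin sub] subspace_UNIV) (auto simp: dim_UNIV)
  then show ?thesis using inj by (simp add: bij_betw_def)
qed

lemma chart_op_mem:
  assumes M: "M \<in> lagrangians" and \<tau>: "transv \<tau> M"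
  shows "chart_frame \<tau> (chart_op \<tau> M) z = inv_into M (\<lambda>m. snd m - \<tau> *\<^sub>R fst m) z"
    and "chart_frame \<tau> (chart_op \<tau> M) z \<in> M"
proof -
  let ?Z = "\<lambda>m. snd m - \<tau> *\<^sub>R fst m"
  have zZ: "z \<in> ?Z ` M" using slope_map_bij[OF M \<tau>] by (simp add: bij_betw_def)
  have z1: "inv_into M ?Z z \<in> M" by (rule inv_into_into[OF zZ])
  have "?Z (inv_into M ?Z z) = z" by (rule f_inv_into_f[OF zZ])
  then have z2: "snd (inv_into M ?Z z) = z + \<tau> *\<^sub>R fst (inv_into M ?Z z)" by (simp only: diff_eq_eq)
  show eq: "chart_frame \<tau> (chart_op \<tau> M) z = inv_into M ?Z z"
    unfolding chart_frame_def chart_op_def z2[symmetric] by (rule prod.collapse)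
  show "chart_frame \<tau> (chart_op \<tau> M) z \<in> M" unfolding eq by (rule z1)
qed

lemma chart_op_unique:
  assumes M: "M \<in> lagrangians" and \<tau>: "transv \<tau> M" and "m \<in> M"
  shows "chart_op \<tau> M (snd m - \<tau> *\<^sub>R fst m) = fst m"
  unfolding chart_op_def using slope_map_bij[OF M \<tau>] \<open>m \<in> M\<close>
  by (simp add: bij_betw_def inv_into_f_f[where f = "\<lambda>m. snd m - \<tau> *\<^sub>R fst m"])

lemma linear_chart_op:
  assumes M: "M \<in> lagrangians" and \<tau>: "transv \<tau> M"
  shows "linear (chart_op \<tau> M)"
proof (rule linearI)
  note sub = lagrangianD(1)[OF M] and mem = chart_op_mem(2)[OF M \<tau>]
  let ?f = "chart_frame \<tau> (chart_op \<tau> M)"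
  show "chart_op \<tau> M (x + y) = chart_op \<tau> M x + chart_op \<tau> M y" for x y
    using chart_op_unique[OF M \<tau> subspace_add[OF sub mem[of x] mem[of y]]]
    by (simp add: chart_frame_def algebra_simps)
  show "chart_op \<tau> M (c *\<^sub>R x) = c *\<^sub>R chart_op \<tau> M x" for c x
    using chart_op_unique[OF M \<tau> subspace_scale[OF sub mem[of x], of c]]
    by (simp add: chart_frame_def algebra_simps)
qed

lemma chart_op_symmetric:
  assumes M: "M \<in> lagrangians" and \<tau>: "transv \<tau> M"
  shows "chart_op \<tau> M x \<bullet> y = x \<bullet> chart_op \<tau> M y"
  using lagrangian_inner_commute[OF M chart_op_mem(2)[OF M \<tau>, of x] chart_op_mem(2)[OF M \<tau>, of y]]
  by (simp add: chart_frame_def inner_add_right inner_commute)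

lemma range_chart_op:
  assumes M: "M \<in> lagrangians" and \<tau>: "transv \<tau> M"
  shows "range (chart_frame \<tau> (chart_op \<tau> M)) = M"
proof
  show "range (chart_frame \<tau> (chart_op \<tau> M)) \<subseteq> M" using chart_op_mem(2)[OF M \<tau>] by blast
  show "M \<subseteq> range (chart_frame \<tau> (chart_op \<tau> M))"
  proof
    fix m assume "m \<in> M"
    then have "m = chart_frame \<tau> (chart_op \<tau> M) (snd m - \<tau> *\<^sub>R fst m)"
      using chart_op_unique[OF M \<tau>] by (simp add: chart_frame_def prod_eq_iff)
    then show "m \<in> range (chart_frame \<tau> (chart_op \<tau> M))" by blast
  qed
qed

lemma chart_op_tendsto:
  fixes M :: "'p \<Rightarrow> 'n::finite phase set"
  assumes M: "\<forall>\<^sub>F t in F. M t \<in> lagrangians" "M0 \<in> lagrangians" and lim: "subspace_tendsto M M0 F"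
    and \<tau>: "\<forall>\<^sub>F t in F. transv \<tau> (M t)" "transv \<tau> M0"
  shows "((\<lambda>t. chart_op \<tau> (M t) z) \<longlongrightarrow> chart_op \<tau> M0 z) F"
proof -
  let ?Z = "\<lambda>m::'n phase. snd m - \<tau> *\<^sub>R fst m"
  define m where "m t = chart_frame \<tau> (chart_op \<tau> (M t)) z" for t
  define m0 where "m0 = chart_frame \<tau> (chart_op \<tau> M0) z"
  have sub: "\<forall>\<^sub>F t in F. subspace (M t)" using M(1) by eventually_elim (rule lagrangianD)
  have "\<exists>c>0. \<forall>\<^sub>F t in F. \<forall>m\<in>M t. c * norm m \<le> norm (?Z m)"
    by (rule eventually_bounded_below_on_subspaces[OF sub lagrangianD(1)[OF M(2)] lim bounded_linear_slope_map])
       (use \<tau>(2) in \<open>auto simp: transv_def\<close>)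
  then obtain c where c: "0 < c" "\<forall>\<^sub>F t in F. \<forall>m\<in>M t. c * norm m \<le> norm (?Z m)" by blast
  have P: "((\<lambda>t. closest_point (M t) m0) \<longlongrightarrow> m0) F"
    using lim closest_point_self[OF chart_op_mem(2)[OF M(2) \<tau>(2), of z]]
    unfolding subspace_tendsto_def m0_def by metis
  have "((\<lambda>t. m t - closest_point (M t) m0) \<longlongrightarrow> 0) F"
  proof (rule Lim_null_comparison)
    show "\<forall>\<^sub>F t in F. norm (m t - closest_point (M t) m0) \<le> norm (z - ?Z (closest_point (M t) m0)) / c"
      using M(1) \<tau>(1) c(2)
    proof eventually_elim
      case (elim t)
      note subt = lagrangianD(1)[OF elim(1)]
      have "m t - closest_point (M t) m0 \<in> M t"
        unfolding m_def using chart_op_mem(2)[OF elim(1,2)] closest_point_in_subspace[OF subt] subt subspace_diff by blast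
      then have "c * norm (m t - closest_point (M t) m0) \<le> norm (?Z (m t - closest_point (M t) m0))"
        using elim(3) by blast
      also have "?Z (m t - closest_point (M t) m0) = z - ?Z (closest_point (M t) m0)"
        by (simp add: m_def chart_frame_def algebra_simps)
      finally show ?case using c(1) by (simp add: field_simps)
    qed
    have "((\<lambda>t. norm (z - ?Z (closest_point (M t) m0)) / c) \<longlongrightarrow> norm (z - ?Z m0) / c) F"
      using c(1) by (intro tendsto_intros P) auto
    then show "((\<lambda>t. norm (z - ?Z (closest_point (M t) m0)) / c) \<longlongrightarrow> 0) F" by (simp add: m0_def chart_frame_def)
  qed
  from tendsto_add[OF this P] have "(m \<longlongrightarrow> m0) F" by simp
  from tendsto_fst[OF this] show ?thesis by (simp add: m_def m0_def chart_frame_def)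
qed

section \<open>Regular paths in a chart\<close>

text \<open>
  Two Lagrangians in a chart are joined by the straight line between the symmetric operators,
  bent by a large multiple of \<open>\<theta> (1 - \<theta>)\<close>.  For \<open>\<theta>\<close> away from the endpoints of \<open>[0,1]\<close> the operator
  is then positive definite and there is no crossing; near the endpoints the derivative is definite
  and crossings are regular.
\<close>

definition bent_segment :: "real \<Rightarrow> (real^'n \<Rightarrow> real^'n) \<Rightarrow> (real^'n \<Rightarrow> real^'n) \<Rightarrow> real \<Rightarrow> real^'n \<Rightarrow> real^'n::finite" where
  "bent_segment c S0 S1 \<theta> z = (1 - \<theta>) *\<^sub>R S0 z + \<theta> *\<^sub>R S1 z + (c * (\<theta> * (1 - \<theta>))) *\<^sub>R z"

lemma bent_segment_props:
  assumes "linear S0" "linear S1" "\<And>x y. S0 x \<bullet> y = x \<bullet> S0 y" "\<And>x y. S1 x \<bullet> y = x \<bullet> S1 y"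
  shows "linear (bent_segment c S0 S1 \<theta>)"
    and "bent_segment c S0 S1 \<theta> x \<bullet> y = x \<bullet> bent_segment c S0 S1 \<theta> y"
proof -
  show "linear (bent_segment c S0 S1 \<theta>)"
    by (intro linearI) (simp_all add: bent_segment_def linear_add[OF assms(1)] linear_add[OF assms(2)]
        linear_scale[OF assms(1)] linear_scale[OF assms(2)] algebra_simps)
  show "bent_segment c S0 S1 \<theta> x \<bullet> y = x \<bullet> bent_segment c S0 S1 \<theta> y"
    by (simp add: bent_segment_def inner_add_left inner_add_right assms(3,4))
qed

text \<open>
  A vector \<open>z\<close> in the kernel forces \<open>16 \<theta> (1 - \<theta>) \<le> 1\<close>, hence \<open>\<bar>1 - 2 \<theta>\<bar> > 1 / 2\<close>.  There the
  derivative of the bending term is larger than \<open>8 B\<close> in absolute value, whereas \<open>S1 - S0\<close>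
  contributes at most \<open>2 B\<close>.
\<close>

lemma bent_segment_regular:
  fixes S0 S1 :: "real^'n::finite \<Rightarrow> real^'n"
  assumes B: "0 < B" "\<And>z. norm (S0 z) \<le> B * norm z" "\<And>z. norm (S1 z) \<le> B * norm z"
    and \<theta>: "0 \<le> \<theta>" "\<theta> \<le> 1" and z: "z \<noteq> 0" "bent_segment (16 * B) S0 S1 \<theta> z = 0"
  shows "z \<bullet> (S1 z - S0 z + (16 * B * (1 - 2 * \<theta>)) *\<^sub>R z) \<noteq> 0"
proof -
  let ?n = "(norm z)\<^sup>2"
  have n: "0 < ?n" using z by simp
  have bound: "\<bar>z \<bullet> S z\<bar> \<le> B * ?n" if "\<And>z. norm (S z) \<le> B * norm z" for S :: "real^'n \<Rightarrow> real^'n"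
  proof -
    have "\<bar>z \<bullet> S z\<bar> \<le> norm z * norm (S z)" by (rule Cauchy_Schwarz_ineq2)
    also have "\<dots> \<le> norm z * (B * norm z)" using that by (intro mult_left_mono) auto
    finally show ?thesis by (simp add: power2_eq_square mult_ac)
  qed
  note b0 = bound[of S0, OF B(2)] and b1 = bound[of S1, OF B(3)]
  have "0 = z \<bullet> bent_segment (16 * B) S0 S1 \<theta> z" using z(2) by simp
  also have "\<dots> = (1 - \<theta>) * (z \<bullet> S0 z) + \<theta> * (z \<bullet> S1 z) + 16 * B * (\<theta> * (1 - \<theta>)) * ?n"
    by (simp add: bent_segment_def inner_add_right power2_norm_eq_inner)
  also have "\<dots> \<ge> (1 - \<theta>) * (- (B * ?n)) + \<theta> * (- (B * ?n)) + 16 * B * (\<theta> * (1 - \<theta>)) * ?n"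
    using b0 b1 \<theta> by (intro add_mono mult_left_mono order_refl) auto
  finally have "(B * ?n) * (16 * (\<theta> * (1 - \<theta>))) \<le> (B * ?n) * 1" by (simp add: algebra_simps)
  then have "16 * (\<theta> * (1 - \<theta>)) \<le> 1" using n B(1) by (simp add: mult_le_cancel_left_pos)
  then have "(1/2)\<^sup>2 < (1 - 2 * \<theta>)\<^sup>2" by (simp add: power2_eq_square algebra_simps)
  then have big: "1/2 < \<bar>1 - 2 * \<theta>\<bar>" by (simp add: abs_le_square_iff[symmetric] flip: not_le)
  show ?thesis
  proof
    assume "z \<bullet> (S1 z - S0 z + (16 * B * (1 - 2 * \<theta>)) *\<^sub>R z) = 0"
    then have "z \<bullet> S0 z - z \<bullet> S1 z = (16 * (B * ?n)) * (1 - 2 * \<theta>)"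
      by (simp add: inner_add_right inner_diff_right power2_norm_eq_inner algebra_simps)
    then have "(16 * (B * ?n)) * \<bar>1 - 2 * \<theta>\<bar> = \<bar>z \<bullet> S0 z - z \<bullet> S1 z\<bar>"
      using B(1) n by (simp add: abs_mult)
    also have "\<dots> \<le> 2 * (B * ?n)" using b0 b1 by linarith
    also have "\<dots> < (16 * (B * ?n)) * (1/2)" using B(1) n by simp
    finally have "\<bar>1 - 2 * \<theta>\<bar> < 1/2" using B(1) n by (simp add: mult_less_cancel_left_pos)
    then show False using big by simp
  qed
qed

lemma linear_norm_bound:
  fixes f :: "'a::euclidean_space \<Rightarrow> 'b::real_normed_vector"
  assumes "linear f"
  shows "\<exists>B>0. \<forall>z. norm (f z) \<le> B * norm z"
  using bounded_linear.pos_bounded assms unfolding linear_conv_bounded_linear by (metis mult.commute)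

lemma regular_path_in_chart:
  fixes S0 S1 :: "real^'n::finite \<Rightarrow> real^'n"
  assumes S0: "linear S0" "\<And>x y. S0 x \<bullet> y = x \<bullet> S0 y" and S1: "linear S1" "\<And>x y. S1 x \<bullet> y = x \<bullet> S1 y"
    and ab: "a < b"
  shows "\<exists>S. (\<forall>t. linear (S t)) \<and> (\<forall>t x y. S t x \<bullet> y = x \<bullet> S t y) \<and> (\<forall>z. continuous_on {a..b} (\<lambda>t. S t z)) \<and>
    S a = S0 \<and> S b = S1 \<and> regular_path (\<lambda>t. range (chart_frame \<tau> (S t))) vertical a b"
proof -
  obtain B0 B1 where B01: "0 < B0" "\<And>z. norm (S0 z) \<le> B0 * norm z" "0 < B1" "\<And>z. norm (S1 z) \<le> B1 * norm z"
    using linear_norm_bound[OF S0(1)] linear_norm_bound[OF S1(1)] by blast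
  define B where "B = B0 + B1"
  have B: "0 < B" "norm (S0 z) \<le> B * norm z" "norm (S1 z) \<le> B * norm z" for z
  proof -
    have "0 \<le> B0 * norm z" "0 \<le> B1 * norm z" using B01(1,3) by simp_all
    then show "0 < B" "norm (S0 z) \<le> B * norm z" "norm (S1 z) \<le> B * norm z"
      unfolding B_def distrib_right using B01(1,3) B01(2,4)[of z] by linarith+
  qed
  define \<theta> where "\<theta> t = (t - a) / (b - a)" for t
  define S where "S t = bent_segment (16 * B) S0 S1 (\<theta> t)" for t
  define S' where "S' t z = (1 / (b - a)) *\<^sub>R (S1 z - S0 z + (16 * B * (1 - 2 * \<theta> t)) *\<^sub>R z)" for t z
  let ?\<Gamma> = "\<lambda>t. range (chart_frame \<tau> (S t))"
  have linS: "linear (S t)" and symS: "S t x \<bullet> y = x \<bullet> S t y" for t x y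
    unfolding S_def by (rule bent_segment_props[OF S0(1) S1(1) S0(2) S1(2)])+
  have linS': "linear (S' t)" for t
    by (intro linearI) (simp_all add: S'_def linear_add[OF S0(1)] linear_add[OF S1(1)]
        linear_scale[OF S0(1)] linear_scale[OF S1(1)] algebra_simps)
  have derS: "((\<lambda>s. S s z) has_vector_derivative S' t z) (at t within {a..b})" for t z
  proof -
    have d\<theta>: "(\<theta> has_real_derivative 1 / (b - a)) (at t within {a..b})"
      unfolding \<theta>_def[abs_def] using ab by (auto intro!: derivative_eq_intros)
    have d\<theta>2: "((\<lambda>s. 16 * B * (\<theta> s * (1 - \<theta> s))) has_real_derivative 16 * B * (1 - 2 * \<theta> t) / (b - a))
        (at t within {a..b})"
      by (rule DERIV_cong, (rule DERIV_diff DERIV_mult DERIV_cmult DERIV_const d\<theta>)+)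
        (simp add: algebra_simps diff_divide_distrib)
    have d1: "((\<lambda>s. 1 - \<theta> s) has_real_derivative - (1 / (b - a))) (at t within {a..b})"
      by (rule DERIV_cong, (rule DERIV_diff DERIV_const d\<theta>)+) simp
    have "((\<lambda>s. (1 - \<theta> s) *\<^sub>R S0 z + \<theta> s *\<^sub>R S1 z + (16 * B * (\<theta> s * (1 - \<theta> s))) *\<^sub>R z)
        has_vector_derivative
        ((1 - \<theta> t) *\<^sub>R 0 + (- (1 / (b - a))) *\<^sub>R S0 z) + (\<theta> t *\<^sub>R 0 + (1 / (b - a)) *\<^sub>R S1 z) +
        ((16 * B * (\<theta> t * (1 - \<theta> t))) *\<^sub>R 0 + (16 * B * (1 - 2 * \<theta> t) / (b - a)) *\<^sub>R z)) (at t within {a..b})"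
      by (intro has_vector_derivative_add has_vector_derivative_scaleR has_vector_derivative_const d1 d\<theta> d\<theta>2)
    then show ?thesis
      unfolding S_def bent_segment_def S'_def
      by (simp add: scaleR_add_right scaleR_diff_right)
  qed
  have derF: "((\<lambda>s. chart_frame \<tau> (S s) z) has_vector_derivative chart_frame \<tau> (S' t) z - (0, z)) (at t within {a..b})" for t z
  proof -
    have "((\<lambda>s. (S s z, z + \<tau> *\<^sub>R S s z)) has_vector_derivative (S' t z, \<tau> *\<^sub>R S' t z)) (at t within {a..b})"
      by (intro has_vector_derivative_Pair derS)
        (rule has_vector_derivative_eq_rhs, (rule has_vector_derivative_add has_vector_derivative_const
            bounded_linear.has_vector_derivative[OF bounded_linear_scaleR_right] derS)+, simp)
    then show ?thesis by (simp add: chart_frame_def)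
  qed
  have lag: "?\<Gamma> t \<in> lagrangians" for t by (rule chart_lagrangian[OF linS symS])
  have C1: "C1_lagrangian_path ?\<Gamma> a b"
    unfolding C1_lagrangian_path_def
  proof (intro conjI ballI allI lag)
    fix v
    show "\<exists>D. continuous_on {a..b} D \<and> (\<forall>t\<in>{a..b}.
        ((\<lambda>s. closest_point (?\<Gamma> s) v) has_vector_derivative D t) (at t within {a..b}))"
    proof (rule closest_point_frame_C1)
      show "linear (\<lambda>z. chart_frame \<tau> (S' t) z - (0, z))" for t
        by (intro linear_compose_sub linear_chart_frame linS') (auto intro: linearI)
      show "continuous_on {a..b} (\<lambda>t. chart_frame \<tau> (S' t) z - (0, z))" for z
        unfolding chart_frame_def S'_def \<theta>_def by (intro continuous_intros) (use ab in auto)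
      show "0 < 1 / (1 + \<bar>\<tau>\<bar>)" by (simp add: add_pos_nonneg)
    qed (rule linear_chart_frame[OF linS] derF chart_frame_coercive)+
  qed
  have form: "crossing_form ?\<Gamma> a b t q = - (snd q \<bullet> S' t (snd q))" and z0: "S t (snd q) = 0"
    if t: "t \<in> {a..b}" and q: "q \<in> ?\<Gamma> t \<inter> vertical" for t q
  proof -
    obtain z where "q = chart_frame \<tau> (S t) z" using q by blast
    then have z: "S t z = 0" "q = (0, z)" using q by (auto simp: chart_frame_def mem_vertical)
    then show "S t (snd q) = 0" by simp
    obtain D where D: "((\<lambda>s. closest_point (?\<Gamma> s) q) has_vector_derivative D) (at t within {a..b})"
      using C1_pathD(2)[OF C1 t] by blast
    have qz: "chart_frame \<tau> (S t) z = q" using z by (simp add: chart_frame_def)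
    have "((\<lambda>s. chart_frame \<tau> (S s) z) \<longlongrightarrow> q) (at t within {a..b})"
      using has_vector_derivative_continuous[OF derF[of z t]] unfolding continuous_within qz .
    then have "((\<lambda>s. omega q (chart_frame \<tau> (S s) z) / (s - t)) \<longlongrightarrow> omega q D) (at t within {a..b})"
      using q by (intro omega_along_curve[OF lag t _ D]) auto
    moreover have "((\<lambda>s. omega q (chart_frame \<tau> (S s) z) / (s - t)) \<longlongrightarrow> - (z \<bullet> S' t z)) (at t within {a..b})"
    proof -
      have "((\<lambda>s. - (z \<bullet> ((S s z - S t z) /\<^sub>R (s - t)))) \<longlongrightarrow> - (z \<bullet> S' t z)) (at t within {a..b})"
        using derS[of z t] unfolding has_vector_derivative_iff_quotient by (intro tendsto_intros)
      then show ?thesis by (simp add: z omega_pair chart_frame_def divide_inverse mult.commute)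
    qed
    moreover have "at t within {a..b} \<noteq> bot" using ab t by (simp add: trivial_limit_within islimpt_Icc)
    ultimately have "omega q D = - (z \<bullet> S' t z)" using tendsto_unique by blast
    moreover have "crossing_form ?\<Gamma> a b t q = omega q D"
      using q by (intro crossing_form_eq[OF C1 ab t _ D]) auto
    ultimately show "crossing_form ?\<Gamma> a b t q = - (snd q \<bullet> S' t (snd q))" using z by simp
  qed
  have nondeg: "nondegenerate_on (?\<Gamma> t \<inter> vertical) (crossing_form ?\<Gamma> a b t)" if t: "t \<in> {a..b}" for t
    unfolding nondegenerate_on_def
  proof (intro ballI impI, rule ccontr)
    fix x assume x: "x \<in> ?\<Gamma> t \<inter> vertical" "\<forall>y\<in>?\<Gamma> t \<inter> vertical. polar_form (crossing_form ?\<Gamma> a b t) x y = 0" "x \<noteq> 0"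
    have sub: "subspace (?\<Gamma> t \<inter> vertical)" by (intro subspace_inter lagrangianD(1)[OF lag] subspace_vertical)
    then have xx: "x + x \<in> ?\<Gamma> t \<inter> vertical" using x(1) subspace_add by blast
    have "snd (x + x) \<bullet> S' t (snd (x + x)) = 4 * (snd x \<bullet> S' t (snd x))"
      unfolding snd_add linear_add[OF linS'] inner_add_left inner_add_right by simp
    then have "polar_form (crossing_form ?\<Gamma> a b t) x x = - (snd x \<bullet> S' t (snd x))"
      unfolding polar_form_def form[OF t x(1)] form[OF t xx] by simp
    then have "snd x \<bullet> S' t (snd x) = 0" using x(1,2) by auto
    moreover have "snd x \<noteq> 0" using x(1,3) by (auto simp: mem_vertical prod_eq_iff)
    moreover have "0 \<le> \<theta> t" "\<theta> t \<le> 1" using t ab by (auto simp: \<theta>_def)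
    ultimately show False
      using bent_segment_regular[OF B, of "\<theta> t" "snd x"] z0[OF t x(1)] ab by (simp add: S_def S'_def)
  qed
  have "\<theta> a = 0" "\<theta> b = 1" using ab by (auto simp: \<theta>_def)
  then have "S a = S0" "S b = S1" by (auto simp: S_def bent_segment_def)
  moreover have "continuous_on {a..b} (\<lambda>t. S t z)" for z
    unfolding continuous_on_eq_continuous_within using has_vector_derivative_continuous[OF derS] by blast
  ultimately show ?thesis
    using linS symS C1 nondeg by (intro exI[of _ S]) (simp add: regular_path_def)
qed

text \<open>Within a chart the homotopy is linear in the symmetric operators.\<close>

lemma exists_homotopic_regular_path:
  fixes \<Gamma> :: "real \<Rightarrow> 'n::finite phase set"
  assumes \<Gamma>: "lag_continuous_on {a..b} \<Gamma>" and \<tau>: "\<And>t. t \<in> {a..b} \<Longrightarrow> transv \<tau> (\<Gamma> t)" and ab: "a < b"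
  shows "\<exists>\<Delta>. regular_path \<Delta> vertical a b \<and>
    homotopic_with (\<lambda>\<gamma>. \<gamma> a = \<Gamma> a \<and> \<gamma> b = \<Gamma> b) (top_of_set {a..b}) lagrangian_topology \<Gamma> \<Delta>"
proof -
  note lag = lag_continuous_onD[OF \<Gamma>]
  define R where "R t = chart_op \<tau> (\<Gamma> t)" for t
  have R: "linear (R t)" "\<And>x y. R t x \<bullet> y = x \<bullet> R t y" "range (chart_frame \<tau> (R t)) = \<Gamma> t" if "t \<in> {a..b}" for t
    using linear_chart_op[OF lag(1)[OF that] \<tau>[OF that]] chart_op_symmetric[OF lag(1)[OF that] \<tau>[OF that]]
      range_chart_op[OF lag(1)[OF that] \<tau>[OF that]] by (simp_all add: R_def)
  have Rc: "continuous_on {a..b} (\<lambda>t. R t z)" for z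
    unfolding continuous_on_def R_def
  proof (intro ballI chart_op_tendsto lag(3) lag(1) lag(2) \<tau>)
    show "\<forall>\<^sub>F t in at x within {a..b}. transv \<tau> (\<Gamma> t)" for x
      using \<tau> by (simp add: eventually_at_filter)
  qed
  obtain S where S: "\<And>t. linear (S t)" "\<And>t x y. S t x \<bullet> y = x \<bullet> S t y" "\<And>z. continuous_on {a..b} (\<lambda>t. S t z)"
    "S a = R a" "S b = R b" "regular_path (\<lambda>t. range (chart_frame \<tau> (S t))) vertical a b"
    using regular_path_in_chart[OF R(1,2) R(1,2) ab, of a b \<tau>] ab by auto
  define T where "T p z = (1 - fst p) *\<^sub>R R (snd p) z + fst p *\<^sub>R S (snd p) z" for p z
  let ?Q = "{0..1::real} \<times> {a..b}"
  define h where "h p = range (chart_frame \<tau> (T p))" for p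
  have linT: "linear (T p)" if "p \<in> ?Q" for p
  proof -
    have "linear (R (snd p))" using R(1) that by auto
    then show ?thesis
      using S(1) by (intro linearI) (simp_all add: T_def linear_add linear_scale algebra_simps)
  qed
  have symT: "T p x \<bullet> y = x \<bullet> T p y" if "p \<in> ?Q" for p x y
    using R(2)[of "snd p" x y] S(2) that by (auto simp: T_def inner_add_left inner_add_right)
  have Tc: "continuous_on ?Q (\<lambda>p. T p z)" for z
    unfolding T_def
    by (intro continuous_intros continuous_on_compose2[OF Rc] continuous_on_compose2[OF S(3)]) auto
  have "lag_continuous_on ?Q h"
    unfolding lag_continuous_on_def
  proof (intro conjI ballI allI)
    show "h p \<in> lagrangians" if "p \<in> ?Q" for p
      unfolding h_def by (rule chart_lagrangian[OF linT[OF that] symT[OF that]])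
    show "continuous_on ?Q (\<lambda>p. closest_point (h p) x)" for x
      unfolding continuous_on_def
    proof
      fix p assume p: "p \<in> ?Q"
      have "subspace_tendsto (\<lambda>p. range (chart_frame \<tau> (T p))) (range (chart_frame \<tau> (T p))) (at p within ?Q)"
      proof (rule subspace_tendsto_frame)
        show "\<forall>\<^sub>F q in at p within ?Q. linear (chart_frame \<tau> (T q))"
          unfolding eventually_at_filter by (intro always_eventually allI impI linear_chart_frame linT)
        show "linear (chart_frame \<tau> (T p))" by (intro linear_chart_frame linT p)
        show "((\<lambda>q. chart_frame \<tau> (T q) z) \<longlongrightarrow> chart_frame \<tau> (T p) z) (at p within ?Q)" for z
          using Tc[of z] p unfolding chart_frame_def continuous_on_def by (intro tendsto_intros) auto
        show "0 < 1 / (1 + \<bar>\<tau>\<bar>)" by (simp add: add_pos_nonneg)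
        show "\<forall>\<^sub>F q in at p within ?Q. \<forall>z. 1 / (1 + \<bar>\<tau>\<bar>) * norm z \<le> norm (chart_frame \<tau> (T q) z)"
          by (intro always_eventually allI chart_frame_coercive)
      qed
      then show "((\<lambda>p. closest_point (h p) x) \<longlongrightarrow> closest_point (h p) x) (at p within ?Q)"
        unfolding subspace_tendsto_def h_def by blast
    qed
  qed
  then have hc: "continuous_map (prod_topology (top_of_set {0..1::real}) (top_of_set {a..b})) lagrangian_topology h"
    by (simp add: lag_continuous_on_iff_continuous_map)
  have "homotopic_with (\<lambda>\<gamma>. \<gamma> a = \<Gamma> a \<and> \<gamma> b = \<Gamma> b) (top_of_set {a..b}) lagrangian_topology \<Gamma>
      (\<lambda>t. range (chart_frame \<tau> (S t)))"
  proof (subst homotopic_with, goal_cases)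
    case (1 h k)
    then show ?case using ab by auto
  next
    case 2
    show ?case
    proof (intro exI[of _ h] conjI ballI hc)
      show "h (0, t) = \<Gamma> t" if "t \<in> topspace (top_of_set {a..b})" for t
        using that R(3) by (simp add: h_def T_def[abs_def])
      show "h (1, t) = range (chart_frame \<tau> (S t))" for t
        by (simp add: h_def T_def[abs_def])
      have "T (s, a) = R a" "T (s, b) = R b" for s
        using S(4,5) by (auto simp: T_def[abs_def] scaleR_add_left[symmetric])
      then show "h (s, a) = \<Gamma> a" "h (s, b) = \<Gamma> b" for s
        using R(3) ab by (auto simp: h_def)
    qed
  qed
  then show ?thesis using S(6) by blast
qed

text \<open>
  The index is the drop of any potential along any regular path in the homotopy class, and in a
  chart \<open>steep \<tau>\<close> itself is a potential.
\<close>

theorem maslov_index_in_chart: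
  fixes \<Gamma> :: "real \<Rightarrow> 'n::finite phase set"
  assumes \<Gamma>: "lag_continuous_on {a..b} \<Gamma>" and \<tau>: "\<And>t. t \<in> {a..b} \<Longrightarrow> transv \<tau> (\<Gamma> t)" and ab: "a < b"
  shows "maslov_index \<Gamma> vertical a b = int (steep \<tau> (\<Gamma> a)) - int (steep \<tau> (\<Gamma> b))"
proof -
  let ?k = "int (steep \<tau> (\<Gamma> a)) - int (steep \<tau> (\<Gamma> b))"
  let ?hom = "homotopic_with (\<lambda>\<gamma>. \<gamma> a = \<Gamma> a \<and> \<gamma> b = \<Gamma> b) (top_of_set {a..b}) lagrangian_topology \<Gamma>"
  have index: "regular_maslov \<Delta> vertical a b = ?k" if reg: "regular_path \<Delta> vertical a b" and hom: "?hom \<Delta>" for \<Delta>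
  proof -
    obtain k where k: "path_index \<Gamma> a b k" "path_index \<Delta> a b k"
      using path_index_homotopic[OF hom] ab by auto
    have "k = ?k"
      using path_index_unique[OF \<Gamma> _ k(1) path_index_single_chart[OF \<Gamma> \<tau>]] ab by simp
    then show ?thesis using path_index_regular[OF reg ab k(2)] by simp
  qed
  obtain \<Delta> where "regular_path \<Delta> vertical a b" "?hom \<Delta>"
    using exists_homotopic_regular_path[OF \<Gamma> \<tau> ab] by blast
  then show ?thesis
    unfolding maslov_index_def using index by (intro the_equality) auto
qed

section \<open>Linear ordinary differential equations on a compact interval\<close>

text \<open>
  The Picard iteration for \<open>z x = exp (- K x) Y x\<close> is a contraction of the bounded continuous
  functions on the whole interval once \<open>K\<close> exceeds the Lipschitz constant, so that no continuation
  argument is needed.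
\<close>

lemma lipschitz_ode_exists:
  fixes f :: "real \<Rightarrow> 'e::euclidean_space \<Rightarrow> 'e"
  assumes l: "0 < l" and L: "0 \<le> L" "\<And>x y z. x \<in> {0..l} \<Longrightarrow> norm (f x y - f x z) \<le> L * norm (y - z)"
    and cont: "\<And>Y. continuous_on {0..l} Y \<Longrightarrow> continuous_on {0..l} (\<lambda>x. f x (Y x))"
  shows "\<exists>Y. Y 0 = y0 \<and> (\<forall>x\<in>{0..l}. (Y has_vector_derivative f x (Y x)) (at x within {0..l}))"
proof -
  define K where "K = 2 * L + 1"
  have K: "0 < K" "L / K \<le> 1/2" using L(1) by (auto simp: K_def field_simps)
  define P where "P z x = exp (- (K * x)) *\<^sub>R (y0 + integral {0..x} (\<lambda>s. f s (exp (K * s) *\<^sub>R z s)))"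
    for z :: "real \<Rightarrow> 'e" and x
  have fc: "continuous_on {0..l} (\<lambda>s. f s (exp (K * s) *\<^sub>R z s))" if "continuous_on {0..l} z" for z
    by (intro cont continuous_intros that)
  have Pc: "continuous_on {0..l} (P z)" if "continuous_on {0..l} z" for z
    unfolding P_def using fc[OF that]
    by (intro continuous_intros indefinite_integral_continuous_1 integrable_continuous_real)
  have "\<exists>g. \<forall>x. apply_bcontfun g x = P (apply_bcontfun z) (clamp 0 l x)" for z :: "real \<Rightarrow>\<^sub>C 'e"
  proof -
    have "continuous_on (cbox 0 l) (P (apply_bcontfun z))"
      using Pc[of "apply_bcontfun z"] by simp
    then show ?thesis by (rule continuous_on_cbox_bcontfunE) blast
  qed
  then obtain T where T: "\<And>z x. apply_bcontfun (T z) x = P (apply_bcontfun z) (clamp 0 l x)" by metis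
  have "dist (T z) (T w) \<le> 1/2 * dist z w" for z w
  proof (rule dist_bound)
    fix x0
    define x where "x = clamp 0 l x0"
    have x: "0 \<le> x" "x \<le> l" using clamp_in_interval[of 0 l x0] l by (auto simp: x_def)
    let ?i = "\<lambda>z s. f s (exp (K * s) *\<^sub>R apply_bcontfun z s)"
    have int: "?i z integrable_on {0..x}" for z
      using x by (intro integrable_continuous_real continuous_on_subset[OF fc]) auto
    let ?B = "\<lambda>s. (L * dist z w) * exp (K * s)"
    have B: "(?B has_integral (L * dist z w) * exp (K * x) / K - (L * dist z w) * exp (K * 0) / K) {0..x}"
      using x K(1)
      by (intro fundamental_theorem_of_calculus)
        (auto intro!: derivative_eq_intros simp: has_real_derivative_iff_has_vector_derivative[symmetric])
    have "norm (integral {0..x} (?i z) - integral {0..x} (?i w)) = norm (integral {0..x} (\<lambda>s. ?i z s - ?i w s))"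
      by (simp add: Henstock_Kurzweil_Integration.integral_diff int)
    also have "\<dots> \<le> integral {0..x} ?B"
    proof (rule Henstock_Kurzweil_Integration.integral_norm_bound_integral)
      show "(\<lambda>s. ?i z s - ?i w s) integrable_on {0..x}" by (intro integrable_diff int)
      show "?B integrable_on {0..x}" using B by blast
      fix s assume s: "s \<in> {0..x}"
      have "norm (?i z s - ?i w s) \<le> L * norm (exp (K * s) *\<^sub>R apply_bcontfun z s - exp (K * s) *\<^sub>R apply_bcontfun w s)"
        using s x by (intro L(2)) auto
      also have "\<dots> = L * (exp (K * s) * dist (apply_bcontfun z s) (apply_bcontfun w s))"
        by (simp add: dist_norm flip: scaleR_diff_right)
      also have "\<dots> \<le> L * (exp (K * s) * dist z w)"
        using L(1) by (intro mult_left_mono dist_bounded) auto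
      finally show "norm (?i z s - ?i w s) \<le> ?B s" by (simp add: mult_ac)
    qed
    also have "\<dots> = (L / K * dist z w) * (exp (K * x) - 1)"
      using integral_unique[OF B] K(1) by (simp add: field_simps)
    also have "\<dots> \<le> (1/2 * dist z w) * exp (K * x)"
      using K x by (intro mult_mono mult_right_mono) auto
    finally have est: "norm (integral {0..x} (?i z) - integral {0..x} (?i w)) \<le> (1/2 * dist z w) * exp (K * x)" .
    have "dist (apply_bcontfun (T z) x0) (apply_bcontfun (T w) x0) =
        exp (- (K * x)) * norm (integral {0..x} (?i z) - integral {0..x} (?i w))"
      unfolding T x_def[symmetric] P_def dist_norm scaleR_diff_right[symmetric] norm_scaleR
      by simp
    also have "\<dots> \<le> exp (- (K * x)) * ((1/2 * dist z w) * exp (K * x))"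
      using est by (intro mult_left_mono) auto
    also have "\<dots> = 1/2 * dist z w" by (simp add: exp_minus field_simps)
    finally show "dist (apply_bcontfun (T z) x0) (apply_bcontfun (T w) x0) \<le> 1/2 * dist z w" .
  qed
  then obtain z where z: "T z = z" using banach_fix_type[of "1/2" T] by auto
  define i where "i s = f s (exp (K * s) *\<^sub>R apply_bcontfun z s)" for s
  define Y where "Y x = y0 + integral {0..x} i" for x
  have ic: "continuous_on {0..l} i" unfolding i_def by (rule fc) simp
  have iY: "i x = f x (Y x)" if x: "x \<in> {0..l}" for x
  proof -
    have "apply_bcontfun z x = P (apply_bcontfun z) x"
      using T[of z x] x by (simp add: z)
    then have "exp (K * x) *\<^sub>R apply_bcontfun z x = Y x"
      by (simp add: P_def Y_def i_def[abs_def] exp_minus)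
    then show ?thesis by (simp add: i_def)
  qed
  have "(Y has_vector_derivative f x (Y x)) (at x within {0..l})" if x: "x \<in> {0..l}" for x
  proof -
    have "((\<lambda>x. integral {0..x} i) has_vector_derivative i x) (at x within {0..l})"
      using x by (intro integral_has_vector_derivative ic)
    then have "((\<lambda>x. y0 + integral {0..x} i) has_vector_derivative 0 + i x) (at x within {0..l})"
      by (intro has_vector_derivative_add has_vector_derivative_const)
    then show ?thesis using iY[OF x] by (simp add: Y_def[abs_def])
  qed
  moreover have "Y 0 = y0" by (simp add: Y_def)
  ultimately show ?thesis by blast
qed

text \<open>
  Gronwall's inequality for \<open>\<bar>Z\<bar>\<^sup>2\<close>: the function \<open>exp (- K x) \<bar>Z x\<bar>\<^sup>2 - C x\<close> is nonincreasing.
\<close>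

lemma energy_estimate:
  fixes Z Z' :: "real \<Rightarrow> 'e::euclidean_space"
  assumes der: "\<And>x. x \<in> {0..l} \<Longrightarrow> (Z has_vector_derivative Z' x) (at x within {0..l})"
    and le: "\<And>x. x \<in> {0..l} \<Longrightarrow> 2 * (Z x \<bullet> Z' x) \<le> K * (norm (Z x))\<^sup>2 + C"
    and KC: "0 \<le> K" "0 \<le> C" and x: "x \<in> {0..l}"
  shows "(norm (Z x))\<^sup>2 \<le> ((norm (Z 0))\<^sup>2 + C * x) * exp (K * x)"
proof (cases "x = 0")
  case False
  then have x0: "0 < x" using x by auto
  define \<phi> where "\<phi> s = (Z s \<bullet> Z s) * exp (- (K * s)) - C * s" for s
  define \<phi>' where "\<phi>' s = (Z s \<bullet> Z' s + Z' s \<bullet> Z s) * exp (- (K * s)) + (Z s \<bullet> Z s) * (exp (- (K * s)) * (- K)) - C" for s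
  have "\<exists>s\<in>{0<..<x}. \<phi> x - \<phi> 0 = (\<lambda>h. h * \<phi>' s) (x - 0)"
  proof (rule mvt_simple[OF x0])
    fix s assume s: "0 \<le> s" "s \<le> x"
    then have sl: "s \<in> {0..l}" using x by auto
    have dZ: "(Z has_vector_derivative Z' s) (at s within {0..x})"
      using has_vector_derivative_within_subset[OF der[OF sl]] x by auto
    have "((\<lambda>s. Z s \<bullet> Z s) has_vector_derivative Z s \<bullet> Z' s + Z' s \<bullet> Z s) (at s within {0..x})"
      by (rule bounded_bilinear.has_vector_derivative[OF bounded_bilinear_inner dZ dZ])
    then have d1: "((\<lambda>s. Z s \<bullet> Z s) has_real_derivative Z s \<bullet> Z' s + Z' s \<bullet> Z s) (at s within {0..x})"
      by (simp add: has_real_derivative_iff_has_vector_derivative)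
    have "(\<phi> has_real_derivative \<phi>' s) (at s within {0..x})"
      unfolding \<phi>_def[abs_def] \<phi>'_def by (rule derivative_eq_intros d1 refl)+ simp
    then show "(\<phi> has_derivative (\<lambda>h. h * \<phi>' s)) (at s within {0..x})"
      by (simp add: has_field_derivative_def mult_commute_abs)
  qed
  then obtain s where s: "0 < s" "s < x" "\<phi> x - \<phi> 0 = x * \<phi>' s" by auto
  then have sl: "s \<in> {0..l}" using x by auto
  have "\<phi>' s = (2 * (Z s \<bullet> Z' s) - K * (norm (Z s))\<^sup>2) * exp (- (K * s)) - C"
    by (simp add: \<phi>'_def inner_commute power2_norm_eq_inner algebra_simps)
  also have "\<dots> \<le> C * 1 - C"
    using le[OF sl] KC s by (intro diff_mono mult_mono) auto
  finally have "\<phi>' s \<le> 0" by simp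
  then have "\<phi> x \<le> \<phi> 0" using s x0 mult_nonneg_nonpos[of x "\<phi>' s"] by linarith
  then have "(norm (Z x))\<^sup>2 * exp (- (K * x)) \<le> (norm (Z 0))\<^sup>2 + C * x"
    by (simp add: \<phi>_def power2_norm_eq_inner)
  then show ?thesis by (simp add: exp_minus field_simps)
qed simp

section \<open>The first order system\<close>

text \<open>
  The equation \<open>N (u, v) = c (u, v) + (f1, f2)\<close>, where \<open>F = (f1, f2)\<close>, as a first order system for
  \<open>Y = ((u, u'), (v, v'))\<close>.
\<close>

type_synonym state = "(real \<times> real) \<times> (real \<times> real)"

definition field ::
    "(real \<Rightarrow> real) \<Rightarrow> (real \<Rightarrow> real) \<Rightarrow> real \<Rightarrow> (real \<Rightarrow> real \<times> real) \<Rightarrow> real \<Rightarrow> state \<Rightarrow> state" where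
  "field g h c F x y =
    ((snd (fst y), - (g x * fst (fst y)) - c * fst (snd y) - snd (F x)),
     (snd (snd y), c * fst (fst y) + fst (F x) - h x * fst (snd y)))"

definition solves ::
    "real \<Rightarrow> (real \<Rightarrow> real) \<Rightarrow> (real \<Rightarrow> real) \<Rightarrow> real \<Rightarrow> (real \<Rightarrow> real \<times> real) \<Rightarrow> (real \<Rightarrow> state) \<Rightarrow> bool" where
  "solves l g h c F Y \<longleftrightarrow>
    (\<forall>x\<in>{0..l}. (Y has_vector_derivative field g h c F x (Y x)) (at x within {0..l}))"

definition position :: "(real \<Rightarrow> state) \<Rightarrow> real \<Rightarrow> real \<times> real" where
  "position Y x = (fst (fst (Y x)), fst (snd (Y x)))"

lemma solves_continuous: "solves l g h c F Y \<Longrightarrow> continuous_on {0..l} Y"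
  unfolding solves_def continuous_on_eq_continuous_within
  using has_vector_derivative_continuous by blast

lemma solves_position_continuous: "solves l g h c F Y \<Longrightarrow> continuous_on {0..l} (position Y)"
  unfolding position_def[abs_def] by (intro continuous_intros solves_continuous)

lemma solves_linear:
  assumes "solves l g h c F Y" "solves l g h c G Z"
  shows "solves l g h c (\<lambda>x. F x + a *\<^sub>R G x) (\<lambda>x. Y x + a *\<^sub>R Z x)"
  unfolding solves_def
proof
  fix x assume x: "x \<in> {0..l}"
  have "((\<lambda>x. Y x + a *\<^sub>R Z x) has_vector_derivative field g h c F x (Y x) + a *\<^sub>R field g h c G x (Z x))
      (at x within {0..l})"
    using assms x unfolding solves_def
    by (intro has_vector_derivative_add bounded_linear.has_vector_derivative[OF bounded_linear_scaleR_right]) auto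
  moreover have "field g h c F x (Y x) + a *\<^sub>R field g h c G x (Z x) =
      field g h c (\<lambda>x. F x + a *\<^sub>R G x) x (Y x + a *\<^sub>R Z x)"
    by (simp add: field_def algebra_simps)
  ultimately show "((\<lambda>x. Y x + a *\<^sub>R Z x) has_vector_derivative
      field g h c (\<lambda>x. F x + a *\<^sub>R G x) x (Y x + a *\<^sub>R Z x)) (at x within {0..l})" by simp
qed

lemma solves_change_parameter:
  assumes "solves l g h c F Y"
  shows "solves l g h c' (\<lambda>x. F x + (c - c') *\<^sub>R position Y x) Y"
proof -
  have "field g h c' (\<lambda>x. F x + (c - c') *\<^sub>R position Y x) x (Y x) = field g h c F x (Y x)" for x
    by (simp add: field_def position_def algebra_simps)
  then show ?thesis using assms by (simp add: solves_def)
qed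

lemma solves_cong:
  "solves l g h c F Y \<Longrightarrow> (\<And>x. x \<in> {0..l} \<Longrightarrow> F x = G x) \<Longrightarrow> solves l g h c G Y"
  by (simp add: solves_def field_def)

lemma state_components_derivative:
  fixes W :: "real \<Rightarrow> state"
  assumes "(W has_vector_derivative D) F"
  shows "((\<lambda>s. fst (fst (W s))) has_real_derivative fst (fst D)) F"
    "((\<lambda>s. snd (fst (W s))) has_real_derivative snd (fst D)) F"
    "((\<lambda>s. fst (snd (W s))) has_real_derivative fst (snd D)) F"
    "((\<lambda>s. snd (snd (W s))) has_real_derivative snd (snd D)) F"
  unfolding has_real_derivative_iff_has_vector_derivative
  by (rule bounded_linear.has_vector_derivative[OF bounded_linear_compose[OF bounded_linear_fst bounded_linear_fst] assms]
      bounded_linear.has_vector_derivative[OF bounded_linear_compose[OF bounded_linear_snd bounded_linear_fst] assms]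
      bounded_linear.has_vector_derivative[OF bounded_linear_compose[OF bounded_linear_fst bounded_linear_snd] assms]
      bounded_linear.has_vector_derivative[OF bounded_linear_compose[OF bounded_linear_snd bounded_linear_snd] assms])+

lemma product_le_norm_sq:
  fixes y :: state
  assumes "s \<in> {fst (fst y), snd (fst y), fst (snd y), snd (snd y)}"
    and "t \<in> {fst (fst y), snd (fst y), fst (snd y), snd (snd y)}"
  shows "\<bar>s * t\<bar> \<le> (norm y)\<^sup>2"
proof -
  have n: "(norm y)\<^sup>2 = (fst (fst y))\<^sup>2 + (snd (fst y))\<^sup>2 + ((fst (snd y))\<^sup>2 + (snd (snd y))\<^sup>2)"
    by (cases y) (auto simp: norm_Pair real_sqrt_pow2)
  have "s\<^sup>2 \<le> (norm y)\<^sup>2" "t\<^sup>2 \<le> (norm y)\<^sup>2"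
    using assms unfolding n by auto
  moreover have "2 * \<bar>s * t\<bar> \<le> s\<^sup>2 + t\<^sup>2"
    using sum_squares_bound[of "\<bar>s\<bar>" "\<bar>t\<bar>"] by (simp add: abs_mult)
  ultimately show ?thesis by linarith
qed

lemma field_energy:
  assumes "\<bar>g x\<bar> \<le> B" "\<bar>h x\<bar> \<le> B" "(norm (F x))\<^sup>2 \<le> C"
  shows "2 * (y \<bullet> field g h c F x y) \<le> (2 * (2 + 2 * B + 2 * \<bar>c\<bar>) + 1) * (norm y)\<^sup>2 + C"
proof -
  obtain u p v r where y: "y = ((u, p), (v, r))" by (metis prod.collapse)
  obtain f1 f2 where F: "F x = (f1, f2)" by (metis prod.collapse)
  let ?n = "(norm y)\<^sup>2"
  have pr: "\<bar>s * t\<bar> \<le> ?n" if "s \<in> {u, p, v, r}" "t \<in> {u, p, v, r}" for s t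
    using product_le_norm_sq[of s y t] that by (simp add: y)
  have le: "\<bar>k * (s * t)\<bar> \<le> A * ?n" if "s \<in> {u, p, v, r}" "t \<in> {u, p, v, r}" "\<bar>k\<bar> \<le> A" for s t k A
    unfolding abs_mult[of k] using that pr by (intro mult_mono) auto
  have n: "?n = u\<^sup>2 + p\<^sup>2 + (v\<^sup>2 + r\<^sup>2)" by (simp add: y norm_Pair)
  have nF: "f1\<^sup>2 + f2\<^sup>2 \<le> C" using assms(3) by (simp add: F norm_Pair)
  have "y \<bullet> field g h c F x y = u * p - g x * (p * u) - c * (p * v) + v * r + c * (r * u) - h x * (r * v)
      + (r * f1 - p * f2)"
    by (simp add: y F field_def algebra_simps)
  moreover have "u * p \<le> ?n" "v * r \<le> ?n" using pr[of u p] pr[of v r] by auto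
  moreover have "- (g x * (p * u)) \<le> B * ?n" "- (h x * (r * v)) \<le> B * ?n"
    "- (c * (p * v)) \<le> \<bar>c\<bar> * ?n" "c * (r * u) \<le> \<bar>c\<bar> * ?n"
    using le[of p u "g x" B] le[of r v "h x" B] le[of p v c "\<bar>c\<bar>"] le[of r u c "\<bar>c\<bar>"] assms
    by (auto simp: abs_le_iff)
  ultimately have main: "y \<bullet> field g h c F x y \<le> 2 * ?n + 2 * (B * ?n) + 2 * (\<bar>c\<bar> * ?n) + (r * f1 - p * f2)"
    by linarith
  have "2 * (r * f1) \<le> r\<^sup>2 + f1\<^sup>2" using sum_squares_bound[of r f1] by simp
  moreover have "- (2 * (p * f2)) \<le> p\<^sup>2 + f2\<^sup>2" using sum_squares_bound[of p "- f2"] by simp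
  ultimately have "2 * (r * f1 - p * f2) \<le> ?n + C"
    using n nF zero_le_power2[of u] zero_le_power2[of v] unfolding right_diff_distrib by linarith
  moreover have "2 * e \<le> 4 * n + 4 * b + 4 * k + n + C" if "e \<le> 2 * n + 2 * b + 2 * k + d" "2 * d \<le> n + C"
    for e n b k d :: real using that by linarith
  ultimately have "2 * (y \<bullet> field g h c F x y) \<le> 4 * ?n + 4 * (B * ?n) + 4 * (\<bar>c\<bar> * ?n) + ?n + C"
    using main by blast
  also have "\<dots> = (2 * (2 + 2 * B + 2 * \<bar>c\<bar>) + 1) * ?n + C" by (simp add: algebra_simps)
  finally show ?thesis .
qed

lemma solves_bound:
  assumes Y: "solves l g h c F Y"
    and B: "\<And>x. x \<in> {0..l} \<Longrightarrow> \<bar>g x\<bar> \<le> B" "\<And>x. x \<in> {0..l} \<Longrightarrow> \<bar>h x\<bar> \<le> B" "0 \<le> B"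
    and F: "\<And>x. x \<in> {0..l} \<Longrightarrow> (norm (F x))\<^sup>2 \<le> C" "0 \<le> C" and c: "\<bar>c\<bar> \<le> A" and x: "x \<in> {0..l}"
  shows "(norm (Y x))\<^sup>2 \<le> ((norm (Y 0))\<^sup>2 + C * l) * exp ((2 * (2 + 2 * B + 2 * A) + 1) * l)"
proof -
  let ?K = "2 * (2 + 2 * B + 2 * A) + 1"
  have A: "0 \<le> A" using c by linarith
  have "(norm (Y x))\<^sup>2 \<le> ((norm (Y 0))\<^sup>2 + C * x) * exp (?K * x)"
  proof (rule energy_estimate)
    fix x assume x: "x \<in> {0..l}"
    show "(Y has_vector_derivative field g h c F x (Y x)) (at x within {0..l})"
      using Y x by (simp add: solves_def)
    have "2 * (Y x \<bullet> field g h c F x (Y x)) \<le> (2 * (2 + 2 * B + 2 * \<bar>c\<bar>) + 1) * (norm (Y x))\<^sup>2 + C"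
      by (intro field_energy B F x)
    also have "\<dots> \<le> ?K * (norm (Y x))\<^sup>2 + C"
      using c by (intro add_mono mult_right_mono) auto
    finally show "2 * (Y x \<bullet> field g h c F x (Y x)) \<le> ?K * (norm (Y x))\<^sup>2 + C" .
  qed (use A B F x in auto)
  also have "\<dots> \<le> ((norm (Y 0))\<^sup>2 + C * l) * exp (?K * l)"
    using A B F x by (intro mult_mono add_mono) (auto intro: mult_left_mono mult_nonneg_nonneg)
  finally show ?thesis .
qed


locale nls_system =
  fixes l :: real and g h :: "real \<Rightarrow> real"
  assumes l: "0 < l" and g: "continuous_on {0..l} g" and h: "continuous_on {0..l} h"
begin

abbreviation sol where "sol \<equiv> solves l g h"

lemma coefficients_bounded: "\<exists>B\<ge>0. \<forall>x\<in>{0..l}. \<bar>g x\<bar> \<le> B \<and> \<bar>h x\<bar> \<le> B"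
proof -
  have "bounded (g ` {0..l})" "bounded (h ` {0..l})"
    using compact_continuous_image[OF g] compact_continuous_image[OF h] compact_imp_bounded by auto
  then obtain A B where "\<forall>x\<in>{0..l}. \<bar>g x\<bar> \<le> A" "\<forall>x\<in>{0..l}. \<bar>h x\<bar> \<le> B"
    unfolding bounded_iff by auto
  then show ?thesis by (intro exI[of _ "max 0 (max A B)"]) (auto simp: le_max_iff_disj)
qed

lemma sol_exists:
  assumes F: "continuous_on {0..l} F"
  shows "\<exists>Y. Y 0 = y0 \<and> sol c F Y"
proof -
  obtain B where B: "0 \<le> B" "\<And>x. x \<in> {0..l} \<Longrightarrow> \<bar>g x\<bar> \<le> B" "\<And>x. x \<in> {0..l} \<Longrightarrow> \<bar>h x\<bar> \<le> B"
    using coefficients_bounded by blast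
  have "\<exists>Y. Y 0 = y0 \<and> (\<forall>x\<in>{0..l}. (Y has_vector_derivative field g h c F x (Y x)) (at x within {0..l}))"
  proof (rule lipschitz_ode_exists[OF l])
    show "0 \<le> 2 + 2 * B + 2 * \<bar>c\<bar>" using B(1) by simp
    fix x and y z :: state
    assume x: "x \<in> {0..l}"
    obtain u p v r where yz: "y - z = ((u, p), (v, r))" by (metis prod.collapse)
    have comp: "u = fst (fst y) - fst (fst z)" "p = snd (fst y) - snd (fst z)"
        "v = fst (snd y) - fst (snd z)" "r = snd (snd y) - snd (snd z)"
      using yz by (auto simp: prod_eq_iff)
    have n: "\<bar>u\<bar> \<le> norm (y - z)" "\<bar>p\<bar> \<le> norm (y - z)" "\<bar>v\<bar> \<le> norm (y - z)" "\<bar>r\<bar> \<le> norm (y - z)"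
      using norm_fst_le[of "(u, p)" "(v, r)"] norm_snd_le[of "(v, r)" "(u, p)"]
        norm_fst_le[of u p] norm_snd_le[of p u] norm_fst_le[of v r] norm_snd_le[of r v]
      unfolding yz by auto
    have "field g h c F x y - field g h c F x z = ((p, - (g x * u) - c * v), (r, c * u - h x * v))"
      by (simp add: field_def comp algebra_simps)
    then have "norm (field g h c F x y - field g h c F x z) \<le>
        norm (p, - (g x * u) - c * v) + norm (r, c * u - h x * v)"
      using norm_Pair_le by metis
    also have "\<dots> \<le> (\<bar>p\<bar> + \<bar>- (g x * u) - c * v\<bar>) + (\<bar>r\<bar> + \<bar>c * u - h x * v\<bar>)"
      using norm_Pair_le[of p "- (g x * u) - c * v"] norm_Pair_le[of r "c * u - h x * v"]
      by (intro add_mono) (auto simp: real_norm_def)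
    also have "\<dots> \<le> (\<bar>p\<bar> + (\<bar>g x\<bar> * \<bar>u\<bar> + \<bar>c\<bar> * \<bar>v\<bar>)) + (\<bar>r\<bar> + (\<bar>c\<bar> * \<bar>u\<bar> + \<bar>h x\<bar> * \<bar>v\<bar>))"
      unfolding abs_mult[symmetric] by linarith
    also have "\<dots> \<le> (norm (y - z) + (B * norm (y - z) + \<bar>c\<bar> * norm (y - z))) +
        (norm (y - z) + (\<bar>c\<bar> * norm (y - z) + B * norm (y - z)))"
      using n B(1) B(2,3)[OF x] by (intro add_mono mult_mono) auto
    also have "\<dots> = (2 + 2 * B + 2 * \<bar>c\<bar>) * norm (y - z)" by (simp add: algebra_simps)
    finally show "norm (field g h c F x y - field g h c F x z) \<le> (2 + 2 * B + 2 * \<bar>c\<bar>) * norm (y - z)" .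
  next
    show "continuous_on {0..l} (\<lambda>x. field g h c F x (Y x))" if "continuous_on {0..l} Y" for Y :: "real \<Rightarrow> state"
      unfolding field_def by (intro continuous_intros g h F that)
  qed
  then show ?thesis by (simp add: solves_def)
qed

text \<open>
  The bound is uniform for the parameters \<open>c\<close> in a bounded interval, so that it can be used along
  limits of \<open>c\<close>.
\<close>

definition growth_bound :: "real \<Rightarrow> real \<Rightarrow> bool" where
  "growth_bound A E \<longleftrightarrow> 0 < E \<and> (\<forall>c F Y C x. \<bar>c\<bar> \<le> A \<longrightarrow> sol c F Y \<longrightarrow> 0 \<le> C \<longrightarrow>
    (\<forall>x\<in>{0..l}. norm (F x) \<le> C) \<longrightarrow> x \<in> {0..l} \<longrightarrow> norm (Y x) \<le> E * (norm (Y 0) + C))"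

lemma growth_boundD:
  assumes "growth_bound A E" "\<bar>c\<bar> \<le> A" "sol c F Y" "0 \<le> C" "\<And>x. x \<in> {0..l} \<Longrightarrow> norm (F x) \<le> C" "x \<in> {0..l}"
  shows "norm (Y x) \<le> E * (norm (Y 0) + C)"
  using assms(1)[unfolded growth_bound_def, THEN conjunct2, rule_format, of c F Y C x] assms(2-) by simp

lemma growth_bound_exists:
  assumes A: "0 \<le> A"
  shows "\<exists>E. growth_bound A E"
proof -
  obtain B where B: "0 \<le> B" "\<And>x. x \<in> {0..l} \<Longrightarrow> \<bar>g x\<bar> \<le> B" "\<And>x. x \<in> {0..l} \<Longrightarrow> \<bar>h x\<bar> \<le> B"
    using coefficients_bounded by blast
  define e where "e = exp ((2 * (2 + 2 * B + 2 * A) + 1) * l)"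
  define E where "E = sqrt ((1 + l) * e)"
  have E: "0 < E" "E\<^sup>2 = (1 + l) * e" using l by (auto simp: E_def e_def)
  have "norm (Y x) \<le> E * (norm (Y 0) + C)"
    if c: "\<bar>c\<bar> \<le> A" and Y: "sol c F Y" and C: "0 \<le> C" "\<forall>x\<in>{0..l}. norm (F x) \<le> C" and x: "x \<in> {0..l}" for c F Y C x
  proof -
    have F: "(norm (F x))\<^sup>2 \<le> C\<^sup>2" if "x \<in> {0..l}" for x using C that by (intro power_mono) auto
    have "(norm (Y x))\<^sup>2 \<le> ((norm (Y 0))\<^sup>2 + C\<^sup>2 * l) * e"
      unfolding e_def by (rule solves_bound[OF Y B(2,3,1) F _ c x]) auto
    also have "\<dots> \<le> ((norm (Y 0) + C)\<^sup>2 * (1 + l)) * e"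
    proof (rule mult_right_mono)
      have "(norm (Y 0))\<^sup>2 \<le> (norm (Y 0) + C)\<^sup>2" "C\<^sup>2 \<le> (norm (Y 0) + C)\<^sup>2"
        using C(1) by (auto intro!: power_mono)
      then have "(norm (Y 0))\<^sup>2 + C\<^sup>2 * l \<le> (norm (Y 0) + C)\<^sup>2 + (norm (Y 0) + C)\<^sup>2 * l"
        using l by (intro add_mono mult_right_mono) auto
      then show "(norm (Y 0))\<^sup>2 + C\<^sup>2 * l \<le> (norm (Y 0) + C)\<^sup>2 * (1 + l)" by (simp add: algebra_simps)
    qed (simp add: e_def)
    also have "\<dots> = (E * (norm (Y 0) + C))\<^sup>2" by (simp add: power_mult_distrib E(2))
    finally show ?thesis by (rule power2_le_imp_le) (use E(1) C(1) in simp)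
  qed
  note main = this
  show ?thesis
  proof (rule exI[of _ E], unfold growth_bound_def, rule conjI[OF E(1)], intro allI impI)
    fix c F Y C x
    assume "\<bar>c\<bar> \<le> A" "sol c F Y" "0 \<le> C" "\<forall>x\<in>{0..l}. norm (F x) \<le> C" "x \<in> {0..l}"
    then show "norm (Y x) \<le> E * (norm (Y 0) + C)" by (rule main)
  qed
qed

lemma sol_unique:
  assumes "sol c F Y" "sol c F Z" "Y 0 = Z 0" "x \<in> {0..l}"
  shows "Y x = Z x"
proof -
  have "sol c (\<lambda>x. F x + (- 1) *\<^sub>R F x) (\<lambda>x. Y x + (- 1) *\<^sub>R Z x)"
    by (rule solves_linear) fact+
  note diff = this
  obtain E where E: "growth_bound \<bar>c\<bar> E" using growth_bound_exists[of "\<bar>c\<bar>"] by auto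
  have "norm (Y x + (- 1) *\<^sub>R Z x) \<le> E * (norm (Y 0 + (- 1) *\<^sub>R Z 0) + 0)"
    by (rule growth_boundD[OF E _ diff _ _ assms(4)]) auto
  then show ?thesis using assms(3) by simp
qed

definition flow :: "real \<Rightarrow> state \<Rightarrow> real \<Rightarrow> state" where
  "flow c y0 = (SOME Y. Y 0 = y0 \<and> sol c (\<lambda>x. 0) Y)"

lemma flow: "flow c y0 0 = y0" "sol c (\<lambda>x. 0) (flow c y0)"
  using someI_ex[OF sol_exists[of "\<lambda>x. 0" y0 c]] unfolding flow_def by auto

lemma flow_unique: "sol c (\<lambda>x. 0) Y \<Longrightarrow> x \<in> {0..l} \<Longrightarrow> Y x = flow c (Y 0) x"
  by (rule sol_unique[OF _ flow(2)]) (simp_all add: flow(1))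

lemma flow_linear:
  assumes x: "x \<in> {0..l}"
  shows "linear (\<lambda>y. flow c y x)"
proof (rule linearI)
  have comb: "flow c (y + a *\<^sub>R z) x = flow c y x + a *\<^sub>R flow c z x" for y z a
  proof -
    have "sol c (\<lambda>x. 0) (\<lambda>x. flow c y x + a *\<^sub>R flow c z x)"
      using solves_linear[OF flow(2)[of c y] flow(2)[of c z], of a] by simp
    from flow_unique[OF this x] show ?thesis by (simp add: flow(1))
  qed
  from comb[of _ 1] show "flow c (y + z) x = flow c y x + flow c z x" for y z by simp
  have "flow c 0 x = 0" using comb[of 0 1 0] by simp
  then show "flow c (a *\<^sub>R y) x = a *\<^sub>R flow c y x" for a y using comb[of 0 a y] by simp
qed

text \<open>
  The difference of two solutions with equal initial values solves the equation for one of the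
  parameters with a right-hand side proportional to \<open>c - c0\<close>.
\<close>

lemma flow_tendsto:
  assumes x: "x \<in> {0..l}"
  shows "((\<lambda>c. flow c y x) \<longlongrightarrow> flow c0 y x) (at c0 within S)"
proof -
  define F where "F = position (flow c0 y)"
  have "continuous_on {0..l} F" unfolding F_def by (rule solves_position_continuous[OF flow(2)])
  then have "bounded (F ` {0..l})" using compact_continuous_image compact_imp_bounded by blast
  then obtain C where C: "0 < C" "\<And>x. x \<in> {0..l} \<Longrightarrow> norm (F x) \<le> C"
    unfolding bounded_pos by auto
  obtain E where E: "growth_bound (\<bar>c0\<bar> + 1) E" using growth_bound_exists[of "\<bar>c0\<bar> + 1"] by auto
  have "((\<lambda>c. flow c y x - flow c0 y x) \<longlongrightarrow> 0) (at c0 within S)"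
  proof (rule Lim_null_comparison)
    have "\<forall>\<^sub>F c in at c0 within S. dist c c0 < 1"
      using eventually_at_ball[of 1 c0 S] by (auto simp: dist_commute elim: eventually_mono)
    then show "\<forall>\<^sub>F c in at c0 within S. norm (flow c y x - flow c0 y x) \<le> E * (\<bar>c - c0\<bar> * C)"
    proof eventually_elim
      case (elim c)
      then have c: "\<bar>c\<bar> \<le> \<bar>c0\<bar> + 1" by (simp add: dist_real_def)
      have "sol c (\<lambda>x. 0 + (c0 - c) *\<^sub>R F x) (flow c0 y)"
        unfolding F_def by (rule solves_change_parameter[OF flow(2)])
      from solves_linear[OF flow(2)[of c y] this, of "- 1"]
      have d: "sol c (\<lambda>x. (c - c0) *\<^sub>R F x) (\<lambda>x. flow c y x - flow c0 y x)"
        by (simp add: scaleR_left_diff_distrib)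
      have "norm (flow c y x - flow c0 y x) \<le> E * (norm (flow c y 0 - flow c0 y 0) + \<bar>c - c0\<bar> * C)"
      proof (rule growth_boundD[OF E c d _ _ x])
        show "norm ((c - c0) *\<^sub>R F x) \<le> \<bar>c - c0\<bar> * C" if "x \<in> {0..l}" for x
          using C(2)[OF that] by (simp add: mult_left_mono)
      qed (use C in simp)
      then show ?case by (simp add: flow(1))
    qed
    have "((\<lambda>c. E * (\<bar>c - c0\<bar> * C)) \<longlongrightarrow> E * (\<bar>c0 - c0\<bar> * C)) (at c0 within S)" by (intro tendsto_intros)
    then show "((\<lambda>c. E * (\<bar>c - c0\<bar> * C)) \<longlongrightarrow> 0) (at c0 within S)" by simp
  qed
  then show ?thesis by (simp add: LIM_zero_iff)
qed

subsection \<open>The trace of a solution\<close>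

definition state_trace :: "(real \<Rightarrow> state) \<Rightarrow> 4 phase" where
  "state_trace Y =
    (vector [fst (fst (Y 0)), fst (snd (Y 0)), fst (fst (Y l)), fst (snd (Y l))],
     vector [- snd (fst (Y 0)), snd (snd (Y 0)), snd (fst (Y l)), - snd (snd (Y l))])"

lemma vector_4:
  "(vector [a, b, c, d] :: 'a::zero^4) $ 1 = a" "(vector [a, b, c, d] :: 'a^4) $ 2 = b"
  "(vector [a, b, c, d] :: 'a^4) $ 3 = c" "(vector [a, b, c, d] :: 'a^4) $ 4 = d"
  unfolding vector_def by simp_all

lemma inner_vector_4: "(vector [a, b, c, d] :: real^4) \<bullet> vector [a', b', c', d'] = a * a' + b * b' + c * c' + d * d'"
  by (simp add: inner_vec_def sum_4 vector_4)

lemma state_trace_linear: "state_trace (\<lambda>x. Y x + a *\<^sub>R Z x) = state_trace Y + a *\<^sub>R state_trace Z"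
  by (simp add: state_trace_def vec_eq_iff forall_4 vector_4 algebra_simps)

lemma state_trace_norm: "norm (Y 0) \<le> norm (state_trace Y)"
proof -
  obtain u p v r where Y: "Y 0 = ((u, p), (v, r))" by (metis prod.collapse)
  have "(norm (Y 0))\<^sup>2 \<le> state_trace Y \<bullet> state_trace Y"
    by (simp add: state_trace_def inner_Pair inner_vector_4 Y norm_Pair power2_eq_square)
  then show ?thesis by (simp add: power2_norm_eq_inner[symmetric])
qed

lemma state_trace_norm_le: "norm (state_trace Y) \<le> norm (Y 0) + norm (Y l)"
proof -
  obtain u p v r where Y: "Y 0 = ((u, p), (v, r))" by (metis prod.collapse)
  obtain u' p' v' r' where Y': "Y l = ((u', p'), (v', r'))" by (metis prod.collapse)
  have "(norm (state_trace Y))\<^sup>2 = (norm (Y 0))\<^sup>2 + (norm (Y l))\<^sup>2"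
    unfolding power2_norm_eq_inner
    by (simp add: state_trace_def inner_Pair inner_vector_4 Y Y')
  also have "\<dots> \<le> (norm (Y 0) + norm (Y l))\<^sup>2" by (simp add: power2_sum)
  finally show ?thesis by (rule power2_le_imp_le) simp
qed

lemma state_trace_vertical:
  "state_trace Y \<in> vertical \<longleftrightarrow> position Y 0 = 0 \<and> position Y l = 0"
  by (auto simp: mem_vertical state_trace_def position_def vec_eq_iff forall_4 vector_4 zero_prod_def)

definition wronskian :: "(real \<Rightarrow> state) \<Rightarrow> (real \<Rightarrow> state) \<Rightarrow> real \<Rightarrow> real" where
  "wronskian Y Z x =
    (fst (fst (Y x)) * snd (fst (Z x)) - snd (fst (Y x)) * fst (fst (Z x))) -
    (fst (snd (Y x)) * snd (snd (Z x)) - snd (snd (Y x)) * fst (snd (Z x)))"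

lemma omega_state_trace: "omega (state_trace Y) (state_trace Z) = wronskian Y Z l - wronskian Y Z 0"
  by (simp add: omega_pair state_trace_def inner_vector_4 wronskian_def)

text \<open>The integrand of \<open>\<langle>a, S b\<rangle>\<close>.\<close>

definition crossed :: "real \<times> real \<Rightarrow> real \<times> real \<Rightarrow> real" where
  "crossed a b = fst a * snd b + snd a * fst b"

text \<open>
  Green's formula.  The terms with \<open>g\<close>, \<open>h\<close> and \<open>c\<close> cancel because \<open>S N\<close> is symmetric and \<open>c S\<close>
  is, too.
\<close>

lemma lagrange_identity:
  assumes Y: "sol c F Y" and Z: "sol c G Z"
  shows "((\<lambda>x. crossed (position Z x) (F x) - crossed (position Y x) (G x)) has_integral
    omega (state_trace Y) (state_trace Z)) {0..l}"
  unfolding omega_state_trace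
proof (rule fundamental_theorem_of_calculus)
  fix x assume x: "x \<in> {0..l}"
  have "(Y has_vector_derivative field g h c F x (Y x)) (at x within {0..l})"
    "(Z has_vector_derivative field g h c G x (Z x)) (at x within {0..l})"
    using Y Z x by (auto simp: solves_def)
  note d = this
  note d1 = state_components_derivative
  have "(wronskian Y Z has_real_derivative crossed (position Z x) (F x) - crossed (position Y x) (G x))
      (at x within {0..l})"
    unfolding wronskian_def[abs_def]
    by (rule derivative_eq_intros d1[OF d(1)] d1[OF d(2)] refl)+
      (simp add: field_def crossed_def position_def algebra_simps)
  then show "(wronskian Y Z has_vector_derivative crossed (position Z x) (F x) - crossed (position Y x) (G x))
      (at x within {0..l})"
    by (simp add: has_real_derivative_iff_has_vector_derivative)
qed (use l in simp)

end

section \<open>Weak and classical solutions\<close>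

text \<open>
  The half-lines form an intersection-stable generator of the Borel sets, so the integral of \<open>w\<close>
  vanishes over every Borel set.
\<close>

lemma AE_lborel_zero_of_indefinite_integral:
  fixes w :: "real \<Rightarrow> real"
  assumes w: "integrable lborel w" and zero: "\<And>x. (LINT t:{..x}|lborel. w t) = 0" "(LINT t|lborel. w t) = 0"
  shows "AE x in lborel. w x = 0"
proof -
  let ?G = "range (\<lambda>a::real. {..a})"
  have setint: "set_integrable lborel A w" if "A \<in> sets borel" for A
    unfolding set_integrable_def using w that by (intro integrable_mult_indicator) auto
  have sets: "sigma_sets UNIV ?G = sets (borel :: real measure)"
    by (subst borel_eq_atMost) simp
  have "(LINT t:A|lborel. w t) = 0" if A: "A \<in> sets borel" for A
  proof -
    have "Int_stable ?G" by (auto simp: Int_stable_def)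
    moreover have "?G \<subseteq> Pow UNIV" by simp
    moreover have "A \<in> sigma_sets UNIV ?G" using A sets by simp
    ultimately show ?thesis
    proof (induction rule: sigma_sets_induct_disjoint)
      case (basic A)
      then show ?case using zero(1) by auto
    next
      case empty
      then show ?case by (simp add: set_lebesgue_integral_def)
    next
      case (compl A)
      then have A: "A \<in> sets borel" using sets by simp
      have "(LINT t:A \<union> (UNIV - A)|lborel. w t) = (LINT t:A|lborel. w t) + (LINT t:UNIV - A|lborel. w t)"
        using A by (intro set_integral_Un setint) auto
      moreover have "(LINT t:A \<union> (UNIV - A)|lborel. w t) = 0"
        using zero(2) by (simp add: set_lebesgue_integral_def)
      ultimately show ?case using compl by simp
    next
      case (union A)
      then have A: "\<And>i. A i \<in> sets borel" using sets by auto
      have "(LINT t:(\<Union>i. A i)|lborel. w t) = (\<Sum>i. (LINT t:(A i)|lborel. w t))"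
        using A union(1) by (intro lebesgue_integral_countable_add setint) (auto simp: disjoint_family_on_def)
      then show ?case using union by simp
    qed
  qed
  then have "AE x in lborel. w x = (\<lambda>x. 0) x"
    by (intro density_unique_real w) (auto simp: set_lebesgue_integral_def)
  then show ?thesis by simp
qed

lemma AE_lebesgue_zero_of_indefinite_integral:
  fixes w :: "real \<Rightarrow> real"
  assumes w: "integrable lebesgue w" and zero: "\<And>x. (LINT t:{..x}|lebesgue. w t) = 0" "(LINT t|lebesgue. w t) = 0"
  shows "AE x in lebesgue. w x = 0"
proof -
  have "w \<in> borel_measurable lebesgue" using w by auto
  then obtain w0 where w0: "w0 \<in> borel_measurable lborel" "AE x in lborel. w x = w0 x"
    using completion_ex_borel_measurable_real by blast
  have m: "w0 \<in> borel_measurable lebesgue" using w0(1) by (rule measurable_completion)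
  have AE: "AE x in lebesgue. w x = w0 x" using w0(2) by (rule AE_completion)
  have "integrable lebesgue w0"
    using integrable_cong_AE_imp[OF w m] AE by (auto simp: eq_commute)
  then have int: "integrable lborel w0" using integrable_completion[of w0 lborel] w0(1) by simp
  have val: "(LINT t:A|lborel. w0 t) = (LINT t:A|lebesgue. w t)" if A: "A \<in> sets borel" for A
  proof -
    have mA: "(\<lambda>t. indicator A t *\<^sub>R w0 t) \<in> borel_measurable lborel"
      using w0(1) A by (intro borel_measurable_scaleR borel_measurable_indicator) auto
    have "(LINT t:A|lborel. w0 t) = (LINT t:A|lebesgue. w0 t)"
      unfolding set_lebesgue_integral_def using integral_completion[OF mA] by simp
    also have "\<dots> = (LINT t:A|lebesgue. w t)"
      unfolding set_lebesgue_integral_def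
    proof (rule integral_cong_AE)
      show "(\<lambda>t. indicator A t *\<^sub>R w0 t) \<in> borel_measurable lebesgue" using mA by (rule measurable_completion)
      have "A \<in> sets lebesgue" using A by simp
      then show "(\<lambda>t. indicator A t *\<^sub>R w t) \<in> borel_measurable lebesgue"
        using w by (intro borel_measurable_scaleR borel_measurable_indicator) auto
      show "AE t in lebesgue. indicator A t *\<^sub>R w0 t = indicator A t *\<^sub>R w t" using AE by eventually_elim simp
    qed
    finally show ?thesis .
  qed
  have "AE x in lborel. w0 x = 0"
  proof (rule AE_lborel_zero_of_indefinite_integral[OF int])
    show "(LINT t:{..x}|lborel. w0 t) = 0" for x using val[of "{..x}"] zero(1) by simp
    show "(LINT t|lborel. w0 t) = 0" using val[of UNIV] zero(2) by (simp add: set_lebesgue_integral_def)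
  qed
  with w0(2) have "AE x in lborel. w x = 0" by eventually_elim simp
  then show ?thesis by (rule AE_completion)
qed

lemma L2_integrable:
  assumes "w \<in> L2 l"
  shows "integrable lebesgue (\<lambda>x. indicator {0..l} x *\<^sub>R w x)"
proof -
  have "finite_measure (lebesgue_on {0..l})" by (intro finite_measure_lebesgue_on) simp
  then have "integrable (lebesgue_on {0..l}) w"
    using assms finite_measure.square_integrable_imp_integrable unfolding L2_def by blast
  then show ?thesis by (subst (asm) integrable_restrict_space) auto
qed

lemma L2_integrable_interval:
  assumes "w \<in> L2 l" "x \<in> {0..l}"
  shows "integrable lebesgue (\<lambda>t. indicator {0..x} t *\<^sub>R w t)"
proof -
  have "integrable lebesgue (\<lambda>t. indicator {0..x} t *\<^sub>R (indicator {0..l} t *\<^sub>R w t))"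
    by (intro integrable_mult_indicator L2_integrable assms) simp
  moreover have "(\<lambda>t. indicator {0..x} t *\<^sub>R (indicator {0..l} t *\<^sub>R w t)) = (\<lambda>t. indicator {0..x} t *\<^sub>R w t)"
    using assms(2) by (auto simp: indicator_def fun_eq_iff)
  ultimately show ?thesis by (simp only:)
qed

lemma weak_second_derivD:
  assumes "weak_second_deriv l u w"
  shows "x \<in> {0..l} \<Longrightarrow> u differentiable (at x within {0..l})" "w \<in> L2 l"
    "x \<in> {0..l} \<Longrightarrow> dx l u x = dx l u 0 + (LINT t:{0..x}|lebesgue. w t)"
  using assms unfolding weak_second_deriv_def by blast+

text \<open>
  This makes \<open>dxx\<close> independent, up to a null set, of the choice in its definition.
\<close>

lemma weak_second_deriv_unique:
  assumes "weak_second_deriv l u w" "weak_second_deriv l u w'"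
  shows "AE x in lebesgue_on {0..l}. w x = w' x"
proof -
  note L = assms[THEN weak_second_derivD(2)]
  define v where "v t = indicator {0..l} t *\<^sub>R w t - indicator {0..l} t *\<^sub>R w' t" for t
  have v: "integrable lebesgue v"
    unfolding v_def by (intro Bochner_Integration.integrable_diff L2_integrable L)
  have part: "(LINT t|lebesgue. indicator {0..x} t *\<^sub>R w t - indicator {0..x} t *\<^sub>R w' t) = 0"
    if x: "x \<in> {0..l}" for x
  proof -
    have "(LINT t:{0..x}|lebesgue. w t) = (LINT t:{0..x}|lebesgue. w' t)"
      using weak_second_derivD(3)[OF assms(1) x] weak_second_derivD(3)[OF assms(2) x] by linarith
    then show ?thesis
      unfolding set_lebesgue_integral_def
      using Bochner_Integration.integral_diff[OF L2_integrable_interval[OF L(1) x] L2_integrable_interval[OF L(2) x]] by simp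
  qed
  have all: "(LINT t|lebesgue. indicator {..x} t *\<^sub>R v t) = 0" for x
  proof (cases "0 \<le> x \<and> 0 \<le> l")
    case True
    have "(LINT t|lebesgue. indicator {..x} t *\<^sub>R v t) =
        (LINT t|lebesgue. indicator {0..min x l} t *\<^sub>R w t - indicator {0..min x l} t *\<^sub>R w' t)"
      by (intro Bochner_Integration.integral_cong refl) (auto simp: v_def indicator_def)
    then show ?thesis using part[of "min x l"] True by simp
  next
    case False
    then have "(\<lambda>t. indicator {..x} t *\<^sub>R v t) = (\<lambda>t. 0)" by (auto simp: v_def indicator_def fun_eq_iff)
    then show ?thesis by (simp only: Bochner_Integration.integral_zero)
  qed
  have "AE x in lebesgue. v x = 0"
  proof (rule AE_lebesgue_zero_of_indefinite_integral[OF v])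
    show "(LINT t:{..x}|lebesgue. v t) = 0" for x unfolding set_lebesgue_integral_def by (rule all)
    have "(LINT t|lebesgue. indicator {..l} t *\<^sub>R v t) = (LINT t|lebesgue. v t)"
      by (intro Bochner_Integration.integral_cong refl) (auto simp: v_def indicator_def)
    then show "(LINT t|lebesgue. v t) = 0" using all[of l] by simp
  qed
  then have "AE x in lebesgue. x \<in> {0..l} \<longrightarrow> w x = w' x"
    by eventually_elim (auto simp: v_def)
  then show ?thesis by (subst AE_restrict_space_iff) auto
qed

lemma classical_imp_H2:
  assumes l: "0 < l"
    and u: "\<And>x. x \<in> {0..l} \<Longrightarrow> (u has_real_derivative p x) (at x within {0..l})"
    and p: "\<And>x. x \<in> {0..l} \<Longrightarrow> (p has_real_derivative q x) (at x within {0..l})"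
    and q: "continuous_on {0..l} q"
  shows "u \<in> H2 l" "\<And>x. x \<in> {0..l} \<Longrightarrow> dx l u x = p x"
    "AE x in lebesgue_on {0..l}. dxx l u x = q x"
proof -
  show d: "dx l u x = p x" if "x \<in> {0..l}" for x
    unfolding dx_def using u[OF that] that l
    by (intro vector_derivative_within_closed_interval)
      (auto simp: has_real_derivative_iff_has_vector_derivative)
  have "weak_second_deriv l u q"
    unfolding weak_second_deriv_def
  proof (intro conjI ballI)
    show "u differentiable at x within {0..l}" if "x \<in> {0..l}" for x
      using u[OF that] real_differentiable_def by blast
    have "integrable (lebesgue_on (cbox 0 l)) q"
      by (rule continuous_imp_integrable) (simp add: q)
    moreover have "integrable (lebesgue_on (cbox 0 l)) (\<lambda>x. (q x)\<^sup>2)"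
      by (rule continuous_imp_integrable) (simp add: q continuous_on_power)
    ultimately show "q \<in> L2 l" by (auto simp: L2_def)
    fix x assume x: "x \<in> {0..l}"
    have "(q has_integral p x - p 0) {0..x}"
    proof (rule fundamental_theorem_of_calculus)
      fix s assume "s \<in> {0..x}"
      then have "(p has_real_derivative q s) (at s within {0..l})" using x by (intro p) auto
      then have "(p has_real_derivative q s) (at s within {0..x})" by (rule DERIV_subset) (use x in auto)
      then show "(p has_vector_derivative q s) (at s within {0..x})"
        by (simp add: has_real_derivative_iff_has_vector_derivative)
    qed (use x in auto)
    moreover have "q absolutely_integrable_on {0..x}"
      using q x by (intro absolutely_integrable_continuous_real) (auto elim: continuous_on_subset)
    ultimately have "(LINT t:{0..x}|lebesgue. q t) = p x - p 0"
      using set_lebesgue_integral_eq_integral(2) integral_unique by metis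
    then show "dx l u x = dx l u 0 + (LINT t:{0..x}|lebesgue. q t)" using d x l by auto
  qed
  then show "u \<in> H2 l" "AE x in lebesgue_on {0..l}. dxx l u x = q x"
    using weak_second_deriv_unique someI[of "weak_second_deriv l u" q] unfolding H2_def dxx_def by blast+
qed

text \<open>
  A solution of the differential equation in \<open>H\<^sup>2\<close> has a second derivative that is almost
  everywhere equal to a continuous function, and is therefore a classical solution.
\<close>

lemma H2_imp_classical:
  assumes u: "u \<in> H2 l" and q: "AE x in lebesgue_on {0..l}. dxx l u x = q x" "continuous_on {0..l} q"
    and x: "x \<in> {0..l}"
  shows "(u has_real_derivative dx l u x) (at x within {0..l})"
    "(dx l u has_real_derivative q x) (at x within {0..l})"
proof -
  have weak: "weak_second_deriv l u (dxx l u)"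
    using u someI_ex[of "weak_second_deriv l u"] unfolding H2_def dxx_def by blast
  from weak_second_derivD(1)[OF this x] show "(u has_real_derivative dx l u x) (at x within {0..l})"
    unfolding dx_def using vector_derivative_works has_real_derivative_iff_has_vector_derivative by blast
  have AE: "AE t in lebesgue. t \<in> {0..l} \<longrightarrow> dxx l u t = q t"
    using q(1) by (subst (asm) AE_restrict_space_iff) auto
  note L = weak_second_derivD(2)[OF weak]
  have dx: "dx l u s = dx l u 0 + integral {0..s} q" if s: "s \<in> {0..l}" for s
  proof -
    have abs: "q absolutely_integrable_on {0..s}"
      using q(2) s by (intro absolutely_integrable_continuous_real) (auto elim: continuous_on_subset)
    have "(LINT t:{0..s}|lebesgue. dxx l u t) = (LINT t:{0..s}|lebesgue. q t)"
      unfolding set_lebesgue_integral_def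
    proof (rule integral_cong_AE)
      show "(\<lambda>t. indicator {0..s} t *\<^sub>R dxx l u t) \<in> borel_measurable lebesgue"
        using L2_integrable_interval[OF L s] by auto
      show "(\<lambda>t. indicator {0..s} t *\<^sub>R q t) \<in> borel_measurable lebesgue"
        using abs unfolding set_integrable_def by auto
      show "AE t in lebesgue. indicator {0..s} t *\<^sub>R dxx l u t = indicator {0..s} t *\<^sub>R q t"
        using AE by eventually_elim (use s in \<open>auto simp: indicator_def\<close>)
    qed
    also have "\<dots> = integral {0..s} q" by (rule set_lebesgue_integral_eq_integral(2)[OF abs])
    finally show ?thesis using weak_second_derivD(3)[OF weak s] by linarith
  qed
  have "((\<lambda>s. dx l u 0 + integral {0..s} q) has_vector_derivative 0 + q x) (at x within {0..l})"
    using x by (intro has_vector_derivative_add has_vector_derivative_const integral_has_vector_derivative q(2))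
  then have "(dx l u has_vector_derivative q x) (at x within {0..l})"
    using has_vector_derivative_transform[OF x dx] by simp
  then show "(dx l u has_real_derivative q x) (at x within {0..l})"
    by (simp add: has_real_derivative_iff_has_vector_derivative)
qed

context nls_system
begin

definition state :: "fun2 \<Rightarrow> real \<Rightarrow> state" where
  "state U x = ((fst U x, dx l (fst U) x), (snd U x, dx l (snd U) x))"

lemma Tr_state: "Tr l U = state_trace (state U)"
  by (simp add: Tr_def state_trace_def state_def Let_def)

lemma position_state: "position (state U) x = (fst U x, snd U x)"
  by (simp add: position_def state_def)

lemma H2_continuous: "u \<in> H2 l \<Longrightarrow> continuous_on {0..l} u"
  unfolding H2_def weak_second_deriv_def
  using differentiable_imp_continuous_within continuous_on_eq_continuous_within by blast

lemma state_sol: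
  assumes U: "U \<in> H2 l \<times> H2 l" and eq: "eq_ae l (N_expr l g h U) R"
    and R: "continuous_on {0..l} (fst R)" "continuous_on {0..l} (snd R)"
  shows "sol 0 (\<lambda>x. (fst R x, snd R x)) (state U)"
  unfolding solves_def
proof
  fix x assume x: "x \<in> {0..l}"
  have U2: "fst U \<in> H2 l" "snd U \<in> H2 l" using U by auto
  note cont = H2_continuous[OF U2(1)] H2_continuous[OF U2(2)]
  have AE: "AE x in lebesgue_on {0..l}. - schroedinger l h (snd U) x = fst R x \<and> schroedinger l g (fst U) x = snd R x"
    using eq by (simp add: eq_ae_def N_expr_def)
  have "AE x in lebesgue_on {0..l}. dxx l (fst U) x = - (g x * fst U x) - snd R x"
    using AE by eventually_elim (simp add: schroedinger_def)
  note u = H2_imp_classical[OF U2(1) this _ x]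
  have "AE x in lebesgue_on {0..l}. dxx l (snd U) x = fst R x - h x * snd U x"
    using AE by eventually_elim (simp add: schroedinger_def)
  note v = H2_imp_classical[OF U2(2) this _ x]
  have "continuous_on {0..l} (\<lambda>x. - (g x * fst U x) - snd R x)" "continuous_on {0..l} (\<lambda>x. fst R x - h x * snd U x)"
    by (intro continuous_intros g h cont R)+
  then show "(state U has_vector_derivative field g h 0 (\<lambda>x. (fst R x, snd R x)) x (state U x)) (at x within {0..l})"
    using u v unfolding state_def field_def has_real_derivative_iff_has_vector_derivative
    by (auto intro!: has_vector_derivative_Pair)
qed

text \<open>
  The classical solutions are weak ones.
\<close>

lemma sol_state:
  assumes Y: "sol 0 F Y" and F: "continuous_on {0..l} F"
  defines "U \<equiv> ((\<lambda>x. fst (fst (Y x))), (\<lambda>x. fst (snd (Y x))))"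
  shows "U \<in> H2 l \<times> H2 l" "eq_ae l (N_expr l g h U) (\<lambda>x. fst (F x), \<lambda>x. snd (F x))"
    "\<And>x. x \<in> {0..l} \<Longrightarrow> state U x = Y x"
proof -
  have d: "((\<lambda>s. fst (fst (Y s))) has_real_derivative snd (fst (Y x))) (at x within {0..l})"
    "((\<lambda>s. snd (fst (Y s))) has_real_derivative - (g x * fst (fst (Y x))) - snd (F x)) (at x within {0..l})"
    "((\<lambda>s. fst (snd (Y s))) has_real_derivative snd (snd (Y x))) (at x within {0..l})"
    "((\<lambda>s. snd (snd (Y s))) has_real_derivative fst (F x) - h x * fst (snd (Y x))) (at x within {0..l})"
    if "x \<in> {0..l}" for x
  proof -
    have "(Y has_vector_derivative field g h 0 F x (Y x)) (at x within {0..l})"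
      using Y that by (simp add: solves_def)
    note c = state_components_derivative[OF this]
    show "((\<lambda>s. fst (fst (Y s))) has_real_derivative snd (fst (Y x))) (at x within {0..l})"
      "((\<lambda>s. snd (fst (Y s))) has_real_derivative - (g x * fst (fst (Y x))) - snd (F x)) (at x within {0..l})"
      "((\<lambda>s. fst (snd (Y s))) has_real_derivative snd (snd (Y x))) (at x within {0..l})"
      "((\<lambda>s. snd (snd (Y s))) has_real_derivative fst (F x) - h x * fst (snd (Y x))) (at x within {0..l})"
      using c by (simp_all add: field_def)
  qed
  have cont: "continuous_on {0..l} (\<lambda>x. - (g x * fst (fst (Y x))) - snd (F x))"
    "continuous_on {0..l} (\<lambda>x. fst (F x) - h x * fst (snd (Y x)))"
    by (intro continuous_intros g h F solves_continuous[OF Y])+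
  have u: "fst U \<in> H2 l" "\<And>x. x \<in> {0..l} \<Longrightarrow> dx l (fst U) x = snd (fst (Y x))"
    "AE x in lebesgue_on {0..l}. dxx l (fst U) x = - (g x * fst (fst (Y x))) - snd (F x)"
    unfolding U_def fst_conv
    by (rule classical_imp_H2[OF l d(1) d(2) cont(1)]; assumption)+
  have v: "snd U \<in> H2 l" "\<And>x. x \<in> {0..l} \<Longrightarrow> dx l (snd U) x = snd (snd (Y x))"
    "AE x in lebesgue_on {0..l}. dxx l (snd U) x = fst (F x) - h x * fst (snd (Y x))"
    unfolding U_def snd_conv
    by (rule classical_imp_H2[OF l d(3) d(4) cont(2)]; assumption)+
  show "U \<in> H2 l \<times> H2 l" using u(1) v(1) by (simp add: mem_Times_iff)
  show "state U x = Y x" if "x \<in> {0..l}" for x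
    using u(2)[OF that] v(2)[OF that] by (simp add: state_def U_def)
  show "eq_ae l (N_expr l g h U) (\<lambda>x. fst (F x), \<lambda>x. snd (F x))"
    unfolding eq_ae_def N_expr_def schroedinger_def fst_conv snd_conv
    using u(3) v(3) by eventually_elim (simp add: U_def)
qed

lemma state_trace_cong: "Y 0 = Z 0 \<Longrightarrow> Y l = Z l \<Longrightarrow> state_trace Y = state_trace Z"
  by (simp add: state_trace_def)

definition trace_frame :: "real \<Rightarrow> state \<Rightarrow> 4 phase" where
  "trace_frame c y = state_trace (flow c y)"

lemma state_trace_sol: "sol c (\<lambda>x. 0) Y \<Longrightarrow> state_trace Y = trace_frame c (Y 0)"
  unfolding trace_frame_def using l by (intro state_trace_cong flow_unique) auto

text \<open>
  The path is the range of a frame, parametrized by the initial values \<open>(u, u', v, v')\<close> at \<open>0\<close>.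
\<close>

lemma Lambda_path_eq: "Lambda_path l g h c = range (trace_frame c)"
proof
  show "Lambda_path l g h c \<subseteq> range (trace_frame c)"
  proof
    fix q assume "q \<in> Lambda_path l g h c"
    then obtain U where U: "q = Tr l U" "U \<in> H2 l \<times> H2 l" "eq_ae l (N_expr l g h U) (scale_fun2 c U)"
      unfolding Lambda_path_def by blast
    have "continuous_on {0..l} (fst U)" "continuous_on {0..l} (snd U)"
      using U(2) H2_continuous by (auto simp: mem_Times_iff)
    then have "sol 0 (\<lambda>x. (fst (scale_fun2 c U) x, snd (scale_fun2 c U) x)) (state U)"
      by (intro state_sol U) (auto simp: scale_fun2_def intro!: continuous_intros)
    from solves_change_parameter[OF this, of c] have "sol c (\<lambda>x. 0) (state U)"
      by (rule solves_cong) (simp add: position_state scale_fun2_def zero_prod_def)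
    then show "q \<in> range (trace_frame c)" using state_trace_sol U(1) Tr_state by auto
  qed
  show "range (trace_frame c) \<subseteq> Lambda_path l g h c"
  proof
    fix q assume "q \<in> range (trace_frame c)"
    then obtain y where q: "q = state_trace (flow c y)" by (auto simp: trace_frame_def)
    let ?Y = "flow c y" and ?U = "((\<lambda>x. fst (fst (flow c y x))), (\<lambda>x. fst (snd (flow c y x))))"
    have Y: "sol 0 (\<lambda>x. 0 + (c - 0) *\<^sub>R position ?Y x) ?Y"
      by (rule solves_change_parameter[OF flow(2)])
    have "continuous_on {0..l} (\<lambda>x. 0 + (c - 0) *\<^sub>R position ?Y x)"
      by (intro continuous_intros solves_position_continuous[OF flow(2)])
    note s = sol_state[OF Y this]
    have "eq_ae l (N_expr l g h ?U) (scale_fun2 c ?U)"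
      using s(2) by (simp add: eq_ae_def position_def scale_fun2_def)
    moreover have "Tr l ?U = q"
      unfolding Tr_state q using s(3) l by (intro state_trace_cong) auto
    ultimately show "q \<in> Lambda_path l g h c" unfolding Lambda_path_def using s(1) by blast
  qed
qed

lemma linear_trace_frame: "linear (trace_frame c)"
proof (rule linearI)
  have comb: "trace_frame c (y + a *\<^sub>R z) = trace_frame c y + a *\<^sub>R trace_frame c z" for y z a
  proof -
    have fl: "flow c (y + a *\<^sub>R z) x = flow c y x + a *\<^sub>R flow c z x" if "x \<in> {0..l}" for x
      using linear_add[OF flow_linear[OF that, of c]] linear_scale[OF flow_linear[OF that, of c]] by simp
    have "state_trace (flow c (y + a *\<^sub>R z)) = state_trace (\<lambda>x. flow c y x + a *\<^sub>R flow c z x)"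
      using l by (intro state_trace_cong fl) auto
    then show ?thesis by (simp add: trace_frame_def state_trace_linear)
  qed
  from comb[of _ 1] show "trace_frame c (y + z) = trace_frame c y + trace_frame c z" for y z by simp
  have "trace_frame c 0 = 0" using comb[of 0 1 0] by simp
  then show "trace_frame c (a *\<^sub>R y) = a *\<^sub>R trace_frame c y" for a y using comb[of 0 a y] by simp
qed

lemma trace_frame_coercive: "1 * norm y \<le> norm (trace_frame c y)"
  using state_trace_norm[of "flow c y"] by (simp add: trace_frame_def flow(1))

lemma trace_frame_tendsto: "((\<lambda>c. trace_frame c y) \<longlongrightarrow> trace_frame c0 y) (at c0 within S)"
proof -
  have f0: "((\<lambda>c. flow c y 0) \<longlongrightarrow> flow c0 y 0) (at c0 within S)"
    and fl: "((\<lambda>c. flow c y l) \<longlongrightarrow> flow c0 y l) (at c0 within S)"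
    using flow_tendsto l by auto
  have vec: "((\<lambda>c. vector [f1 c, f2 c, f3 c, f4 c] :: real^4) \<longlongrightarrow> vector [a1, a2, a3, a4]) F"
    if "(f1 \<longlongrightarrow> a1) F" "(f2 \<longlongrightarrow> a2) F" "(f3 \<longlongrightarrow> a3) F" "(f4 \<longlongrightarrow> a4) F" for f1 f2 f3 f4 a1 a2 a3 a4 and F :: "real filter"
  proof (rule vec_tendstoI)
    have "\<forall>i. ((\<lambda>c. (vector [f1 c, f2 c, f3 c, f4 c] :: real^4) $ i) \<longlongrightarrow> (vector [a1, a2, a3, a4] :: real^4) $ i) F"
      unfolding forall_4 vector_4 using that by blast
    then show "((\<lambda>c. (vector [f1 c, f2 c, f3 c, f4 c] :: real^4) $ i) \<longlongrightarrow> (vector [a1, a2, a3, a4] :: real^4) $ i) F" for i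
      by blast
  qed
  show ?thesis
    unfolding trace_frame_def state_trace_def
    by (intro tendsto_Pair vec tendsto_minus tendsto_fst tendsto_snd f0 fl)
qed

text \<open>
  Two solutions of the same homogeneous equation have constant Wronskian, so the subspace is isotropic.
\<close>

lemma Lambda_lagrangian: "Lambda_path l g h c \<in> lagrangians"
proof -
  have "inj (trace_frame c)"
  proof (rule injI)
    fix y z assume "trace_frame c y = trace_frame c z"
    then have "trace_frame c (y - z) = 0" by (simp add: linear_diff[OF linear_trace_frame])
    then show "y = z" using trace_frame_coercive[of "y - z" c] by simp
  qed
  then have "dim (range (trace_frame c)) = dim (UNIV :: state set)"
    by (intro dim_image_eq[OF linear_trace_frame]) simp
  then have "dim (range (trace_frame c)) = CARD(4)" by (simp add: dim_UNIV)
  moreover have "omega (trace_frame c y) (trace_frame c z) = 0" for y z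
  proof -
    have "((\<lambda>x. 0) has_integral omega (trace_frame c y) (trace_frame c z)) {0..l}"
      using lagrange_identity[OF flow(2)[of c y] flow(2)[of c z]] by (simp add: crossed_def trace_frame_def)
    then show ?thesis using has_integral_unique has_integral_0 by blast
  qed
  ultimately show ?thesis
    using linear_subspace_image[OF linear_trace_frame subspace_UNIV]
    by (auto simp: Lambda_path_eq lagrangians_def)
qed

lemma Lambda_tendsto: "subspace_tendsto (Lambda_path l g h) (Lambda_path l g h c0) (at c0 within S)"
  unfolding Lambda_path_eq
proof (rule subspace_tendsto_frame)
  show "\<forall>\<^sub>F c in at c0 within S. \<forall>y. 1 * norm y \<le> norm (trace_frame c y)"
    by (intro always_eventually allI trace_frame_coercive)
qed (use linear_trace_frame trace_frame_tendsto in auto)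

lemma Lambda_continuous: "lag_continuous_on S (Lambda_path l g h)"
  using Lambda_lagrangian Lambda_tendsto
  unfolding lag_continuous_on_def subspace_tendsto_def continuous_on_def by blast

end

section \<open>The second order form\<close>

lemma vertical_lagrangian: "(vertical :: 'n::finite phase set) \<in> lagrangians"
proof -
  have "(vertical :: 'n phase set) = Pair 0 ` UNIV" by (auto simp: vertical_def)
  moreover have "dim (Pair 0 ` (UNIV :: (real^'n) set) :: 'n phase set) = dim (UNIV :: (real^'n) set)"
    by (intro dim_image_eq linearI) (auto simp: inj_on_def)
  ultimately have "dim (vertical :: 'n phase set) = CARD('n)" by (simp add: dim_UNIV)
  then show ?thesis
    using subspace_vertical by (auto simp: lagrangians_def omega_pair mem_vertical)
qed

text \<open>
  The annihilator of \<open>L \<inter> M\<close> is \<open>L + M\<close>: a vector \<open>z\<close> orthogonal to \<open>L + M\<close> is of the form \<open>J m\<close>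
  with \<open>m\<close> in the annihilators of both \<open>L\<close> and \<open>M\<close>, that is in \<open>L \<inter> M\<close>.
\<close>

lemma lagrangian_annihilator_Int:
  fixes L M :: "'n::finite phase set"
  assumes L: "L \<in> lagrangians" and M: "M \<in> lagrangians" and v: "\<And>m. m \<in> L \<inter> M \<Longrightarrow> omega m v = 0"
  shows "\<exists>a\<in>L. \<exists>b\<in>M. v = a + b"
proof -
  let ?S = "{a + b | a b. a \<in> L \<and> b \<in> M}"
  have S: "subspace ?S" using subspace_sums[OF lagrangianD(1)[OF L] lagrangianD(1)[OF M]] .
  have LS: "a \<in> ?S" if "a \<in> L" for a
    using that subspace_0[OF lagrangianD(1)[OF M]] by (intro CollectI exI[of _ a] exI[of _ 0] conjI) auto
  have MS: "b \<in> ?S" if "b \<in> M" for b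
    using that subspace_0[OF lagrangianD(1)[OF L]] by (intro CollectI exI[of _ 0] exI[of _ b] conjI) auto
  define z where "z = v - closest_point ?S v"
  define m where "m = (snd z, - fst z)"
  have om: "omega m y = z \<bullet> y" for y by (simp add: omega_def J_map_def m_def)
  have perp: "z \<bullet> y = 0" if "y \<in> ?S" for y unfolding z_def by (rule closest_point_orthogonal[OF S that])
  have "m \<in> L" using perp LS om omega_swap[of _ m] by (intro lagrangian_maximal[OF L]) auto
  moreover have "m \<in> M" using perp MS om omega_swap[of _ m] by (intro lagrangian_maximal[OF M]) auto
  ultimately have "z \<bullet> v = 0" using v[of m] om[of v] by simp
  moreover have "z \<bullet> closest_point ?S v = 0" by (rule perp[OF closest_point_in_subspace[OF S]])
  ultimately have "z \<bullet> z = 0" by (simp add: z_def inner_diff_right)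
  then have "v = closest_point ?S v" by (simp add: z_def)
  then have "v \<in> ?S" using closest_point_in_subspace[OF S, of v] by simp
  then show ?thesis by blast
qed

context nls_system
begin

text \<open>
  The form \<open>\<langle>a, S b\<rangle>\<close>.
\<close>

definition pairing :: "(real \<Rightarrow> real \<times> real) \<Rightarrow> (real \<Rightarrow> real \<times> real) \<Rightarrow> real" where
  "pairing a b = integral {0..l} (\<lambda>x. crossed (a x) (b x))"

lemma pairing_integrable:
  assumes "continuous_on {0..l} a" "continuous_on {0..l} b"
  shows "(\<lambda>x. crossed (a x) (b x)) integrable_on {0..l}"
  unfolding crossed_def using assms by (intro integrable_continuous_real continuous_intros)

lemma pairing_commute: "pairing a b = pairing b a"
  unfolding pairing_def crossed_def by (simp add: mult.commute add.commute)

lemma pairing_cong: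
  "(\<And>x. x \<in> {0..l} \<Longrightarrow> a x = a' x) \<Longrightarrow> (\<And>x. x \<in> {0..l} \<Longrightarrow> b x = b' x) \<Longrightarrow> pairing a b = pairing a' b'"
  unfolding pairing_def by (intro integral_cong) simp

lemma pairing_add_scale:
  assumes "continuous_on {0..l} a" "continuous_on {0..l} a'" "continuous_on {0..l} b"
  shows "pairing (\<lambda>x. a x + k *\<^sub>R a' x) b = pairing a b + k * pairing a' b"
proof -
  have "((\<lambda>x. crossed (a x) (b x) + k *\<^sub>R crossed (a' x) (b x)) has_integral pairing a b + k *\<^sub>R pairing a' b) {0..l}"
    unfolding pairing_def
    by (intro has_integral_add has_integral_cmul integrable_integral pairing_integrable assms)
  moreover have "crossed (a x) (b x) + k *\<^sub>R crossed (a' x) (b x) = crossed (a x + k *\<^sub>R a' x) (b x)" for x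
    by (simp add: crossed_def algebra_simps)
  ultimately show ?thesis unfolding pairing_def by (simp add: integral_unique)
qed

lemma inner_L2_pairing:
  assumes "continuous_on {0..l} (\<lambda>x. (fst U x, snd U x))" "continuous_on {0..l} (\<lambda>x. (fst V x, snd V x))"
  shows "inner_L2 l V (S_map U) = pairing (\<lambda>x. (fst V x, snd V x)) (\<lambda>x. (fst U x, snd U x))"
proof -
  have "continuous_on {0..l} (\<lambda>x. fst V x * snd U x + snd V x * fst U x)"
    using continuous_on_fst[OF assms(1)] continuous_on_snd[OF assms(1)]
      continuous_on_fst[OF assms(2)] continuous_on_snd[OF assms(2)]
    by (auto intro!: continuous_intros)
  from set_lebesgue_integral_eq_integral(2)[OF absolutely_integrable_continuous_real[OF this]]
  show ?thesis by (simp add: inner_L2_def S_map_def pairing_def crossed_def)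
qed

lemma omega_trace_pairing:
  assumes "sol c F Y" "sol c G Z" and "continuous_on {0..l} F" "continuous_on {0..l} G"
  shows "omega (state_trace Y) (state_trace Z) = pairing (position Z) F - pairing (position Y) G"
proof -
  have "((\<lambda>x. crossed (position Z x) (F x) - crossed (position Y x) (G x)) has_integral
      pairing (position Z) F - pairing (position Y) G) {0..l}"
    unfolding pairing_def using assms
    by (intro has_integral_diff integrable_integral pairing_integrable solves_position_continuous) auto
  then show ?thesis using lagrange_identity[OF assms(1,2)] has_integral_unique by blast
qed

text \<open>
  The space \<open>\<Lambda>(0,1) \<inter> \<D>\<close> consists of the traces of the kernel of \<open>N\<close>; below, \<open>mode q\<close> is the state of the
  unique kernel element with trace \<open>q\<close>, \<open>pos q\<close> that element itself.
\<close>

definition K :: "4 phase set" where "K = Lambda_path l g h 0 \<inter> vertical"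

lemma subspace_K: "subspace K"
  unfolding K_def by (intro subspace_inter subspace_vertical lagrangianD(1)[OF Lambda_lagrangian])

definition init :: "4 phase \<Rightarrow> state" where "init q = (SOME y. trace_frame 0 y = q)"

definition mode :: "4 phase \<Rightarrow> real \<Rightarrow> state" where "mode q = flow 0 (init q)"

lemma mode_sol: "sol 0 (\<lambda>x. 0) (mode q)"
  unfolding mode_def by (rule flow(2))

lemma mode_trace: "q \<in> K \<Longrightarrow> state_trace (mode q) = q"
  unfolding mode_def init_def trace_frame_def[symmetric] K_def Lambda_path_eq
  by (auto intro: someI)

lemma mode_unique:
  assumes "sol 0 (\<lambda>x. 0) Y" "state_trace Y \<in> K" "x \<in> {0..l}"
  shows "Y x = mode (state_trace Y) x"
proof -
  have "state_trace (\<lambda>x. Y x + (-1) *\<^sub>R mode (state_trace Y) x) = 0"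
    unfolding state_trace_linear using mode_trace[OF assms(2)] by simp
  then have "Y 0 = mode (state_trace Y) 0"
    using state_trace_norm[of "\<lambda>x. Y x + (-1) *\<^sub>R mode (state_trace Y) x"] by simp
  then show ?thesis by (rule sol_unique[OF assms(1) mode_sol _ assms(3)])
qed

abbreviation "pos q \<equiv> position (mode q)"

lemma pos_continuous: "continuous_on {0..l} (pos q)"
  by (rule solves_position_continuous[OF mode_sol])

lemma position_add_scale: "position (\<lambda>x. Y x + k *\<^sub>R Z x) x = position Y x + k *\<^sub>R position Z x"
  by (simp add: position_def)

lemma pos_add_scale:
  assumes "q \<in> K" "q' \<in> K" "x \<in> {0..l}"
  shows "pos (q + k *\<^sub>R q') x = pos q x + k *\<^sub>R pos q' x"
proof -
  have tr: "state_trace (\<lambda>x. mode q x + k *\<^sub>R mode q' x) = q + k *\<^sub>R q'"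
    unfolding state_trace_linear using mode_trace assms by simp
  have "sol 0 (\<lambda>x. 0) (\<lambda>x. mode q x + k *\<^sub>R mode q' x)"
    using solves_linear[OF mode_sol[of q] mode_sol[of q'], of k] by simp
  moreover have "q + k *\<^sub>R q' \<in> K" using assms subspace_K subspace_add subspace_scale by blast
  ultimately have "mode q x + k *\<^sub>R mode q' x = mode (q + k *\<^sub>R q') x"
    using mode_unique[of "\<lambda>x. mode q x + k *\<^sub>R mode q' x" x] tr assms(3) by simp
  then show ?thesis
    using position_add_scale[of "mode q" k "mode q'" x] by (simp add: position_def)
qed

lemma pairing_pos_add_scale:
  assumes "q \<in> K" "q' \<in> K" "continuous_on {0..l} b"
  shows "pairing (pos (q + k *\<^sub>R q')) b = pairing (pos q) b + k * pairing (pos q') b"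
proof -
  have "pairing (pos (q + k *\<^sub>R q')) b = pairing (\<lambda>x. pos q x + k *\<^sub>R pos q' x) b"
    by (rule pairing_cong) (use pos_add_scale assms in auto)
  then show ?thesis by (simp add: pairing_add_scale pos_continuous assms(3))
qed

lemma dirichlet_iff: "state_trace (state U) \<in> vertical \<longleftrightarrow> U \<in> H10 l \<times> H10 l"
  unfolding state_trace_vertical position_state
  by (auto simp: H10_def mem_Times_iff zero_prod_def)

lemma ker_N_iff:
  assumes "U \<in> ker_N l g h"
  shows "Tr l U \<in> K" "\<And>x. x \<in> {0..l} \<Longrightarrow> (fst U x, snd U x) = pos (Tr l U) x"
proof -
  have U: "U \<in> H2 l \<times> H2 l" "U \<in> H10 l \<times> H10 l" "eq_ae l (N_expr l g h U) (\<lambda>x. 0, \<lambda>x. 0)"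
    using assms by (auto simp: ker_N_def dom_N_def)
  have s: "sol 0 (\<lambda>x. 0) (state U)"
    using state_sol[OF U(1,3)] by (simp add: zero_prod_def)
  show TK: "Tr l U \<in> K"
  proof -
    have "state_trace (state U) \<in> Lambda_path l g h 0"
      unfolding Lambda_path_eq using state_trace_sol[OF s] by (rule range_eqI)
    moreover have "state_trace (state U) \<in> vertical" using U(2) by (simp only: dirichlet_iff)
    ultimately show ?thesis by (simp only: K_def Tr_state IntI)
  qed
  show "(fst U x, snd U x) = pos (Tr l U) x" if "x \<in> {0..l}" for x
    using mode_unique[OF s _ that] TK by (simp add: Tr_state position_state[symmetric] position_def)
qed

lemma ker_N_continuous:
  assumes "U \<in> ker_N l g h"
  shows "continuous_on {0..l} (\<lambda>x. (fst U x, snd U x))"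
  by (rule continuous_on_eq[OF pos_continuous]) (rule ker_N_iff(2)[OF assms, symmetric])

lemma ker_N_exists:
  assumes q: "q \<in> K"
  shows "\<exists>U. U \<in> ker_N l g h \<and> Tr l U = q"
proof -
  let ?U = "((\<lambda>x. fst (fst (mode q x))), (\<lambda>x. fst (snd (mode q x))))"
  note s = sol_state[OF mode_sol[of q]]
  have 1: "?U \<in> H2 l \<times> H2 l" "eq_ae l (N_expr l g h ?U) (\<lambda>x. 0, \<lambda>x. 0)"
    "\<And>x. x \<in> {0..l} \<Longrightarrow> state ?U x = mode q x"
    using s by (auto simp: fst_zero snd_zero)
  have tr: "Tr l ?U = q"
    unfolding Tr_state using 1(3) l mode_trace[OF q] state_trace_cong[of "state ?U" "mode q"] by auto
  then have "state_trace (state ?U) \<in> vertical" using q by (simp add: Tr_state K_def)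
  then have "?U \<in> ker_N l g h"
    using 1 dirichlet_iff by (auto simp: ker_N_def dom_N_def)
  then show ?thesis using tr by blast
qed

lemma first_order_form_eq:
  assumes q: "q \<in> K"
  shows "first_order_form l g h q = - pairing (pos q) (pos q)"
  unfolding first_order_form_def
proof (rule the_equality)
  have val: "inner_L2 l U (S_map U) = pairing (pos (Tr l U)) (pos (Tr l U))" if U: "U \<in> ker_N l g h" for U
  proof -
    have c: "continuous_on {0..l} (\<lambda>x. (fst U x, snd U x))"
      by (rule ker_N_continuous[OF U])
    show ?thesis
      unfolding inner_L2_pairing[OF c c] by (intro pairing_cong ker_N_iff(2)[OF U])
  qed
  obtain U where U: "U \<in> ker_N l g h" "Tr l U = q" using ker_N_exists[OF q] by blast
  then show "\<exists>U\<in>ker_N l g h. q = Tr l U \<and> - pairing (pos q) (pos q) = - inner_L2 l U (S_map U)"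
    using val by auto
  show "r = - pairing (pos q) (pos q)" if "\<exists>U\<in>ker_N l g h. q = Tr l U \<and> r = - inner_L2 l U (S_map U)" for r
    using that val by auto
qed

end

text \<open>
  From here on the first order form vanishes identically.  By polarization the kernel of \<open>N\<close> is
  orthogonal to its image under \<open>S\<close>, which is the solvability condition for \<open>N V = U\<close>.
\<close>

locale degenerate_crossing = nls_system +
  assumes first_order_zero: "\<forall>q\<in>K. first_order_form l g h q = 0"
begin

lemma pairing_pos_zero:
  assumes "q \<in> K" "q' \<in> K"
  shows "pairing (pos q) (pos q') = 0"
proof -
  have z: "pairing (pos q) (pos q) = 0" if "q \<in> K" for q
    using first_order_zero first_order_form_eq[OF that] that by auto
  have "q + 1 *\<^sub>R q' \<in> K" using assms subspace_K subspace_add by auto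
  from z[OF this]
  have "pairing (pos q) (pos (q + 1 *\<^sub>R q')) + 1 * pairing (pos q') (pos (q + 1 *\<^sub>R q')) = 0"
    using pairing_pos_add_scale[OF assms pos_continuous, of 1] by simp
  moreover have "pairing (pos p) (pos (q + 1 *\<^sub>R q')) = pairing (pos q) (pos p) + 1 * pairing (pos q') (pos p)" for p
    unfolding pairing_commute[of "pos p"] by (rule pairing_pos_add_scale[OF assms pos_continuous])
  ultimately show ?thesis
    using z[OF assms(1)] z[OF assms(2)] pairing_commute[of "pos q'" "pos q"] by simp
qed

text \<open>
  Start from any solution \<open>W\<close> of the differential equation \<open>N W = U\<close>.  By Green's formula and
  \<open>\<langle>U', S U\<rangle> = 0\<close> for all \<open>U'\<close> in the kernel, its trace annihilates \<open>\<Lambda>(0,1) \<inter> \<D>\<close>, and so it is the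
  sum of a trace of a homogeneous solution and a vertical vector.  Subtracting the homogeneous solution
  enforces the boundary conditions.
\<close>

lemma preimage_exists:
  assumes q: "q \<in> K"
  shows "\<exists>V. sol 0 (pos q) V \<and> state_trace V \<in> vertical"
proof -
  obtain W where W: "sol 0 (pos q) W" using sol_exists[OF pos_continuous] by blast
  have "omega m (state_trace W) = 0" if m: "m \<in> Lambda_path l g h 0 \<inter> vertical" for m
  proof -
    have mK: "m \<in> K" using m by (simp add: K_def)
    have "omega (state_trace (mode m)) (state_trace W) = pairing (position W) (\<lambda>x. 0) - pairing (pos m) (pos q)"
      by (rule omega_trace_pairing[OF mode_sol W]) (auto intro: pos_continuous)
    also have "\<dots> = 0" using pairing_pos_zero[OF mK q] by (simp add: pairing_def crossed_def)
    finally show ?thesis using mode_trace[OF mK] by simp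
  qed
  then have "\<exists>a\<in>Lambda_path l g h 0. \<exists>d\<in>vertical. state_trace W = a + d"
    by (rule lagrangian_annihilator_Int[OF Lambda_lagrangian vertical_lagrangian])
  then obtain a d where "a \<in> Lambda_path l g h 0" and d: "d \<in> vertical" "state_trace W = a + d" by blast
  then obtain y where "a = trace_frame 0 y" unfolding Lambda_path_eq by blast
  with d have yd: "state_trace W = trace_frame 0 y + d" "d \<in> vertical" by simp_all
  have "sol 0 (pos q) (\<lambda>x. W x + (-1) *\<^sub>R flow 0 y x)"
    using solves_linear[OF W flow(2)[of 0 y], of "-1"] by simp
  moreover have "state_trace (\<lambda>x. W x + (-1) *\<^sub>R flow 0 y x) = d"
    unfolding state_trace_linear using yd(1) by (simp add: trace_frame_def)
  ultimately show ?thesis using yd(2) by blast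
qed

definition pre :: "4 phase \<Rightarrow> real \<Rightarrow> state" where
  "pre q = (SOME V. sol 0 (pos q) V \<and> state_trace V \<in> vertical)"

lemma pre: "q \<in> K \<Longrightarrow> sol 0 (pos q) (pre q)" "q \<in> K \<Longrightarrow> state_trace (pre q) \<in> vertical"
  using someI_ex[OF preimage_exists] unfolding pre_def by blast+

lemma pre_continuous: "q \<in> K \<Longrightarrow> continuous_on {0..l} (position (pre q))"
  by (rule solves_position_continuous[OF pre(1)])

text \<open>
  The polarization of half the second order form, \<open>- \<langle>U', S V\<rangle>\<close> with \<open>N V = U\<close>.
\<close>

definition form2 :: "4 phase \<Rightarrow> 4 phase \<Rightarrow> real" where
  "form2 q' q = - pairing (pos q') (position (pre q))"

lemma vertical_omega: "d \<in> vertical \<Longrightarrow> e \<in> vertical \<Longrightarrow> omega d e = 0"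
  by (rule lagrangianD(3)[OF vertical_lagrangian])

lemma sym_form_on_form2: "sym_form_on K form2"
  unfolding sym_form_on_def
proof (intro conjI subspace_K ballI allI)
  show "form2 (x + y) z = form2 x z + form2 y z" if "x \<in> K" "y \<in> K" "z \<in> K" for x y z
    using pairing_pos_add_scale[OF that(1,2) pre_continuous[OF that(3)], of 1] by (simp add: form2_def)
  show "form2 (c *\<^sub>R x) y = c * form2 x y" if "x \<in> K" "y \<in> K" for c x y
    using pairing_pos_add_scale[OF subspace_0[OF subspace_K] that(1) pre_continuous[OF that(2)], of c]
      pairing_pos_add_scale[OF subspace_0[OF subspace_K] subspace_0[OF subspace_K] pre_continuous[OF that(2)], of 1]
    by (simp add: form2_def)
  show "form2 x y = form2 y x" if "x \<in> K" "y \<in> K" for x y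
    using omega_trace_pairing[OF pre(1)[OF that(1)] pre(1)[OF that(2)] pos_continuous pos_continuous]
      vertical_omega[OF pre(2)[OF that(1)] pre(2)[OF that(2)]]
      pairing_commute[of "pos x"] pairing_commute[of "pos y"]
    by (simp add: form2_def)
qed

text \<open>
  Two preimages \<open>V\<close> of \<open>U\<close> differ by an element of the kernel, which does not change \<open>\<langle>V, S U\<rangle>\<close>.
\<close>

lemma second_order_form_eq:
  assumes q: "q \<in> K"
  shows "second_order_form l g h q = 2 * form2 q q"
  unfolding second_order_form_def
proof (rule the_equality)
  have val: "inner_L2 l V (S_map U) = pairing (position (pre q)) (pos q)"
    if U: "U \<in> ker_N l g h" and V: "V \<in> dom_N l" and qU: "q = Tr l U" and eq: "eq_ae l (N_expr l g h V) U" for U V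
  proof -
    have cU: "continuous_on {0..l} (\<lambda>x. (fst U x, snd U x))"
      by (rule ker_N_continuous[OF U])
    have V2: "V \<in> H2 l \<times> H2 l" "V \<in> H10 l \<times> H10 l" using V by (auto simp: dom_N_def)
    have "sol 0 (\<lambda>x. (fst U x, snd U x)) (state V)"
      using continuous_on_fst[OF cU] continuous_on_snd[OF cU] by (intro state_sol[OF V2(1) eq]) simp_all
    then have s: "sol 0 (pos q) (state V)"
      by (rule solves_cong) (simp add: ker_N_iff(2)[OF U] qU)
    have cV: "continuous_on {0..l} (\<lambda>x. (fst V x, snd V x))"
      using solves_position_continuous[OF s] by (simp add: position_state[abs_def])
    let ?D = "\<lambda>x. state V x + (-1) *\<^sub>R pre q x"
    have D: "sol 0 (\<lambda>x. 0) ?D" using solves_linear[OF s pre(1)[OF q], of "-1"] by simp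
    have "state_trace ?D \<in> vertical"
      unfolding state_trace_linear using pre(2)[OF q] V2(2)[folded dirichlet_iff] subspace_vertical
      by (intro subspace_add subspace_scale) auto
    then have DK: "state_trace ?D \<in> K" using state_trace_sol[OF D] by (auto simp: K_def Lambda_path_eq)
    have "pairing (position ?D) (pos q) = pairing (pos (state_trace ?D)) (pos q)"
      using mode_unique[OF D DK] by (intro pairing_cong) (simp_all add: position_def)
    also have "\<dots> = 0" by (rule pairing_pos_zero[OF DK q])
    finally have 0: "pairing (position ?D) (pos q) = 0" .
    have "pairing (\<lambda>x. position (state V) x + (-1) *\<^sub>R position (pre q) x) (pos q) = 0"
    proof -
      have "position ?D = (\<lambda>x. position (state V) x + (-1) *\<^sub>R position (pre q) x)"
        by (rule ext) (simp add: position_def)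
      with 0 show ?thesis by (simp only:)
    qed
    then have "pairing (position (state V)) (pos q) = pairing (position (pre q)) (pos q)"
      by (subst (asm) pairing_add_scale)
        (auto intro: pos_continuous pre_continuous[OF q] solves_position_continuous[OF s])
    moreover have "inner_L2 l V (S_map U) = pairing (position (state V)) (pos q)"
      unfolding inner_L2_pairing[OF cU cV]
      by (rule pairing_cong) (simp_all add: position_state ker_N_iff(2)[OF U] qU)
    ultimately show ?thesis by simp
  qed
  have f: "2 * form2 q q = - 2 * pairing (position (pre q)) (pos q)"
    by (simp add: form2_def pairing_commute)
  obtain U where U: "U \<in> ker_N l g h" "Tr l U = q" using ker_N_exists[OF q] by blast
  let ?V = "((\<lambda>x. fst (fst (pre q x))), (\<lambda>x. fst (snd (pre q x))))"
  note s = sol_state[OF pre(1)[OF q] pos_continuous]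
  have "state_trace (state ?V) = state_trace (pre q)" using s(3) l by (intro state_trace_cong) auto
  then have "?V \<in> dom_N l" using s(1) pre(2)[OF q] dirichlet_iff[of ?V] by (auto simp: dom_N_def)
  moreover have "eq_ae l (N_expr l g h ?V) U"
  proof -
    have "AE x in lebesgue_on {0..l}. x \<in> {0..l}"
      using AE_space[of "lebesgue_on {0..l}"] by simp
    with s(2)[unfolded eq_ae_def] show ?thesis
      unfolding eq_ae_def
    proof eventually_elim
      case (elim x)
      then show ?case using ker_N_iff(2)[OF U(1), of x] U(2) by (metis fst_conv snd_conv)
    qed
  qed
  ultimately show "\<exists>U\<in>ker_N l g h. \<exists>V\<in>dom_N l. q = Tr l U \<and> eq_ae l (N_expr l g h V) U \<and>
      2 * form2 q q = - 2 * inner_L2 l V (S_map U)"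
    using val[OF U(1)] U f by (intro bexI[of _ U] bexI[of _ ?V]) auto
  show "r = 2 * form2 q q" if "\<exists>U\<in>ker_N l g h. \<exists>V\<in>dom_N l. q = Tr l U \<and> eq_ae l (N_expr l g h V) U \<and>
      r = - 2 * inner_L2 l V (S_map U)" for r
    using that val f by auto
qed

text \<open>
  With \<open>N U = 0\<close>, \<open>N V = U\<close> and \<open>N W = V\<close>, the function \<open>U + t V + t\<^sup>2 W\<close> solves \<open>N T = t T\<close> up to
  an error of order \<open>t\<^sup>3\<close>.  The solution with the same initial values therefore has a trace that
  is known up to this order, and its pairing with a vertical vector of \<open>\<Lambda>(0,1)\<close> is of second order.
\<close>

lemma mode_curve:
  assumes q: "q \<in> K"
  shows "\<exists>c C. (\<forall>\<^sub>F t in at 0 within {0<..}. c t \<in> Lambda_path l g h t) \<and> (c \<longlongrightarrow> q) (at 0 within {0<..}) \<and>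
    (\<forall>\<^sub>F t in at 0 within {0<..}. norm (fst (c t)) \<le> C * t\<^sup>2) \<and>
    (\<forall>q'\<in>K. ((\<lambda>t. omega q' (c t) / t\<^sup>2) \<longlongrightarrow> form2 q' q) (at 0 within {0<..}))"
proof -
  let ?F = "at (0::real) within {0<..}"
  let ?U = "mode q" and ?V = "pre q"
  obtain W where W: "sol 0 (position ?V) W" using sol_exists[OF pre_continuous[OF q]] by blast
  \<comment> \<open>The approximate solution \<open>T t\<close> and its distance \<open>R t\<close> to the solution with the same initial values.\<close>
  define T where "T t x = ?U x + t *\<^sub>R (?V x + t *\<^sub>R W x)" for t x
  define R where "R t x = flow t (T t 0) x + (-1) *\<^sub>R T t x" for t x
  have cW: "continuous_on {0..l} (position W)" by (rule solves_position_continuous[OF W])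
  have solT: "sol t (\<lambda>x. (- (t ^ 3)) *\<^sub>R position W x) (T t)" for t
  proof -
    have "sol 0 (\<lambda>x. 0 + t *\<^sub>R (pos q x + t *\<^sub>R position ?V x)) (T t)"
      unfolding T_def by (intro solves_linear mode_sol pre(1)[OF q] W)
    from solves_change_parameter[OF this, of t] show ?thesis
    proof (rule solves_cong)
      fix x assume "x \<in> {0..l}"
      have "position (T t) x = pos q x + t *\<^sub>R (position ?V x + t *\<^sub>R position W x)"
        by (simp add: T_def position_def)
      then show "0 + t *\<^sub>R (pos q x + t *\<^sub>R position ?V x) + (0 - t) *\<^sub>R position (T t) x =
          (- (t ^ 3)) *\<^sub>R position W x"
        by (simp add: algebra_simps power3_eq_cube)
    qed
  qed
  have solR: "sol t (\<lambda>x. (t ^ 3) *\<^sub>R position W x) (R t)" for t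
    unfolding R_def using solves_linear[OF flow(2)[of t "T t 0"] solT[of t], of "-1"] by (simp add: scaleR_minus_left)
  have "bounded (position W ` {0..l})" using compact_continuous_image[OF cW] compact_imp_bounded by blast
  then obtain C where C: "0 < C" "\<And>x. x \<in> {0..l} \<Longrightarrow> norm (position W x) \<le> C" unfolding bounded_pos by auto
  obtain E where E: "growth_bound 1 E" using growth_bound_exists[of 1] by auto
  then have E0: "0 < E" by (simp add: growth_bound_def)
  have Rb: "norm (state_trace (R t)) \<le> 2 * (E * (t ^ 3 * C))" if t: "0 < t" "t \<le> 1" for t
  proof -
    have b: "norm (R t x) \<le> E * (norm (R t 0) + t ^ 3 * C)" if "x \<in> {0..l}" for x
      using t C by (intro growth_boundD[OF E _ solR _ _ that]) (auto intro: mult_left_mono)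
    have "R t 0 = 0" by (simp add: R_def flow(1))
    then have "norm (R t 0) \<le> E * (t ^ 3 * C)" "norm (R t l) \<le> E * (t ^ 3 * C)"
      using b[of 0] b[of l] l by auto
    then show ?thesis using state_trace_norm_le[of "R t"] by linarith
  qed
  define c where "c t = trace_frame t (T t 0)" for t
  have c: "c t = q + t *\<^sub>R (state_trace ?V + t *\<^sub>R state_trace W) + state_trace (R t)" for t
  proof -
    have "state_trace (R t) = c t + (-1) *\<^sub>R state_trace (T t)"
      unfolding R_def state_trace_linear by (simp add: c_def trace_frame_def)
    moreover have "state_trace (T t) = q + t *\<^sub>R (state_trace ?V + t *\<^sub>R state_trace W)"
      unfolding T_def state_trace_linear using mode_trace[OF q] by simp
    ultimately show ?thesis by simp
  qed
  have small: "\<forall>\<^sub>F t in ?F. 0 < t \<and> t \<le> 1"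
    unfolding eventually_at by (intro exI[of _ 1]) (auto simp: dist_real_def)
  have R0: "((\<lambda>t. state_trace (R t) /\<^sub>R t\<^sup>2) \<longlongrightarrow> 0) ?F"
  proof (rule Lim_null_comparison)
    from small show "\<forall>\<^sub>F t in ?F. norm (state_trace (R t) /\<^sub>R t\<^sup>2) \<le> 2 * (E * (t * C))"
    proof eventually_elim
      case (elim t)
      have "norm (state_trace (R t) /\<^sub>R t\<^sup>2) = norm (state_trace (R t)) / t\<^sup>2"
        by (simp add: divide_inverse mult.commute)
      also have "\<dots> \<le> 2 * (E * (t ^ 3 * C)) / t\<^sup>2" using Rb elim by (intro divide_right_mono) auto
      also have "\<dots> = 2 * (E * (t * C))" using elim by (simp add: power3_eq_cube power2_eq_square)
      finally show ?case .
    qed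
    have "((\<lambda>t. 2 * (E * (t * C))) \<longlongrightarrow> 2 * (E * (0 * C))) ?F" by (intro tendsto_intros)
    then show "((\<lambda>t. 2 * (E * (t * C))) \<longlongrightarrow> 0) ?F" by simp
  qed
  have Rt: "\<forall>\<^sub>F t in ?F. state_trace (R t) = t\<^sup>2 *\<^sub>R (state_trace (R t) /\<^sub>R t\<^sup>2)"
    using small by eventually_elim simp
  have lim: "(c \<longlongrightarrow> q) ?F"
  proof -
    have "((\<lambda>t. q + t *\<^sub>R (state_trace ?V + t *\<^sub>R state_trace W) + t\<^sup>2 *\<^sub>R (state_trace (R t) /\<^sub>R t\<^sup>2)) \<longlongrightarrow>
        q + 0 *\<^sub>R (state_trace ?V + 0 *\<^sub>R state_trace W) + 0\<^sup>2 *\<^sub>R 0) ?F"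
      by (intro tendsto_intros R0)
    then have "((\<lambda>t. q + t *\<^sub>R (state_trace ?V + t *\<^sub>R state_trace W) + t\<^sup>2 *\<^sub>R (state_trace (R t) /\<^sub>R t\<^sup>2)) \<longlongrightarrow> q) ?F"
      by simp
    moreover have "\<forall>\<^sub>F t in ?F. q + t *\<^sub>R (state_trace ?V + t *\<^sub>R state_trace W) + t\<^sup>2 *\<^sub>R (state_trace (R t) /\<^sub>R t\<^sup>2) = c t"
      using Rt by eventually_elim (simp add: c)
    ultimately show ?thesis by (subst (asm) tendsto_cong)
  qed
  have fst0: "fst q = 0" "fst (state_trace ?V) = 0"
    using q pre(2)[OF q] by (auto simp: K_def mem_vertical)
  have bound: "\<forall>\<^sub>F t in ?F. norm (fst (c t)) \<le> (norm (state_trace W) + 2 * (E * C)) * t\<^sup>2"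
    using small
  proof eventually_elim
    case (elim t)
    have "fst (c t) = t\<^sup>2 *\<^sub>R fst (state_trace W) + fst (state_trace (R t))"
      unfolding c by (simp add: fst0 power2_eq_square)
    then have "norm (fst (c t)) \<le> t\<^sup>2 * norm (fst (state_trace W)) + norm (fst (state_trace (R t)))"
      using norm_triangle_ineq[of "t\<^sup>2 *\<^sub>R fst (state_trace W)" "fst (state_trace (R t))"] by simp
    also have "\<dots> \<le> t\<^sup>2 * norm (state_trace W) + 2 * (E * (t ^ 3 * C))"
    proof (rule add_mono)
      show "t\<^sup>2 * norm (fst (state_trace W)) \<le> t\<^sup>2 * norm (state_trace W)"
        by (intro mult_left_mono) (simp_all add: norm_fst_le[of "fst (state_trace W)" "snd (state_trace W)", unfolded prod.collapse])
      show "norm (fst (state_trace (R t))) \<le> 2 * (E * (t ^ 3 * C))"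
        using Rb[of t] elim norm_fst_le[of "fst (state_trace (R t))" "snd (state_trace (R t))"] unfolding prod.collapse by linarith
    qed
    also have "2 * (E * (t ^ 3 * C)) \<le> 2 * (E * (t\<^sup>2 * C))"
      using elim E0 C(1) by (intro mult_left_mono mult_right_mono power_decreasing) auto
    finally show ?case by (simp add: algebra_simps)
  qed
  have slope: "((\<lambda>t. omega q' (c t) / t\<^sup>2) \<longlongrightarrow> form2 q' q) ?F" if q': "q' \<in> K" for q'
  proof -
    have "omega q' q = 0" "omega q' (state_trace ?V) = 0"
      using q q' pre(2)[OF q] by (auto simp: K_def intro: vertical_omega)
    note z = this
    have "omega (state_trace (mode q')) (state_trace W) = pairing (position W) (\<lambda>x. 0) - pairing (pos q') (position ?V)"
      by (rule omega_trace_pairing[OF mode_sol W]) (auto intro: pre_continuous[OF q])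
    then have qW: "omega q' (state_trace W) = form2 q' q"
      using mode_trace[OF q'] by (simp add: form2_def pairing_def crossed_def)
    have "((\<lambda>t. form2 q' q + omega q' (state_trace (R t) /\<^sub>R t\<^sup>2)) \<longlongrightarrow> form2 q' q + omega q' 0) ?F"
      by (intro tendsto_add tendsto_const bounded_bilinear.tendsto[OF bounded_bilinear_omega] R0)
    then have "((\<lambda>t. form2 q' q + omega q' (state_trace (R t) /\<^sub>R t\<^sup>2)) \<longlongrightarrow> form2 q' q) ?F"
      by (simp add: bounded_bilinear.zero_right[OF bounded_bilinear_omega])
    moreover have "\<forall>\<^sub>F t in ?F. form2 q' q + omega q' (state_trace (R t) /\<^sub>R t\<^sup>2) = omega q' (c t) / t\<^sup>2"
      using small
    proof eventually_elim
      case (elim t)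
      have "omega q' (c t) = t\<^sup>2 * form2 q' q + omega q' (state_trace (R t))"
        unfolding c by (simp add: omega_simps z qW power2_eq_square)
      then show ?case using elim by (simp add: omega_simps field_simps)
    qed
    ultimately show ?thesis by (subst (asm) tendsto_cong)
  qed
  have "c t \<in> Lambda_path l g h t" for t by (simp add: c_def Lambda_path_eq)
  then show ?thesis using lim bound slope
    by (intro exI[of _ c] exI[of _ "norm (state_trace W) + 2 * (E * C)"]) auto
qed

text \<open>
  The increase of \<open>steep \<tau>\<close> to the right of \<open>0\<close> is the number of negative squares of \<open>form2\<close>, and
  \<open>second_order_form\<close> is twice the diagonal of \<open>form2\<close>.
\<close>

lemma maslov_index_degenerate:
  assumes nd: "nondegenerate_on K (second_order_form l g h)"
  shows "\<exists>\<epsilon>0>0. \<forall>\<epsilon>. 0 < \<epsilon> \<and> \<epsilon> < \<epsilon>0 \<longrightarrow>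
    maslov_index (Lambda_path l g h) vertical 0 \<epsilon> = - int (n_neg K (second_order_form l g h))"
proof -
  let ?L = "Lambda_path l g h" and ?F = "at (0::real) within {0<..}"
  obtain \<tau> where \<tau>: "transv \<tau> (?L 0)" using transv_exists[OF Lambda_lagrangian] by blast
  have nondeg: "x = 0" if x: "x \<in> K" "\<forall>y\<in>K. form2 x y = 0" for x
  proof -
    have sf: "sym_form_on K (\<lambda>x y. 2 * form2 x y)"
      using sym_form_on_form2 unfolding sym_form_on_def by (auto simp: algebra_simps)
    have "polar_form (second_order_form l g h) x y = 0" if "y \<in> K" for y
      using polar_form_diagonal[OF sf x(1) that, of "second_order_form l g h"] second_order_form_eq x(2) that by simp
    then show ?thesis using nd x(1) unfolding nondegenerate_on_def by blast
  qed
  have "\<forall>\<^sub>F t in ?F. steep \<tau> (?L t) = steep \<tau> (?L 0) + n_neg (?L 0 \<inter> vertical) (\<lambda>q. form2 q q) \<and>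
      ?L t \<inter> vertical = {0}"
  proof (rule steep_eventually_near_crossing[where \<delta> = "\<lambda>t. t\<^sup>2" and b = form2])
    show "\<forall>\<^sub>F t in ?F. ?L t \<in> lagrangians" using Lambda_lagrangian by simp
    show "?L 0 \<in> lagrangians" by (rule Lambda_lagrangian)
    show "subspace_tendsto ?L (?L 0) ?F" by (rule Lambda_tendsto)
    show "transv \<tau> (?L 0)" by (rule \<tau>)
    show "sym_form_on (?L 0 \<inter> vertical) form2" by (rule sym_form_on_form2[unfolded K_def])
    show "x = 0" if "x \<in> ?L 0 \<inter> vertical" "\<forall>y\<in>?L 0 \<inter> vertical. form2 x y = 0" for x
      using that by (rule nondeg[unfolded K_def])
    show "\<exists>c C. (\<forall>\<^sub>F t in ?F. c t \<in> ?L t) \<and> (c \<longlongrightarrow> q) ?F \<and>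
        (\<forall>\<^sub>F t in ?F. norm (fst (c t)) \<le> C * t\<^sup>2) \<and>
        (\<forall>q'\<in>?L 0 \<inter> vertical. ((\<lambda>t. omega q' (c t) / t\<^sup>2) \<longlongrightarrow> form2 q' q) ?F)"
      if "q \<in> ?L 0 \<inter> vertical" for q
      using that by (rule mode_curve[unfolded K_def])
    show "\<forall>\<^sub>F t in ?F. 0 < t\<^sup>2" by (auto simp: eventually_at_filter)
    show "((\<lambda>t. t\<^sup>2) \<longlongrightarrow> 0) ?F" by (rule tendsto_eq_intros refl)+ simp
  qed
  moreover have "\<forall>\<^sub>F t in at 0. transv \<tau> (?L t)"
    using Lambda_lagrangian Lambda_tendsto \<tau> by (intro eventually_transv) simp_all
  moreover have "n_neg K (second_order_form l g h) = n_neg K (\<lambda>q. form2 q q)"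
    using n_neg_cong[of K "second_order_form l g h" "\<lambda>q. 2 * form2 q q"] second_order_form_eq
      n_neg_scale[of 2 K "\<lambda>q. form2 q q"] by simp
  ultimately obtain d1 d2 where d: "d1 > 0" "d2 > 0"
    "\<And>t. 0 < t \<Longrightarrow> t < d1 \<Longrightarrow> steep \<tau> (?L t) = steep \<tau> (?L 0) + n_neg K (second_order_form l g h)"
    "\<And>t. t \<noteq> 0 \<Longrightarrow> \<bar>t\<bar> < d2 \<Longrightarrow> transv \<tau> (?L t)"
    unfolding eventually_at by (auto simp: dist_real_def K_def)
  have "maslov_index ?L vertical 0 \<epsilon> = - int (n_neg K (second_order_form l g h))"
    if \<epsilon>: "0 < \<epsilon>" "\<epsilon> < min d1 d2" for \<epsilon>
  proof -
    have "transv \<tau> (?L t)" if "t \<in> {0..\<epsilon>}" for t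
      using d(4)[of t] \<tau> that \<epsilon> by (cases "t = 0") auto
    then have "maslov_index ?L vertical 0 \<epsilon> = int (steep \<tau> (?L 0)) - int (steep \<tau> (?L \<epsilon>))"
      by (intro maslov_index_in_chart Lambda_continuous \<epsilon>) auto
    then show ?thesis using d(3)[of \<epsilon>] \<epsilon> by simp
  qed
  then show ?thesis using d(1,2) by (intro exI[of _ "min d1 d2"]) auto
qed

end

theorem proposition4p15:
  fixes l :: real and g h :: "real \<Rightarrow> real"
  assumes "0 < l" and "C2_on l g" and "C2_on l h"
    and "crossing (Lambda_path l g h) dirichlet 0"
    and "\<forall>q \<in> Lambda_path l g h 0 \<inter> dirichlet. first_order_form l g h q = 0"
    and "nondegenerate_on (Lambda_path l g h 0 \<inter> dirichlet) (second_order_form l g h)"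
  shows "\<exists>\<epsilon>0 > 0. \<forall>\<epsilon>. 0 < \<epsilon> \<and> \<epsilon> < \<epsilon>0 \<longrightarrow>
    maslov_index (Lambda_path l g h) dirichlet 0 \<epsilon> =
      - int (n_neg (Lambda_path l g h 0 \<inter> dirichlet) (second_order_form l g h))"
proof -
  have cont: "continuous_on {0..l} f" if "C2_on l f" for f
    using that unfolding C2_on_def continuous_on_eq_continuous_within
    by (meson DERIV_continuous)
  interpret nls_system l g h
    using assms(1-3) cont by unfold_locales
  have D: "dirichlet = vertical" by (simp add: dirichlet_def vertical_def)
  interpret degenerate_crossing l g h
    using assms(5) by unfold_locales (simp add: K_def D)
  show ?thesis using maslov_index_degenerate assms(6) by (simp add: K_def D)
qed

end
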